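(* Let $f\colon\mathbf{R}^n\to\overline{\mathbf{R}}$ be a lower-semicontinuous semi-algebraic function, and let $U$ be a bounded subset of $\mathbf{R}^n$. Then there exists a number $N>0$ such that the length of any curve of near-maximal slope for $f$ lying in $U$ does not exceed $N$.
   Context: $\overline{\mathbf{R}}=\mathbf{R}\cup\{-\infty,+\infty\}$ and $r^+=\max\{0,r\}$. A function $f$ is semi-algebraic if its epigraph $\{(x,r)\in\mathbf{R}^n\times\mathbf{R}: r\ge f(x)\}$ is a semi-algebraic set, i.e. a finite union of sets each defined by finitely many polynomial equalities and strict inequalities. Slope: for $f(\bar{x})$ finite, $|\nabla f|(\bar{x}):=\limsup_{x\to\bar{x},\,x\ne\bar{x}}\frac{(f(\bar{x})-f(x))^+}{\|\bar{x}-x\|}$. Limiting slope: $\overline{|\nabla f|}(\bar{x}):=\liminf|\nabla f|(x)$ over $x$ with $(x,f(x))\to(\bar{x},f(\bar{x}))$ ($x=\bar{x}$ allowed). Curve of near-maximal slope for $f$: a curve $\gamma\colon[a,b]\to\mathbf{R}^n$ such that (a) $\gamma$ is absolutely continuous; (b) $\|\dot\gamma(t)\|=\overline{|\nabla f|}(\gamma(t))$ for a.e. $t\in[a,b]$ (in particular $f(\gamma(t))$ is finite for a.e. $t$); (c) $f\circ\gamma$ is nonincreasing and $(f\circ\gamma)'(t)\le-\big(\overline{|\nabla f|}(\gamma(t))\big)^2$ for a.e. $t\in[a,b]$. The length of an absolutely continuous curve $\gamma$ on $[a,b]$ is $\int_a^b\|\dot\gamma(\tau)\|\,d\tau$. 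*)

theory Defs
  imports "HOL-Analysis.Analysis"
begin

definition lower_semicontinuous :: "('a::topological_space \<Rightarrow> ereal) \<Rightarrow> bool" where
  "lower_semicontinuous f \<longleftrightarrow> (\<forall>x. f x \<le> Liminf (at x) f)"

text \<open>
  On a finite-dimensional space, \<^const>\<open>real_polynomial_function\<close> (the algebra of functions
  generated by the constants and the linear functionals) describes exactly the real polynomials
  in the coordinates.
\<close>

definition basic_semialgebraic :: "'a::euclidean_space set \<Rightarrow> bool" where
  "basic_semialgebraic S \<longleftrightarrow>
     (\<exists>P Q. finite P \<and> finite Q \<and>
        (\<forall>p \<in> P \<union> Q. real_polynomial_function p) \<and>
        S = {z. (\<forall>p \<in> P. p z = 0) \<and> (\<forall>q \<in> Q. q z > 0)})"

definition semialgebraic :: "'a::euclidean_space set \<Rightarrow> bool" where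
  "semialgebraic A \<longleftrightarrow> (\<exists>\<B>. finite \<B> \<and> (\<forall>S \<in> \<B>. basic_semialgebraic S) \<and> A = \<Union>\<B>)"

definition epigraph :: "('a \<Rightarrow> ereal) \<Rightarrow> ('a \<times> real) set" where
  "epigraph f = {(x, r). ereal r \<ge> f x}"

definition semialgebraic_function :: "('a::euclidean_space \<Rightarrow> ereal) \<Rightarrow> bool" where
  "semialgebraic_function f \<longleftrightarrow> semialgebraic (epigraph f)"

text \<open>
  The slope is meaningful only at points where \<open>f\<close> is finite; its value elsewhere is irrelevant.
\<close>

definition slope :: "('a::real_normed_vector \<Rightarrow> ereal) \<Rightarrow> 'a \<Rightarrow> ereal" where
  "slope f x0 = Limsup (at x0) (\<lambda>x. max 0 (f x0 - f x) / ereal (norm (x0 - x)))"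

text \<open>
  The filter below is that of \<open>(x, f x) \<rightarrow> (x0, f x0)\<close>, with \<open>x = x0\<close> allowed: its basic sets
  consist of the \<open>x\<close> near \<open>x0\<close> whose value \<open>f x\<close> is near \<open>f x0\<close>.  If \<open>f x0\<close> is finite, then
  \<open>f x\<close> is eventually finite along it.
\<close>

definition limiting_slope :: "('a::real_normed_vector \<Rightarrow> ereal) \<Rightarrow> 'a \<Rightarrow> ereal" where
  "limiting_slope f x0 =
     Liminf (filtercomap (\<lambda>x. (x, f x)) (nhds (x0, f x0))) (slope f)"

text \<open>
  A finite family of non-overlapping subintervals of \<open>[a, b]\<close> is encoded by the set of pairs of
  their end points.
\<close>

definition absolutely_continuous_curve ::
    "real \<Rightarrow> real \<Rightarrow> (real \<Rightarrow> 'a::metric_space) \<Rightarrow> bool" where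
  "absolutely_continuous_curve a b \<gamma> \<longleftrightarrow>
     (\<forall>\<epsilon>>0. \<exists>\<delta>>0. \<forall>D.
        finite D \<and> (\<forall>(s, t) \<in> D. a \<le> s \<and> s \<le> t \<and> t \<le> b) \<and>
        disjoint_family_on (\<lambda>(s, t). {s<..<t}) D \<and> (\<Sum>(s, t)\<in>D. t - s) < \<delta>
        \<longrightarrow> (\<Sum>(s, t)\<in>D. dist (\<gamma> s) (\<gamma> t)) < \<epsilon>)"

definition velocity ::
    "real \<Rightarrow> real \<Rightarrow> (real \<Rightarrow> 'a::real_normed_vector) \<Rightarrow> real \<Rightarrow> 'a" where
  "velocity a b \<gamma> t = vector_derivative \<gamma> (at t within {a..b})"

text \<open>
  The values of \<open>f \<circ> \<gamma>\<close> are extended reals, whence the \<^const>\<open>real_of_ereal\<close> in its derivative.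
  This is harmless: \<open>f \<circ> \<gamma>\<close> is monotone on \<open>[a, b]\<close> and finite almost everywhere there, hence
  finite on the open interval, although possibly infinite at \<open>a\<close> or \<open>b\<close>.
\<close>

definition near_maximal_slope_curve ::
    "('a::real_normed_vector \<Rightarrow> ereal) \<Rightarrow> real \<Rightarrow> real \<Rightarrow> (real \<Rightarrow> 'a) \<Rightarrow> bool" where
  "near_maximal_slope_curve f a b \<gamma> \<longleftrightarrow>
     a \<le> b \<and>
     absolutely_continuous_curve a b \<gamma> \<and>
     (AE t in lebesgue_on {a..b}.
        \<bar>f (\<gamma> t)\<bar> \<noteq> \<infinity> \<and>
        \<gamma> differentiable (at t within {a..b}) \<and>
        ereal (norm (velocity a b \<gamma> t)) = limiting_slope f (\<gamma> t)) \<and>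
     antimono_on {a..b} (f \<circ> \<gamma>) \<and>
     (AE t in lebesgue_on {a..b}.
        \<exists>d. ((\<lambda>s. real_of_ereal (f (\<gamma> s))) has_real_derivative d) (at t within {a..b}) \<and>
            ereal d \<le> - ((limiting_slope f (\<gamma> t))\<^sup>2))"

text \<open>
  The integral is taken in \<^typ>\<open>ennreal\<close>, so that an upper bound on the length is not met
  vacuously by a default value of the integral.
\<close>

definition curve_length ::
    "real \<Rightarrow> real \<Rightarrow> (real \<Rightarrow> 'a::real_normed_vector) \<Rightarrow> ennreal" where
  "curve_length a b \<gamma> = (\<integral>\<^sup>+ t. ennreal (norm (velocity a b \<gamma> t)) \<partial>lebesgue_on {a..b})"

end

theory Submission
  imports Defs "HOL-Computational_Algebra.Polynomial"
begin

text \<open>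
  Let \<open>m r\<close> be the infimum of the slopes of \<open>f\<close> at the points of level \<open>r\<close> in a ball that
  contains \<open>U\<close>.  By semialgebraicity, a point \<open>X r\<close> of level \<open>r\<close> with slope at most \<open>2 * m r\<close> can be
  chosen so that \<open>X\<close> is a bounded, piecewise monotone and piecewise continuous curve; let \<open>h\<close> be its
  variation function, which is bounded.  Since \<open>f (X r) = r\<close>, the definition of the slope yields
  \<open>dr \<le> 2 * m r * dh\<close>.  Along a curve \<open>\<gamma>\<close> of near-maximal slope, with speed \<open>v\<close>, the value
  \<open>r = f (\<gamma> t)\<close> decreases at least at the rate \<open>v\<^sup>2\<close>, and \<open>m r \<le> v\<close> off finitely many values of \<open>r\<close>.
  Hence \<open>h (f (\<gamma> t))\<close> decreases at least at a rate proportional to \<open>v\<close>, and the integral of \<open>v\<close>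
  is bounded by a multiple of the supremum of \<open>h\<close>.
\<close>

section \<open>Thom's lemma and the extension of sign vectors\<close>

text \<open>No derivative of \<open>X\<close> is taken. A slope limits only how fast
  \<open>f\<close> falls, and along the curve the values do fall; so all estimates compare
  \<open>h r\<close> with \<open>h r'\<close> for \<open>r'\<close> slightly below \<open>r\<close>.

  Two obstacles shape the argument. The limiting slope sees points whose levels are merely close to
  \<open>r\<close>, so \<open>m\<close> must be continuous at \<open>r\<close>; and a slope at most
  \<open>2 * m r\<close> can be selected only if \<open>m r > 0\<close>, since an infimum need not
  be attained. The first is secured off finitely many levels by the monotonicity theorem, the second
  by a Sard property that comes itself from curve selection. An exceptional level is met at most
  once with a negative derivative, hence on a null set of times.

  Tarski--Seidenberg enters in this form: the signs of finitely many polynomials in \<open>x\<close>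
  decide which sign vectors of polynomials in \<open>(x, t)\<close> occur over \<open>x\<close>.
  First-order descriptions of infima, continuity and choice thereby become semialgebraic.\<close>

lemma poly_mono_between:
  fixes p :: "real poly"
  assumes "\<And>v. u \<le> v \<Longrightarrow> v \<le> w \<Longrightarrow> poly (pderiv p) v \<ge> 0" "u \<le> a" "a \<le> b" "b \<le> w"
  shows "poly p a \<le> poly p b"
proof (rule DERIV_nonneg_imp_nondecreasing[OF assms(3)])
  fix x assume "a \<le> x" "x \<le> b"
  then show "\<exists>y. ((poly p) has_real_derivative y) (at x) \<and> 0 \<le> y"
    using assms poly_DERIV[of p x] by (intro exI[of _ "poly (pderiv p) x"]) auto
qed

lemma poly_same_sgn_if_no_root:
  fixes p :: "real poly"
  assumes "\<And>v. min a b \<le> v \<Longrightarrow> v \<le> max a b \<Longrightarrow> poly p v \<noteq> 0"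
  shows "sgn (poly p a) = sgn (poly p b)"
proof -
  have *: "sgn (poly p a) = sgn (poly p b)" if "a < b" "\<And>v. a \<le> v \<Longrightarrow> v \<le> b \<Longrightarrow> poly p v \<noteq> 0" for a b
  proof -
    have "poly p a \<noteq> 0" "poly p b \<noteq> 0" using that by auto
    moreover have "\<not> (poly p a < 0 \<and> 0 < poly p b)" "\<not> (poly p b < 0 \<and> 0 < poly p a)"
      using poly_IVT_pos[OF that(1), of p] poly_IVT_neg[OF that(1), of p] that(2) by (metis less_imp_le)+
    ultimately show ?thesis by (auto simp: sgn_if)
  qed
  show ?thesis
  proof (cases a b rule: linorder_cases)
    case less
    with assms show ?thesis by (intro *) auto
  next
    case greater
    with assms show ?thesis by (intro *[symmetric]) auto
  qed simp
qed

lemma weak_sign_mult_nonneg: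
  fixes c :: real
  assumes "c \<noteq> 0" "sgn (c * y) \<in> {0, \<tau>}"
  shows "\<tau> / c * y \<ge> 0"
proof (cases "c * y = 0")
  case False
  then have "\<tau> = sgn (c * y)" using assms by (auto simp: sgn_eq_0_iff)
  then have "\<tau> / c * y = \<bar>c * y\<bar> / c\<^sup>2" using assms(1)
    by (simp add: sgn_mult abs_mult power2_eq_square abs_sgn field_simps)
  then show ?thesis by simp
qed (use assms in auto)

lemma degree_pos_if_root:
  fixes p :: "real poly"
  assumes "p \<noteq> 0" "poly p t = 0"
  shows "degree p > 0"
proof (rule ccontr)
  assume "\<not> ?thesis"
  then obtain c where "p = [:c:]" by (metis degree_eq_zeroE gr0I)
  then show False using assms by simp
qed

text \<open>
  Thom's lemma.  Constant factors \<open>c\<close> are allowed so that the hypothesis is stable under the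
  reflection \<open>t \<mapsto> - t\<close>.
\<close>

lemma thom_convex:
  fixes q :: "'i \<Rightarrow> real poly"
  assumes closed: "\<And>i. i \<in> I \<Longrightarrow> degree (q i) > 0 \<Longrightarrow> \<exists>j\<in>I. \<exists>c. c \<noteq> 0 \<and> q j = smult c (pderiv (q i))"
    and u: "\<And>i. i \<in> I \<Longrightarrow> sgn (poly (q i) u) \<in> {0, \<sigma> i}"
    and w: "\<And>i. i \<in> I \<Longrightarrow> sgn (poly (q i) w) \<in> {0, \<sigma> i}"
    and "i \<in> I" "u \<le> v" "v \<le> w"
  shows "sgn (poly (q i) v) \<in> {0, \<sigma> i}"
  using \<open>i \<in> I\<close> \<open>u \<le> v\<close> \<open>v \<le> w\<close>
proof (induction "degree (q i)" arbitrary: i v rule: less_induct)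
  case less
  show ?case
  proof (cases "degree (q i) = 0")
    case True
    then obtain c where "q i = [:c:]" by (rule degree_eq_zeroE)
    then show ?thesis using u[of i] less.prems by simp
  next
    case False
    then obtain j c where j: "j \<in> I" "c \<noteq> 0" "q j = smult c (pderiv (q i))"
      using closed[of i] less.prems by blast
    have "degree (q j) < degree (q i)" using j False by (simp add: degree_pderiv)
    then have *: "sgn (c * poly (pderiv (q i)) z) \<in> {0, \<sigma> j}" if "u \<le> z" "z \<le> w" for z
      using less.hyps[OF _ j(1) that] j(3) by auto
    \<comment> \<open>One nonzero multiple of \<open>q i\<close> is increasing on all of
      \<open>{u..w}\<close>, so its value at \<open>v\<close> lies between those at the ends. If
      \<open>\<sigma> j = 0\<close>, the derivative vanishes there and any multiplier
      serves.\<close>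
    have "\<exists>s. s \<noteq> 0 \<and> (\<forall>z. u \<le> z \<longrightarrow> z \<le> w \<longrightarrow> s * poly (pderiv (q i)) z \<ge> 0)"
    proof (cases "\<sigma> j = 0")
      case True
      then show ?thesis using * j(2) by (intro exI[of _ 1]) (auto simp: sgn_eq_0_iff)
    next
      case False
      then show ?thesis using weak_sign_mult_nonneg[OF j(2) *] j(2)
        by (intro exI[of _ "\<sigma> j / c"]) auto
    qed
    then obtain s where s: "s \<noteq> 0" "\<And>z. u \<le> z \<Longrightarrow> z \<le> w \<Longrightarrow> s * poly (pderiv (q i)) z \<ge> 0" by blast
    have "poly (pderiv (smult s (q i))) z \<ge> 0" if "u \<le> z" "z \<le> w" for z
      using s(2)[OF that] by (simp add: pderiv_smult)
    then have "poly (smult s (q i)) u \<le> poly (smult s (q i)) v" "poly (smult s (q i)) v \<le> poly (smult s (q i)) w"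
      using less.prems by (blast intro: poly_mono_between[of u w "smult s (q i)"] order_refl)+
    then have "(poly (q i) u \<le> poly (q i) v \<and> poly (q i) v \<le> poly (q i) w) \<or>
       (poly (q i) u \<ge> poly (q i) v \<and> poly (q i) v \<ge> poly (q i) w)"
      using s(1) by (cases "s > 0") (auto simp: mult_le_cancel_left)
    then show ?thesis using u[OF less.prems(1)] w[OF less.prems(1)]
      by (auto simp: sgn_if split: if_splits)
  qed
qed

text \<open>A derivative positive on a ray has a positive leading coefficient, and so has
  \<open>p\<close>. This supplies a positive value when no further zero of the family lies to the
  right.\<close>

lemma poly_eventually_pos_if_pderiv_pos:
  fixes p :: "real poly"
  assumes "\<And>z. z > t \<Longrightarrow> poly (pderiv p) z > 0"
  shows "\<exists>u > t. poly p u > 0"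
proof -
  have "pderiv p \<noteq> 0" using assms[of "t+1"] by auto
  then have d: "degree p > 0" using pderiv_eq_0_iff by blast
  have "lead_coeff (pderiv p) > 0"
  proof (rule ccontr)
    assume "\<not> ?thesis"
    then have "lead_coeff (- pderiv p) > 0" using \<open>pderiv p \<noteq> 0\<close> leading_coeff_neq_0
      by (metis coeff_minus degree_minus linorder_less_linear neg_0_less_iff_less)
    then obtain n where "\<forall>x\<ge>n. poly (- pderiv p) x \<ge> lead_coeff (- pderiv p)"
      using poly_pinfty_gt_lc by blast
    then have "poly (- pderiv p) (max n (t+1)) > 0" using \<open>lead_coeff (- pderiv p) > 0\<close>
      by (meson less_le_trans max.cobounded1)
    moreover have "poly (pderiv p) (max n (t+1)) > 0" by (rule assms) auto
    ultimately show False by simp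
  qed
  then have "lead_coeff p > 0" using d by (simp add: degree_pderiv coeff_pderiv zero_less_mult_iff)
  then obtain n where "\<forall>x\<ge>n. poly p x \<ge> lead_coeff p" using poly_pinfty_gt_lc by blast
  then have "poly p (max n (t+1)) > 0" using \<open>lead_coeff p > 0\<close>
    by (meson less_le_trans max.cobounded1)
  then show ?thesis by (intro exI[of _ "max n (t+1)"]) auto
qed

text \<open>
  Below, \<open>q\<close> and \<open>q'\<close> are the specializations of one family of parametric polynomials at two values
  of the parameter.
\<close>

definition paired_derivs :: "'i set \<Rightarrow> ('i \<Rightarrow> real poly) \<Rightarrow> ('i \<Rightarrow> real poly) \<Rightarrow> bool" where
  "paired_derivs I q q' \<longleftrightarrow> finite I \<and> (\<forall>i\<in>I. degree (q i) = degree (q' i) \<and>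
     (degree (q i) > 0 \<longrightarrow> (\<exists>j\<in>I. \<exists>c. c \<noteq> 0 \<and> q j = smult c (pderiv (q i)) \<and> q' j = smult c (pderiv (q' i)))))"

definition same_signs :: "'i set \<Rightarrow> ('i \<Rightarrow> real poly) \<Rightarrow> ('i \<Rightarrow> real poly) \<Rightarrow> real \<Rightarrow> real \<Rightarrow> bool" where
  "same_signs I q q' t t' \<longleftrightarrow> (\<forall>i\<in>I. sgn (poly (q i) t) = sgn (poly (q' i) t'))"

lemma same_signsD: "same_signs I q q' t t' \<Longrightarrow> i \<in> I \<Longrightarrow> sgn (poly (q i) t) = sgn (poly (q' i) t')"
  by (simp add: same_signs_def)

text \<open>Identically zero members are left out; for finite \<open>I\<close> such points are then
  finitely many, and the sign vector is constant on intervals free of them.\<close>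

definition vanishes :: "'i set \<Rightarrow> ('i \<Rightarrow> real poly) \<Rightarrow> real \<Rightarrow> bool" where
  "vanishes I q t \<longleftrightarrow> (\<exists>i\<in>I. q i \<noteq> 0 \<and> poly (q i) t = 0)"

text \<open>It is the degree that tells that the partner is nonzero: a nonzero polynomial with a
  root has positive degree, and paired degrees are equal.\<close>

lemma vanishes_same_signs:
  assumes "paired_derivs I q q'" "same_signs I q q' t t'"
  shows "vanishes I q t \<longleftrightarrow> vanishes I q' t'"
proof -
  have *: "vanishes I q' t'"
    if h: "\<And>i. i \<in> I \<Longrightarrow> degree (q i) = degree (q' i)"
      "same_signs I q q' t t'" "vanishes I q t" for q q' :: "'a \<Rightarrow> real poly" and t t'
  proof -
    obtain i where i: "i \<in> I" "q i \<noteq> 0" "poly (q i) t = 0" using h(3) by (auto simp: vanishes_def)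
    then have "degree (q i) > 0" using degree_pos_if_root by blast
    then have "q' i \<noteq> 0" using h(1)[OF i(1)] by auto
    moreover have "poly (q' i) t' = 0" using h(2) i by (metis same_signs_def sgn_0_0)
    ultimately show ?thesis using i(1) by (auto simp: vanishes_def)
  qed
  show ?thesis using *[of q q' t t'] *[of q' q t' t] assms
    by (auto simp: paired_derivs_def same_signs_def)
qed

lemma sgn_eq_if_not_vanishes:
  assumes "\<And>z. min a b \<le> z \<Longrightarrow> z \<le> max a b \<Longrightarrow> \<not> vanishes I q z" "i \<in> I"
  shows "sgn (poly (q i) a) = sgn (poly (q i) b)"
proof (cases "q i = 0")
  case False
  then show ?thesis using assms by (intro poly_same_sgn_if_no_root) (auto simp: vanishes_def)
qed simp

text \<open>
  To the right of \<open>t'\<close> there is room for \<open>p'\<close> to become positive: at the first point \<open>b'\<close> where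
  the sign vector changes, \<open>p'\<close> has the sign of \<open>p\<close> at a partner \<open>b\<close> of \<open>b'\<close>, and by Thom's lemma
  \<open>p\<close> increases from \<open>t\<close> to \<open>b\<close>.
\<close>

lemma positive_to_the_right:
  assumes pd: "paired_derivs I q q'"
    and st: "same_signs I q q' t t'" and nv: "\<not> vanishes I q t"
    and partner: "\<And>u'. \<exists>u. same_signs I q q' u u' \<and>
       (vanishes I q' u' \<longrightarrow> sgn (poly p u) = sgn (poly p' u'))"
    and j0: "j0 \<in> I" "c0 \<noteq> 0" "q j0 = smult c0 (pderiv p)" "q' j0 = smult c0 (pderiv p')"
    and pos: "poly (pderiv p) t > 0" and p0: "poly p t \<ge> 0"
  shows "\<exists>u'>t'. poly p' u' > 0 \<and> (\<forall>z. t' \<le> z \<and> z < u' \<longrightarrow> \<not> vanishes I q' z)"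
proof -
  have nv': "\<not> vanishes I q' t'" using vanishes_same_signs[OF pd st] nv by blast
  have pos': "poly (pderiv p') t' > 0"
  proof -
    have "sgn (poly (q j0) t) = sgn (poly (q' j0) t')" using st j0(1) by (auto simp: same_signs_def)
    then have "sgn (poly (pderiv p) t) = sgn (poly (pderiv p') t')"
      by (simp add: j0 sgn_mult j0(2) sgn_eq_0_iff)
    then show ?thesis using pos by (metis sgn_greater)
  qed
  define B where "B = {z. z > t' \<and> vanishes I q' z}"
  have "finite (\<Union>i\<in>{i\<in>I. q' i \<noteq> 0}. {z. poly (q' i) z = 0})"
    using pd by (auto simp: paired_derivs_def intro!: poly_roots_finite)
  then have finB: "finite B" by (rule rev_finite_subset) (auto simp: B_def vanishes_def)
  show ?thesis
  proof (cases "B = {}")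
    case True
    then have nvr: "\<not> vanishes I q' z" if "z \<ge> t'" for z
      using that nv' by (cases "z = t'") (auto simp: B_def)
    have "poly (pderiv p') z > 0" if "z > t'" for z
    proof -
      have "sgn (poly (q' j0) t') = sgn (poly (q' j0) z)"
        using that nvr j0(1) by (intro sgn_eq_if_not_vanishes) auto
      then have "sgn (poly (pderiv p') t') = sgn (poly (pderiv p') z)"
        by (simp add: j0 sgn_mult j0(2) sgn_eq_0_iff)
      then show ?thesis using pos' by (metis sgn_greater)
    qed
    then show ?thesis using poly_eventually_pos_if_pderiv_pos[of t' p'] nvr by auto
  next
    case False
    define b' where "b' = Min B"
    have b': "b' > t'" "vanishes I q' b'" using Min_in[OF finB False] by (auto simp: b'_def B_def)
    have nvb: "\<not> vanishes I q' z" if "t' \<le> z" "z < b'" for z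
      using that nv' Min_le[OF finB, of z] by (cases "z = t'") (auto simp: b'_def B_def)
    obtain b where b: "same_signs I q q' b b'" "sgn (poly p b) = sgn (poly p' b')"
      using partner[of b'] b' by auto
    \<comment> \<open>Nothing vanishes before \<open>b'\<close>, so by the intermediate value
      theorem a sign present at \<open>t'\<close> can only persist or become zero there.\<close>
    have weak': "sgn (poly (q' i) b') \<in> {0, sgn (poly (q' i) t')}" if i: "i \<in> I" for i
    proof (rule ccontr)
      assume n: "\<not> ?thesis"
      have q0: "q' i \<noteq> 0" using n by auto
      then have z1: "poly (q' i) t' \<noteq> 0" using nv' i by (auto simp: vanishes_def)
      have "poly (q' i) t' * poly (q' i) b' < 0"
        using n z1 by (auto simp: sgn_if mult_less_0_iff split: if_splits)
      then obtain z where "t' < z" "z < b'" "poly (q' i) z = 0" using poly_IVT[OF b'(1)] by auto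
      then show False using nvb[of z] i q0 by (auto simp: vanishes_def)
    qed
    have weak: "sgn (poly (q i) b) \<in> {0, sgn (poly (q i) t)}" if i: "i \<in> I" for i
      using weak'[OF i] b(1) st i by (auto simp: same_signs_def)
    have cl: "\<And>i. i \<in> I \<Longrightarrow> degree (q i) > 0 \<Longrightarrow> \<exists>j\<in>I. \<exists>c. c \<noteq> 0 \<and> q j = smult c (pderiv (q i))"
      using pd unfolding paired_derivs_def by blast
    have between: "sgn (poly (q i) z) \<in> {0, sgn (poly (q i) t)}" if "i \<in> I" "min t b \<le> z" "z \<le> max t b" for i z
    proof (rule thom_convex[where I = I and q = q and \<sigma> = "\<lambda>i. sgn (poly (q i) t)" and u = "min t b" and w = "max t b"])
      show "\<exists>j\<in>I. \<exists>c. c \<noteq> 0 \<and> q j = smult c (pderiv (q i))" if "i \<in> I" "degree (q i) > 0" for i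
        using cl that by blast
    qed (use that weak in \<open>auto simp: min_def max_def\<close>)
    \<comment> \<open>A member that vanishes at \<open>b'\<close> approaches zero monotonically from
      \<open>t'\<close>. By Thom's lemma its partner is monotone in the same direction between
      \<open>b\<close> and \<open>t\<close>; if \<open>b\<close> lay to the left, the partner would
      leave its zero at \<open>b\<close> towards the wrong sign at \<open>t\<close>.\<close>
    have "b > t"
    proof (rule ccontr)
      assume "\<not> b > t"
      then have bt: "b \<le> t" by simp
      obtain i where i: "i \<in> I" "q' i \<noteq> 0" "poly (q' i) b' = 0" using b'(2) by (auto simp: vanishes_def)
      have "degree (q' i) > 0" using i degree_pos_if_root by blast
      moreover have "degree (q i) = degree (q' i)" using pd i(1) by (auto simp: paired_derivs_def)
      ultimately obtain j c where j: "j \<in> I" "c \<noteq> 0" "q j = smult c (pderiv (q i))" "q' j = smult c (pderiv (q' i))"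
        using pd i(1) unfolding paired_derivs_def by metis
      have zb: "poly (q i) b = 0" using b(1) i by (metis same_signs_def sgn_0_0)
      have nzt: "poly (q' i) t' \<noteq> 0" using nv' i by (auto simp: vanishes_def)
      have sgnt: "sgn (poly (q i) t) = sgn (poly (q' i) t')" "sgn (poly (q j) t) = sgn (poly (q' j) t')"
        using st i j by (auto simp: same_signs_def)
      have dj: "sgn (poly (q' j) z) \<in> {0, sgn (poly (q' j) t')}" if "t' \<le> z" "z \<le> b'" for z
        using that weak'[OF j(1)] sgn_eq_if_not_vanishes[of t' z I q' j] nvb j(1)
        by (cases "z = b'") auto
      have dj2: "sgn (poly (q j) z) \<in> {0, sgn (poly (q' j) t')}" if "b \<le> z" "z \<le> t" for z
        using between[OF j(1), of z] that bt sgnt by auto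
      define s where "s = sgn (poly (q' j) t') / c"
      have 1: "s * poly (pderiv (q' i)) z \<ge> 0" if "t' \<le> z" "z \<le> b'" for z
        using dj[OF that] weak_sign_mult_nonneg[OF j(2)] by (simp add: s_def j(4))
      have 2: "s * poly (pderiv (q i)) z \<ge> 0" if "b \<le> z" "z \<le> t" for z
        using dj2[OF that] weak_sign_mult_nonneg[OF j(2)] by (simp add: s_def j(3))
      have "poly (smult s (q' i)) t' \<le> poly (smult s (q' i)) b'"
        using b'(1) by (intro poly_mono_between[of t' b']) (auto simp: pderiv_smult 1)
      moreover have "poly (smult s (q i)) b \<le> poly (smult s (q i)) t"
        using bt by (intro poly_mono_between[of b t]) (auto simp: pderiv_smult 2)
      moreover have "s \<noteq> 0"
      proof -
        have "pderiv (q' i) \<noteq> 0" using \<open>degree (q' i) > 0\<close> pderiv_eq_0_iff[of "q' i"] by auto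
        then have "q' j \<noteq> 0" using j by simp
        then have "poly (q' j) t' \<noteq> 0" using nv' j(1) by (auto simp: vanishes_def)
        then show ?thesis using j(2) by (auto simp: s_def sgn_0_0)
      qed
      ultimately have "s * poly (q' i) t' < 0" "s * poly (q i) t \<ge> 0"
        using nzt zb i(3) by (auto simp: less_le)
      moreover have "sgn (s * poly (q' i) t') = sgn (s * poly (q i) t)"
        using sgnt(1) by (simp add: sgn_mult)
      ultimately show False by (metis not_le sgn_less)
    qed
    have "poly p b > poly p t"
    proof -
      have "poly (pderiv p) z \<ge> 0" if "t \<le> z" "z \<le> b" for z
      proof -
        have "sgn (c0 * poly (pderiv p) z) \<in> {0, sgn (c0 * poly (pderiv p) t)}"
          using between[OF j0(1), of z] that \<open>b > t\<close> by (simp add: j0(3))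
        then have "poly (pderiv p) z = 0 \<or> sgn (poly (pderiv p) z) = sgn (poly (pderiv p) t)"
          using j0(2) by (simp add: sgn_mult sgn_eq_0_iff)
        then show ?thesis using pos by (simp add: sgn_if split: if_splits)
      qed
      note nonneg = this
      \<comment> \<open>Between \<open>t\<close> and \<open>b\<close> the derivative is only known
        to be nonnegative; strict growth comes from its positivity at \<open>t\<close>.\<close>
      obtain d where d: "d > 0" "\<And>h. 0 < h \<Longrightarrow> h < d \<Longrightarrow> poly p t < poly p (t + h)"
        using DERIV_pos_inc_right[OF poly_DERIV[of p t] pos] by auto
      define h where "h = min (d/2) (b - t)"
      have h: "0 < h" "h < d" "t + h \<le> b" using \<open>b > t\<close> d(1) by (auto simp: h_def)
      have "poly p (t + h) \<le> poly p b"
        by (rule poly_mono_between[of t b, OF nonneg]) (use h in auto)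
      then show ?thesis using d(2)[OF h(1,2)] by simp
    qed
    then have "poly p' b' > 0" using b(2) p0 by (auto simp: sgn_if split: if_splits)
    then show ?thesis using b'(1) nvb by auto
  qed
qed

text \<open>On the way from \<open>t'\<close> to a positive value of \<open>p'\<close> the sign
  vector of the family is unchanged, so the intermediate value theorem may stop at any target
  value.\<close>

lemma match_sign_right:
  assumes pd: "paired_derivs I q q'"
    and st: "same_signs I q q' t t'" and nv: "\<not> vanishes I q t"
    and partner: "\<And>u'. \<exists>u. same_signs I q q' u u' \<and>
       (vanishes I q' u' \<longrightarrow> sgn (poly p u) = sgn (poly p' u'))"
    and j0: "j0 \<in> I" "c0 \<noteq> 0" "q j0 = smult c0 (pderiv p)" "q' j0 = smult c0 (pderiv p')"
    and pos: "poly (pderiv p) t > 0" and s: "sgn (poly p' t') < sgn (poly p t)"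
  shows "\<exists>t''. same_signs I q q' t t'' \<and> sgn (poly p t) = sgn (poly p' t'')"
proof -
  have p0: "poly p t \<ge> 0" "poly p' t' \<le> 0" using s by (auto simp: sgn_if split: if_splits)
  obtain u' where u: "u' > t'" "poly p' u' > 0" "\<And>z. t' \<le> z \<Longrightarrow> z < u' \<Longrightarrow> \<not> vanishes I q' z"
    using positive_to_the_right[OF pd st nv partner j0 pos p0(1)] by blast
  \<comment> \<open>The target has the sign of \<open>p\<close> at \<open>t\<close> and stays
    strictly below the value at \<open>u'\<close>, where the family may vanish.\<close>
  define y where "y = (if poly p t = 0 then 0 else poly p' u' / 2)"
  have y: "poly p' t' \<le> y" "y < poly p' u'" "sgn y = sgn (poly p t)"
    using u p0 by (auto simp: y_def sgn_if)
  obtain z where z: "t' \<le> z" "z \<le> u'" "poly p' z = y"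
    using IVT[of "poly p'" t' y u'] y u(1) by auto
  have "z < u'" using z y(2) by (cases "z = u'") auto
  have "sgn (poly (q' i) t') = sgn (poly (q' i) z)" if "i \<in> I" for i
    using that z(1) \<open>z < u'\<close> u(3) by (intro sgn_eq_if_not_vanishes) auto
  then have "same_signs I q q' t z" using st by (simp add: same_signs_def)
  then show ?thesis using z y by auto
qed

section \<open>Reflection of the variable\<close>

definition reflect :: "real poly \<Rightarrow> real poly" where
  "reflect f = pcompose f [:0, -1:]"

lemma poly_reflect [simp]: "poly (reflect f) x = poly f (- x)"
  by (simp add: reflect_def poly_pcompose)

lemma degree_reflect [simp]: "degree (reflect f) = degree f"
  by (simp add: reflect_def degree_pcompose)

lemma reflect_eq_0_iff [simp]: "reflect f = 0 \<longleftrightarrow> f = 0"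
  by (metis poly_reflect minus_minus poly_0 poly_all_0_iff_0)

lemma pderiv_reflect: "pderiv (reflect f) = - reflect (pderiv f)"
  by (simp add: reflect_def pderiv_pcompose pderiv_pCons)

lemma reflect_smult: "reflect (smult c f) = smult c (reflect f)"
  by (simp add: reflect_def pcompose_smult)

text \<open>If \<open>p'\<close> is too large at \<open>t'\<close>, the matching point lies to the
  left. Reflecting the variable and negating \<open>p\<close> keeps the derivative positive and
  turns this into the search to the right.\<close>

lemma match_sign_increasing:
  assumes pd: "paired_derivs I q q'"
    and st: "same_signs I q q' t t'" and nv: "\<not> vanishes I q t"
    and partner: "\<And>u'. \<exists>u. same_signs I q q' u u' \<and>
       (vanishes I q' u' \<longrightarrow> sgn (poly p u) = sgn (poly p' u'))"
    and j0: "j0 \<in> I" "c0 \<noteq> 0" "q j0 = smult c0 (pderiv p)" "q' j0 = smult c0 (pderiv p')"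
    and pos: "poly (pderiv p) t > 0"
  shows "\<exists>t''. same_signs I q q' t t'' \<and> sgn (poly p t) = sgn (poly p' t'')"
proof (cases "sgn (poly p' t')" "sgn (poly p t)" rule: linorder_cases)
  case less
  then show ?thesis using match_sign_right[OF pd st nv partner j0 pos] by blast
next
  case equal
  then show ?thesis using st by auto
next
  case greater
  let ?q = "\<lambda>i. reflect (q i)" and ?q' = "\<lambda>i. reflect (q' i)"
  have ss: "same_signs I ?q ?q' a b \<longleftrightarrow> same_signs I q q' (- a) (- b)" for a b
    by (simp add: same_signs_def)
  have van: "vanishes I ?q a \<longleftrightarrow> vanishes I q (- a)" "vanishes I ?q' a \<longleftrightarrow> vanishes I q' (- a)" for a
    by (auto simp: vanishes_def)
  have "paired_derivs I ?q ?q'"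
    unfolding paired_derivs_def
  proof (intro conjI ballI impI)
    show "finite I" using pd by (simp add: paired_derivs_def)
    fix i assume i: "i \<in> I"
    show "degree (?q i) = degree (?q' i)" using pd i by (simp add: paired_derivs_def)
    assume "degree (?q i) > 0"
    then obtain j c where "j \<in> I" "c \<noteq> 0" "q j = smult c (pderiv (q i))" "q' j = smult c (pderiv (q' i))"
      using pd i unfolding paired_derivs_def by auto
    then show "\<exists>j\<in>I. \<exists>c. c \<noteq> 0 \<and> ?q j = smult c (pderiv (?q i)) \<and> ?q' j = smult c (pderiv (?q' i))"
      by (intro bexI[of _ j] exI[of _ "-c"]) (auto simp: pderiv_reflect reflect_smult)
  qed
  moreover have "same_signs I ?q ?q' (- t) (- t')" "\<not> vanishes I ?q (- t)"
    using st nv by (simp_all add: ss van)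
  moreover have "\<exists>u. same_signs I ?q ?q' u u' \<and>
       (vanishes I ?q' u' \<longrightarrow> sgn (poly (- reflect p) u) = sgn (poly (- reflect p') u'))" for u'
  proof -
    obtain u where "same_signs I q q' u (- u')" "vanishes I q' (- u') \<longrightarrow> sgn (poly p u) = sgn (poly p' (- u'))"
      using partner by blast
    then show ?thesis by (intro exI[of _ "- u"]) (simp add: ss van sgn_minus)
  qed
  moreover have "?q j0 = smult c0 (pderiv (- reflect p))" "?q' j0 = smult c0 (pderiv (- reflect p'))"
    using j0 by (simp_all add: pderiv_reflect pderiv_minus reflect_smult)
  moreover have "poly (pderiv (- reflect p)) (- t) > 0"
    using pos by (simp add: pderiv_reflect pderiv_minus)
  moreover have "sgn (poly (- reflect p') (- t')) < sgn (poly (- reflect p) (- t))"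
    using greater by (simp add: sgn_minus)
  ultimately have "\<exists>t''. same_signs I ?q ?q' (- t) t'' \<and> sgn (poly (- reflect p) (- t)) = sgn (poly (- reflect p') t'')"
    using j0(1,2) by (intro match_sign_right[where t' = "- t'"])
  then show ?thesis by (auto simp: ss sgn_minus)
qed

text \<open>At a zero of the family, \<open>fwd\<close> already matches the sign of
  \<open>p\<close>. Elsewhere the derivative of \<open>p\<close>, being a nonzero member, does not
  vanish, so \<open>p\<close> or \<open>-p\<close> is increasing at \<open>t\<close>.\<close>

lemma sign_vector_extension:
  assumes pd: "paired_derivs I q q'"
    and fwd: "\<And>u. \<exists>u'. same_signs I q q' u u' \<and>
       (vanishes I q u \<longrightarrow> sgn (poly p u) = sgn (poly p' u'))"
    and bwd: "\<And>u'. \<exists>u. same_signs I q q' u u' \<and>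
       (vanishes I q' u' \<longrightarrow> sgn (poly p u) = sgn (poly p' u'))"
    and j0: "j0 \<in> I" "q j0 = pderiv p" "q' j0 = pderiv p'" and "degree p > 0"
  shows "\<exists>t'. same_signs I q q' t t' \<and> sgn (poly p t) = sgn (poly p' t')"
proof (cases "vanishes I q t")
  case True
  then show ?thesis using fwd by blast
next
  case nv: False
  obtain t' where st: "same_signs I q q' t t'" using fwd by blast
  have "pderiv p \<noteq> 0" using \<open>degree p > 0\<close> by (simp add: pderiv_eq_0_iff)
  then have "poly (pderiv p) t \<noteq> 0" using nv j0 by (auto simp: vanishes_def)
  then consider "poly (pderiv p) t > 0" | "poly (pderiv (- p)) t > 0" by (force simp: pderiv_minus)
  then show ?thesis
  proof cases
    case 1
    show ?thesis
      by (rule match_sign_increasing[OF pd st nv bwd, of j0 1]) (use j0 1 in auto)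
  next
    case 2
    have "\<exists>t''. same_signs I q q' t t'' \<and> sgn (poly (- p) t) = sgn (poly (- p') t'')"
      by (rule match_sign_increasing[OF pd st nv, of _ _ j0 "-1"])
         (use bwd j0 2 in \<open>auto simp: pderiv_minus sgn_minus\<close>)
    then show ?thesis by (simp add: sgn_minus)
  qed
qed

section \<open>Sign vectors of parametric polynomials\<close>

text \<open>A parametric polynomial is paired with a bound on its degree in \<open>t\<close>.\<close>

definition param_poly :: "nat \<times> ('a::real_normed_vector \<Rightarrow> real poly) \<Rightarrow> bool" where
  "param_poly P \<longleftrightarrow> (\<forall>x. degree (snd P x) \<le> fst P) \<and>
     (\<forall>i. real_polynomial_function (\<lambda>x. coeff (snd P x) i))"

definition full_degree :: "(nat \<times> ('a \<Rightarrow> real poly)) set \<Rightarrow> 'a \<Rightarrow> bool" where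
  "full_degree F x \<longleftrightarrow> (\<forall>P\<in>F. degree (snd P x) = fst P)"

text \<open>One direction suffices, because the relation \<open>agree\<close> from which it is
  derived is symmetric.\<close>

definition sign_equiv :: "(nat \<times> ('a \<Rightarrow> real poly)) set \<Rightarrow> 'a \<Rightarrow> 'a \<Rightarrow> bool" where
  "sign_equiv F x x' \<longleftrightarrow> (\<forall>t. \<exists>t'. same_signs F (\<lambda>P. snd P x) (\<lambda>P. snd P x') t t')"

definition agree :: "('a \<Rightarrow> real) set \<Rightarrow> 'a \<Rightarrow> 'a \<Rightarrow> bool" where
  "agree A x x' \<longleftrightarrow> (\<forall>a\<in>A. sgn (a x) = sgn (a x'))"

lemma agreeD: "agree A x x' \<Longrightarrow> a \<in> A \<Longrightarrow> sgn (a x) = sgn (a x')"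
  by (simp add: agree_def)

text \<open>The induction statement of quantifier elimination. It is restricted to full degree
  because derivatives and reducts lose their information where a leading coefficient
  vanishes.\<close>

definition controlled :: "(nat \<times> ('a::real_normed_vector \<Rightarrow> real poly)) set \<Rightarrow> bool" where
  "controlled F \<longleftrightarrow> (\<exists>A. finite A \<and> (\<forall>a\<in>A. real_polynomial_function a) \<and>
     (\<forall>x x'. full_degree F x \<and> full_degree F x' \<and> agree A x x' \<longrightarrow> sign_equiv F x x'))"

section \<open>Strata of constant degree\<close>

definition truncation :: "nat \<Rightarrow> ('a \<Rightarrow> real poly) \<Rightarrow> 'a \<Rightarrow> real poly" where
  "truncation k P x = poly_cutoff (Suc k) (P x)"

lemma param_poly_truncation:
  assumes "param_poly P"
  shows "param_poly (k, truncation k (snd P))"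
proof -
  have "real_polynomial_function (\<lambda>x. if i < Suc k then coeff (snd P x) i else 0)" for i
    using assms by (cases "i < Suc k") (auto simp: param_poly_def)
  then show ?thesis
    by (auto simp: param_poly_def truncation_def coeff_poly_cutoff intro!: degree_le)
qed

definition truncations :: "(nat \<times> ('a \<Rightarrow> real poly)) set \<Rightarrow> (nat \<times> ('a \<Rightarrow> real poly)) set" where
  "truncations G = (\<Union>P\<in>G. (\<lambda>k. (k, truncation k (snd P))) ` {..fst P})"

text \<open>The signs of the coefficients fix the degree of every member. On each of the finitely
  many strata \<open>G\<close> coincides with a family of truncations of full degree, and the
  polynomials that control all these families are collected in advance.\<close>

lemma sign_equiv_if_truncations_controlled:
  fixes G :: "(nat \<times> ('a::real_normed_vector \<Rightarrow> real poly)) set"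
  assumes fin: "finite G" and G: "\<And>P. P \<in> G \<Longrightarrow> param_poly P"
    and contr: "\<And>R. R \<subseteq> truncations G \<Longrightarrow> controlled R"
  shows "\<exists>A. finite A \<and> (\<forall>a\<in>A. real_polynomial_function a) \<and>
     (\<forall>x x'. agree A x x' \<longrightarrow> sign_equiv G x x')"
proof -
  have "\<forall>R\<in>Pow (truncations G). \<exists>A. finite A \<and> (\<forall>a\<in>A. real_polynomial_function a) \<and>
     (\<forall>x x'. full_degree R x \<and> full_degree R x' \<and> agree A x x' \<longrightarrow> sign_equiv R x x')"
    using contr by (auto simp: controlled_def)
  then obtain \<A> where "\<forall>R\<in>Pow (truncations G). finite (\<A> R) \<and> (\<forall>a\<in>\<A> R. real_polynomial_function a) \<and>
     (\<forall>x x'. full_degree R x \<and> full_degree R x' \<and> agree (\<A> R) x x' \<longrightarrow> sign_equiv R x x')"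
    by (rule bchoice[THEN exE])
  then have \<A>: "\<And>R. R \<subseteq> truncations G \<Longrightarrow> finite (\<A> R)"
      "\<And>R a. R \<subseteq> truncations G \<Longrightarrow> a \<in> \<A> R \<Longrightarrow> real_polynomial_function a"
      "\<And>R x x'. R \<subseteq> truncations G \<Longrightarrow> full_degree R x \<Longrightarrow> full_degree R x' \<Longrightarrow> agree (\<A> R) x x' \<Longrightarrow> sign_equiv R x x'"
    by (simp_all add: Pow_iff)
  define C where "C = (\<Union>P\<in>G. (\<lambda>i x. coeff (snd P x) i) ` {..fst P})"
  define A where "A = C \<union> (\<Union>R\<in>Pow (truncations G). \<A> R)"
  have "finite (truncations G)" using fin by (auto simp: truncations_def)
  then have "finite A" using fin \<A>(1) by (auto simp: A_def C_def)
  moreover have "\<forall>a\<in>A. real_polynomial_function a"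
    using \<A>(2) G by (auto simp: A_def C_def param_poly_def)
  moreover have "sign_equiv G x x'" if ag: "agree A x x'" for x x'
  proof -
    have "agree C x x'" using ag by (auto simp: agree_def A_def)
    then have z: "coeff (snd P x) i = 0 \<longleftrightarrow> coeff (snd P x') i = 0" if "P \<in> G" for P i
    proof (cases "i \<le> fst P")
      case True
      then have "(\<lambda>x. coeff (snd P x) i) \<in> C" using that by (auto simp: C_def)
      then have "sgn (coeff (snd P x) i) = sgn (coeff (snd P x') i)"
        using \<open>agree C x x'\<close> by (force simp: agree_def)
      then show ?thesis by (metis sgn_0_0)
    next
      case False
      have "degree (snd P x) \<le> fst P" "degree (snd P x') \<le> fst P"
        using G[OF that] by (auto simp: param_poly_def)
      with False show ?thesis by (simp add: coeff_eq_0)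
    qed
    have deg: "degree (snd P x) = degree (snd P x')" if "P \<in> G" for P
      using z[OF that] unfolding degree_def by simp
    define \<tau> where "\<tau> P = (degree (snd P x), truncation (degree (snd P x)) (snd P))" for P :: "nat \<times> ('a \<Rightarrow> real poly)"
    have cut: "truncation (degree (snd P x)) (snd P) x = snd P x"
       "truncation (degree (snd P x)) (snd P) x' = snd P x'" if "P \<in> G" for P
      using deg[OF that] by (auto simp: truncation_def poly_eq_iff coeff_poly_cutoff coeff_eq_0)
    have sub: "\<tau> ` G \<subseteq> truncations G"
      using G by (auto simp: \<tau>_def truncations_def param_poly_def image_iff)
    have "full_degree (\<tau> ` G) x" "full_degree (\<tau> ` G) x'"
      using cut deg by (auto simp: full_degree_def \<tau>_def)
    moreover have "agree (\<A> (\<tau> ` G)) x x'" using ag sub by (auto simp: agree_def A_def)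
    ultimately have "sign_equiv (\<tau> ` G) x x'" using \<A>(3)[OF sub] by blast
    then show ?thesis using cut by (simp add: sign_equiv_def same_signs_def \<tau>_def)
  qed
  ultimately show ?thesis by blast
qed

section \<open>Iterated derivatives and pseudo-division\<close>

lemma degree_higher_pderiv:
  fixes f :: "real poly"
  shows "degree ((pderiv ^^ j) f) = degree f - j"
  by (induction j) (auto simp: degree_pderiv)

lemma param_poly_pderiv:
  assumes "param_poly (d, P)"
  shows "param_poly (d - 1, \<lambda>x. pderiv (P x))"
  unfolding param_poly_def
proof (intro conjI allI)
  show "degree (snd (d - 1, \<lambda>x. pderiv (P x)) x) \<le> fst (d - 1, \<lambda>x. pderiv (P x))" for x
    using assms by (auto simp: param_poly_def degree_pderiv intro: diff_le_mono)
  have "real_polynomial_function (\<lambda>x. of_nat (Suc i) * coeff (P x) (Suc i))" for i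
    using assms by (intro real_polynomial_function.intros(4) real_polynomial_function.intros(2)) (simp add: param_poly_def)
  then show "real_polynomial_function (\<lambda>x. coeff (snd (d - 1, \<lambda>x. pderiv (P x)) x) i)" for i
    by (simp add: coeff_pderiv)
qed

lemma param_poly_higher_pderiv:
  "param_poly (d, P) \<Longrightarrow> param_poly (d - j, \<lambda>x. (pderiv ^^ j) (P x))"
proof (induction j)
  case (Suc j)
  then show ?case using param_poly_pderiv[of "d - j" "\<lambda>x. (pderiv ^^ j) (P x)"] by simp
qed simp

text \<open>
  One step of pseudo-division of \<open>P\<close>, of degree \<open>Suc n\<close>, by \<open>S\<close>, of degree \<open>e \<le> Suc n\<close>.
  At the roots of \<open>S\<close> the result is the product of \<open>P\<close> and the leading coefficient of \<open>S\<close>.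
\<close>

definition reduct :: "nat \<Rightarrow> ('a \<Rightarrow> real poly) \<Rightarrow> nat \<times> ('a \<Rightarrow> real poly) \<Rightarrow> 'a \<Rightarrow> real poly" where
  "reduct n P S x = smult (coeff (snd S x) (fst S)) (P x) -
     smult (coeff (P x) (Suc n)) (monom 1 (Suc n - fst S) * snd S x)"

lemma poly_reduct:
  assumes "poly (snd S x) t = 0"
  shows "poly (reduct n P S x) t = coeff (snd S x) (fst S) * poly (P x) t"
  using assms by (simp add: reduct_def)

lemma param_poly_reduct:
  assumes P: "param_poly (Suc n, P)" and S: "param_poly S" "fst S \<le> Suc n"
  shows "param_poly (n, reduct n P S)"
  unfolding param_poly_def
proof (intro conjI allI)
  fix x
  have "coeff (reduct n P S x) i = 0" if "i > n" for i
  proof (cases "i = Suc n")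
    case True
    then show ?thesis using S(2) by (simp add: reduct_def coeff_monom_mult)
  next
    case False
    then have "coeff (P x) i = 0" using P that by (intro coeff_eq_0) (auto simp: param_poly_def intro: le_less_trans)
    moreover have "degree (snd S x) \<le> fst S" using S by (simp add: param_poly_def)
    then have "coeff (snd S x) (i - (Suc n - fst S)) = 0" using S(2) that False by (intro coeff_eq_0) auto
    ultimately show ?thesis by (simp add: reduct_def coeff_monom_mult)
  qed
  then show "degree (snd (n, reduct n P S) x) \<le> fst (n, reduct n P S)" by (auto intro: degree_le)
next
  fix i
  have rS: "real_polynomial_function (\<lambda>x. coeff (snd S x) k)" for k using S by (simp add: param_poly_def)
  have rP: "real_polynomial_function (\<lambda>x. coeff (P x) k)" for k using P by (simp add: param_poly_def)
  have "real_polynomial_function (\<lambda>x. if i < Suc n - fst S then 0 else coeff (snd S x) (i - (Suc n - fst S)))"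
    using rS by (cases "i < Suc n - fst S") auto
  then have "real_polynomial_function (\<lambda>x. coeff (snd S x) (fst S) * coeff (P x) i -
      coeff (P x) (Suc n) * (if i < Suc n - fst S then 0 else coeff (snd S x) (i - (Suc n - fst S))))"
    by (intro real_polynomial_function_diff real_polynomial_function.intros(4) rS rP)
  moreover have "(\<lambda>x. coeff (reduct n P S x) i) = (\<lambda>x. coeff (snd S x) (fst S) * coeff (P x) i -
      coeff (P x) (Suc n) * (if i < Suc n - fst S then 0 else coeff (snd S x) (i - (Suc n - fst S))))"
    by (simp add: fun_eq_iff reduct_def coeff_monom_mult)
  ultimately show "real_polynomial_function (\<lambda>x. coeff (snd (n, reduct n P S) x) i)"
    by (simp del: coeff_diff)
qed

definition derivs :: "nat \<times> ('a \<Rightarrow> real poly) \<Rightarrow> (nat \<times> ('a \<Rightarrow> real poly)) set" where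
  "derivs P = (\<lambda>j. (fst P - j, \<lambda>x. (pderiv ^^ j) (snd P x))) ` {..fst P}"

lemma self_in_derivs: "P \<in> derivs P"
  by (auto simp: derivs_def image_iff intro: bexI[of _ 0])

lemma pderiv_in_derivs:
  assumes "S \<in> derivs P" "fst S > 0"
  shows "(fst S - 1, \<lambda>x. pderiv (snd S x)) \<in> derivs P"
proof -
  obtain j where j: "j \<le> fst P" "S = (fst P - j, \<lambda>x. (pderiv ^^ j) (snd P x))"
    using assms(1) by (auto simp: derivs_def)
  then show ?thesis using assms(2) by (auto simp: derivs_def image_iff intro!: bexI[of _ "Suc j"])
qed

lemma derivs_full_degree:
  assumes "S \<in> derivs P" "degree (snd P x) = fst P"
  shows "degree (snd S x) = fst S"
  using assms by (auto simp: derivs_def degree_higher_pderiv)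

lemma derivs_param_poly:
  assumes "S \<in> derivs P" "param_poly P"
  shows "param_poly S"
  using assms param_poly_higher_pderiv[of "fst P" "snd P"] by (auto simp: derivs_def)

text \<open>
  The Cohen--Hoermander step: one polynomial \<open>P\<close> of top degree is traded for its derivative, the
  derivatives of the other polynomials, and the reducts of \<open>P\<close> modulo all of these, which tell the sign
  of \<open>P\<close> at their roots.
\<close>

lemma controlled_induction_step:
  fixes F :: "(nat \<times> ('a::real_normed_vector \<Rightarrow> real poly)) set"
  assumes F: "finite F" "\<And>P. P \<in> F \<Longrightarrow> param_poly P" "\<And>P. P \<in> F \<Longrightarrow> fst P \<le> Suc n"
    and card: "card {P\<in>F. fst P = Suc n} = Suc k"
    and IH: "\<And>R :: (nat \<times> ('a \<Rightarrow> real poly)) set. finite R \<Longrightarrow> (\<And>P. P \<in> R \<Longrightarrow> param_poly P) \<Longrightarrow> (\<And>P. P \<in> R \<Longrightarrow> fst P \<le> Suc n) \<Longrightarrow>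
      card {P\<in>R. fst P = Suc n} \<le> k \<Longrightarrow> controlled R"
  shows "controlled F"
proof -
  have "{P\<in>F. fst P = Suc n} \<noteq> {}" using card by (metis card.empty nat.simps(3))
  then obtain P where P: "(Suc n, P) \<in> F" by auto
  define D where "D = (n, \<lambda>x. pderiv (P x))"
  define F' where "F' = insert D (F - {(Suc n, P)})"
  define Q where "Q = (\<Union>S\<in>F'. derivs S)"
  define G where "G = Q \<union> (\<lambda>S. (n, reduct n P S)) ` Q"
  have ppP: "param_poly (Suc n, P)" using F(2)[OF P] .
  have ppF': "param_poly S" "fst S \<le> Suc n" if "S \<in> F'" for S
    using that F(2,3)[of S] param_poly_pderiv[OF ppP] unfolding F'_def D_def by fastforce+
  have finQ: "finite Q" using F(1) by (auto simp: Q_def F'_def derivs_def)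
  have Q: "param_poly S" "fst S \<le> Suc n" if S: "S \<in> Q" for S
  proof -
    obtain T where T: "T \<in> F'" "S \<in> derivs T" using S by (auto simp: Q_def)
    then show "param_poly S" using ppF' derivs_param_poly by blast
    show "fst S \<le> Suc n" using T(2) ppF'(2)[OF T(1)] by (auto simp: derivs_def)
  qed
  have finG: "finite G" using finQ by (auto simp: G_def)
  have ppG: "param_poly S" "fst S \<le> Suc n" if S: "S \<in> G" for S
  proof -
    consider "S \<in> Q" | T where "T \<in> Q" "S = (n, reduct n P T)" using S unfolding G_def by blast
    then have "param_poly S \<and> fst S \<le> Suc n"
      by cases (use Q param_poly_reduct[OF ppP Q] in simp_all)
    then show "param_poly S" "fst S \<le> Suc n" by blast+
  qed
  \<comment> \<open>A proper derivative has lost degree, and \<open>P\<close> was replaced by one of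
    degree \<open>n\<close>; so the members of top formal degree are old ones other than
    \<open>P\<close>.\<close>
  have topQ: "S \<in> F - {(Suc n, P)}" if S: "S \<in> Q" "fst S = Suc n" for S
  proof -
    obtain T j where T: "T \<in> F'" "j \<le> fst T" "S = (fst T - j, \<lambda>x. (pderiv ^^ j) (snd T x))"
      using S(1) by (auto simp: Q_def derivs_def)
    then have "j = 0" "fst T = Suc n" using S(2) ppF'(2)[OF T(1)] by auto
    then have "S = T" "T \<noteq> D" using T(3) by (auto simp: D_def prod_eq_iff)
    then show ?thesis using T(1) by (auto simp: F'_def)
  qed
  have "controlled R" if R: "R \<subseteq> truncations G" for R
  proof (rule IH)
    have "finite (truncations G)" using finG by (auto simp: truncations_def)
    then show "finite R" using R by (rule rev_finite_subset)
    show "param_poly S" "fst S \<le> Suc n" if S: "S \<in> R" for S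
    proof -
      obtain T k where T: "T \<in> G" "k \<le> fst T" "S = (k, truncation k (snd T))"
        using S R unfolding truncations_def by blast
      show "param_poly S" unfolding T(3) by (rule param_poly_truncation[OF ppG(1)[OF T(1)]])
      show "fst S \<le> Suc n" using T(2,3) ppG(2)[OF T(1)] by simp
    qed
    have "S \<in> (\<lambda>P. (fst P, truncation (fst P) (snd P))) ` ({P\<in>F. fst P = Suc n} - {(Suc n, P)})"
      if S: "S \<in> R" "fst S = Suc n" for S
    proof -
      obtain T j where T: "T \<in> G" "j \<le> fst T" "S = (j, truncation j (snd T))"
        using S(1) R by (auto simp: truncations_def)
      then have "j = Suc n" "fst T = Suc n" using S(2) ppG(2)[OF T(1)] by auto
      moreover have "T \<in> Q" using T(1) \<open>fst T = Suc n\<close> by (auto simp: G_def)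
      ultimately show ?thesis using topQ[of T] T(3) by auto
    qed
    then have "{S\<in>R. fst S = Suc n} \<subseteq> (\<lambda>P. (fst P, truncation (fst P) (snd P))) ` ({P\<in>F. fst P = Suc n} - {(Suc n, P)})"
      by blast
    then have "card {S\<in>R. fst S = Suc n} \<le> card ({P\<in>F. fst P = Suc n} - {(Suc n, P)})"
      using F(1) by (intro surj_card_le) auto
    also have "\<dots> = k" using card F(1) P by simp
    finally show "card {S\<in>R. fst S = Suc n} \<le> k" .
  qed
  then obtain A where A: "finite A" "\<And>a. a \<in> A \<Longrightarrow> real_polynomial_function a"
      "\<And>x x'. agree A x x' \<Longrightarrow> sign_equiv G x x'"
    using sign_equiv_if_truncations_controlled[OF finG ppG(1)] by blast
  \<comment> \<open>A reduct shows the sign of \<open>P\<close> only up to the sign of a leading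
    coefficient, so these coefficients are controlled too.\<close>
  define B where "B = A \<union> (\<lambda>S x. coeff (snd S x) (fst S)) ` Q"
  have "finite B" using A(1) finQ by (auto simp: B_def)
  moreover have "\<forall>a\<in>B. real_polynomial_function a"
    using A(2) Q by (auto simp: B_def param_poly_def)
  moreover have "sign_equiv F x x'" if fd: "full_degree F x" "full_degree F x'" and ag: "agree B x x'" for x x'
  proof -
    have degP: "degree (P x) = Suc n" "degree (P x') = Suc n"
      using fd P by (force simp: full_degree_def)+
    have "degree (snd S y) = fst S" if "S \<in> F'" "full_degree F y" for S y
      using that P by (auto simp: F'_def D_def full_degree_def degree_pderiv)
    then have degQ: "degree (snd S y) = fst S" if "S \<in> Q" "y = x \<or> y = x'" for S y
      using that fd derivs_full_degree unfolding Q_def by (metis UN_E)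
    let ?q = "\<lambda>S. snd S x" and ?q' = "\<lambda>S. snd S x'"
    have pd: "paired_derivs Q ?q ?q'"
      unfolding paired_derivs_def
    proof (intro conjI ballI impI)
      fix S assume S: "S \<in> Q"
      show "degree (?q S) = degree (?q' S)" using degQ[OF S] by simp
      assume "degree (?q S) > 0"
      then have "fst S > 0" using degQ[OF S] by simp
      then have "(fst S - 1, \<lambda>x. pderiv (snd S x)) \<in> Q" using S pderiv_in_derivs[of S] unfolding Q_def by (metis UN_E UN_I)
      then show "\<exists>j\<in>Q. \<exists>c. c \<noteq> 0 \<and> ?q j = smult c (pderiv (?q S)) \<and> ?q' j = smult c (pderiv (?q' S))"
        by (intro bexI[of _ "(fst S - 1, \<lambda>x. pderiv (snd S x))"] exI[of _ 1]) auto
    qed (rule finQ)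
    have lc: "sgn (coeff (?q S) (fst S)) = sgn (coeff (?q' S) (fst S))" if S: "S \<in> Q" for S
      using agreeD[OF ag, of "\<lambda>x. coeff (snd S x) (fst S)"] S by (simp add: B_def)
    have transfer: "same_signs Q ?q ?q' t t' \<and> (vanishes Q ?q t \<longrightarrow> sgn (poly (P x) t) = sgn (poly (P x') t'))"
      if ss: "same_signs G ?q ?q' t t'" for t t'
    proof (intro conjI impI)
      show "same_signs Q ?q ?q' t t'" using ss by (auto simp: same_signs_def G_def)
      assume "vanishes Q ?q t"
      then obtain S where S: "S \<in> Q" "?q S \<noteq> 0" "poly (?q S) t = 0" by (auto simp: vanishes_def)
      have "sgn (poly (?q S) t) = sgn (poly (?q' S) t')" using ss S(1) by (auto simp: same_signs_def G_def)
      then have z': "poly (?q' S) t' = 0" using S(3) by (simp add: sgn_eq_0_iff)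
      have "sgn (poly (reduct n P S x) t) = sgn (poly (reduct n P S x') t')"
        using same_signsD[OF ss, of "(n, reduct n P S)"] S(1) by (simp add: G_def)
      then have "sgn (coeff (?q S) (fst S)) * sgn (poly (P x) t) = sgn (coeff (?q S) (fst S)) * sgn (poly (P x') t')"
        using lc[OF S(1)] by (simp add: poly_reduct S(3) z' sgn_mult)
      moreover have "coeff (?q S) (fst S) \<noteq> 0" using S(2) degQ[OF S(1), of x] by (metis leading_coeff_0_iff)
      ultimately show "sgn (poly (P x) t) = sgn (poly (P x') t')" by (simp add: sgn_eq_0_iff)
    qed
    \<comment> \<open>Both directions are used: Thom's argument goes back from a point over
      \<open>x'\<close> to a partner over \<open>x\<close>.\<close>
    have "sign_equiv G x x'" "sign_equiv G x' x" using A(3) ag by (auto simp: agree_def B_def)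
    then have "\<exists>t'. same_signs G ?q ?q' t t'" "\<exists>t. same_signs G ?q ?q' t t'" for t t'
      by (auto simp: sign_equiv_def same_signs_def eq_commute)
    then have "\<exists>t'. same_signs Q ?q ?q' t t' \<and> (vanishes Q ?q t \<longrightarrow> sgn (poly (P x) t) = sgn (poly (P x') t'))"
      "\<exists>t. same_signs Q ?q ?q' t t' \<and> (vanishes Q ?q' t' \<longrightarrow> sgn (poly (P x) t) = sgn (poly (P x') t'))" for t t'
      using transfer vanishes_same_signs[OF pd] by meson+
    moreover have "D \<in> Q" using self_in_derivs[of D] by (auto simp: Q_def F'_def)
    ultimately have *: "\<exists>t'. same_signs Q ?q ?q' t t' \<and> sgn (poly (P x) t) = sgn (poly (P x') t')" for t
      using degP by (intro sign_vector_extension[OF pd, of _ _ D]) (auto simp: D_def)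
    have "F \<subseteq> insert (Suc n, P) Q" using self_in_derivs unfolding Q_def F'_def by blast
    show ?thesis
      unfolding sign_equiv_def
    proof
      fix t
      obtain t' where t': "same_signs Q ?q ?q' t t'" "sgn (poly (P x) t) = sgn (poly (P x') t')"
        using * by blast
      have "sgn (poly (?q S) t) = sgn (poly (?q' S) t')" if "S \<in> F" for S
        using that \<open>F \<subseteq> insert (Suc n, P) Q\<close> t'(2) same_signsD[OF t'(1), of S] by (cases "S = (Suc n, P)") auto
      then show "\<exists>t'. same_signs F ?q ?q' t t'" by (auto simp: same_signs_def)
    qed
  qed
  ultimately show ?thesis by (auto simp: controlled_def)
qed

text \<open>The induction is lexicographic in the top degree and the number of members of that
  degree: a step creates many polynomials, but leaves at least one fewer of top degree.\<close>

lemma param_polys_controlled_aux: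
  fixes F :: "(nat \<times> ('a::real_normed_vector \<Rightarrow> real poly)) set"
  assumes "finite F" "\<And>P. P \<in> F \<Longrightarrow> param_poly P" "\<And>P. P \<in> F \<Longrightarrow> fst P \<le> n"
  shows "controlled F"
  using assms
proof (induction n arbitrary: F)
  case 0
  define A where "A = (\<lambda>P x. coeff (snd P x) 0) ` F"
  have "sign_equiv F x x'" if "full_degree F x" "full_degree F x'" "agree A x x'" for x x'
  proof -
    have "sgn (poly (snd P x) t) = sgn (poly (snd P x') t)" if P: "P \<in> F" for P t
    proof -
      have "degree (snd P x) = 0" "degree (snd P x') = 0"
        using that \<open>full_degree F x\<close> \<open>full_degree F x'\<close> "0.prems"(3) by (auto simp: full_degree_def)
      then have "poly (snd P x) t = coeff (snd P x) 0" "poly (snd P x') t = coeff (snd P x') 0"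
        by (simp_all add: poly_altdef)
      then show ?thesis using \<open>agree A x x'\<close> P by (auto simp: agree_def A_def)
    qed
    then show ?thesis by (auto simp: sign_equiv_def same_signs_def)
  qed
  moreover have "finite A" "\<forall>a\<in>A. real_polynomial_function a"
    using "0.prems" by (auto simp: A_def param_poly_def)
  ultimately show ?case by (auto simp: controlled_def)
next
  case (Suc n)
  have "controlled F" if "finite F" "\<And>P. P \<in> F \<Longrightarrow> param_poly P" "\<And>P. P \<in> F \<Longrightarrow> fst P \<le> Suc n"
    "card {P\<in>F. fst P = Suc n} \<le> k" for k and F :: "(nat \<times> ('a \<Rightarrow> real poly)) set"
    using that
  proof (induction k arbitrary: F)
    case 0
    then have "{P\<in>F. fst P = Suc n} = {}" by simp
    then have "fst P \<le> n" if "P \<in> F" for P using 0(3)[OF that] that by fastforce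
    then show ?case using Suc.IH[OF 0(1,2)] by blast
  next
    case (Suc k)
    show ?case
    proof (cases "card {P\<in>F. fst P = Suc n} \<le> k")
      case True
      then show ?thesis using Suc.IH Suc.prems by blast
    next
      case False
      then have "card {P\<in>F. fst P = Suc n} = Suc k" using Suc.prems(4) by simp
      then show ?thesis using controlled_induction_step[OF Suc.prems(1-3)] Suc.IH by blast
    qed
  qed
  then show ?case using Suc.prems by blast
qed

lemma param_polys_sign_equiv:
  fixes F :: "(nat \<times> ('a::real_normed_vector \<Rightarrow> real poly)) set"
  assumes F: "finite F" "\<And>P. P \<in> F \<Longrightarrow> param_poly P"
  shows "\<exists>A. finite A \<and> (\<forall>a\<in>A. real_polynomial_function a) \<and>
     (\<forall>x x'. agree A x x' \<longrightarrow> sign_equiv F x x')"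
proof (rule sign_equiv_if_truncations_controlled[OF F])
  fix R assume R: "R \<subseteq> truncations F"
  have fin: "finite (truncations F)" using F(1) by (auto simp: truncations_def)
  show "controlled R"
  proof (rule param_polys_controlled_aux)
    show "finite R" using R fin by (rule finite_subset)
    show "param_poly P" if P: "P \<in> R" for P
    proof -
      obtain T k where T: "T \<in> F" "P = (k, truncation k (snd T))"
        using P R unfolding truncations_def by blast
      show ?thesis unfolding T(2) by (rule param_poly_truncation[OF F(2)[OF T(1)]])
    qed
    show "fst P \<le> Max (fst ` truncations F)" if "P \<in> R" for P
      using that R fin by (intro Max_ge) auto
  qed
qed

section \<open>Semialgebraic predicates and the Tarski--Seidenberg theorem\<close>

lemma real_polynomial_function_as_param_poly:
  fixes p :: "'a::real_normed_vector \<times> real \<Rightarrow> real"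
  assumes "real_polynomial_function p"
  shows "\<exists>P. param_poly P \<and> (\<forall>x t. p (x, t) = poly (snd P x) t)"
  using assms
proof (induction p rule: real_polynomial_function.induct)
  case (linear f)
  interpret f: bounded_linear f by fact
  have "bounded_linear (\<lambda>x. f (x, 0))"
    by (intro bounded_linear_compose[OF linear] bounded_linear_Pair bounded_linear_ident bounded_linear_zero)
  then have "real_polynomial_function (\<lambda>x. coeff [:f (x, 0), f (0, 1):] i)" for i
    by (cases i; cases "i - 1") (auto simp: coeff_pCons split: nat.splits)
  then have "param_poly (1, \<lambda>x. [:f (x, 0), f (0, 1):])"
    by (simp add: param_poly_def)
  moreover have "f (x, t) = poly [:f (x, 0), f (0, 1):] t" for x t
    using f.add[of "(x, 0)" "t *\<^sub>R (0, 1)"] f.scaleR[of t "(0, 1)"] by simp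
  ultimately show ?case
    by (intro exI[of _ "(1, \<lambda>x. [:f (x, 0), f (0, 1):])"] conjI allI) (unfold snd_conv)
next
  case (const c)
  have "param_poly (0, \<lambda>_::'a. [:c:])"
    by (auto simp: param_poly_def intro: real_polynomial_function.intros(2))
  then show ?case by (intro exI[of _ "(0, \<lambda>_. [:c:])"]) simp
next
  case (add f g)
  then obtain P Q where P: "param_poly P" "\<And>x t. f (x, t) = poly (snd P x) t"
    and Q: "param_poly Q" "\<And>x t. g (x, t) = poly (snd Q x) t" by blast
  have "param_poly (fst P + fst Q, \<lambda>x. snd P x + snd Q x)"
    using P(1) Q(1) by (auto simp: param_poly_def
        intro!: degree_add_le real_polynomial_function.intros(3) intro: trans_le_add1 trans_le_add2)
  then show ?case using P Q by (intro exI[of _ "(fst P + fst Q, \<lambda>x. snd P x + snd Q x)"]) simp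
next
  case (mult f g)
  then obtain P Q where P: "param_poly P" "\<And>x t. f (x, t) = poly (snd P x) t"
    and Q: "param_poly Q" "\<And>x t. g (x, t) = poly (snd Q x) t" by blast
  have "degree (snd P x * snd Q x) \<le> fst P + fst Q" for x
    using P(1) Q(1) degree_mult_le[of "snd P x" "snd Q x"] by (force simp: param_poly_def intro: order_trans add_mono)
  moreover have "real_polynomial_function (\<lambda>x. coeff (snd P x * snd Q x) i)" for i
    unfolding coeff_mult using P(1) Q(1)
    by (intro real_polynomial_function_sum real_polynomial_function.intros(4)) (auto simp: param_poly_def)
  ultimately have "param_poly (fst P + fst Q, \<lambda>x. snd P x * snd Q x)"
    by (simp add: param_poly_def)
  then show ?case using P Q by (intro exI[of _ "(fst P + fst Q, \<lambda>x. snd P x * snd Q x)"]) simp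
qed

text \<open>
  Membership in a semialgebraic set depends only on the signs of finitely many polynomials; in this
  form the Boolean operations are immediate.
\<close>

definition sa :: "('a::euclidean_space \<Rightarrow> bool) \<Rightarrow> bool" where
  "sa P \<longleftrightarrow> (\<exists>L. finite L \<and> (\<forall>a\<in>L. real_polynomial_function a) \<and>
     (\<forall>z z'. agree L z z' \<longrightarrow> P z = P z'))"

lemma saI:
  assumes "finite L" "\<And>a. a \<in> L \<Longrightarrow> real_polynomial_function a"
    "\<And>z z'. agree L z z' \<Longrightarrow> P z \<Longrightarrow> P z'"
  shows "sa P"
proof -
  have "P z = P z'" if "agree L z z'" for z z'
    using assms(3)[of z z'] assms(3)[of z' z] that by (auto simp: agree_def)
  then show ?thesis unfolding sa_def by (intro exI[of _ L]) (use assms(1,2) in blast)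
qed

lemma saE:
  assumes "sa P"
  obtains L where "finite L" "\<And>a. a \<in> L \<Longrightarrow> real_polynomial_function a"
    "\<And>z z'. agree L z z' \<Longrightarrow> P z \<Longrightarrow> P z'"
  using assms unfolding sa_def by metis

lemma sa_iff_semialgebraic: "sa P \<longleftrightarrow> semialgebraic {z. P z}"
proof
  assume "sa P"
  then obtain L where L: "finite L" "\<And>a. a \<in> L \<Longrightarrow> real_polynomial_function a"
    "\<And>z z'. agree L z z' \<Longrightarrow> P z \<Longrightarrow> P z'" using saE by blast
  define cell where "cell v = {y. \<forall>a\<in>L. v a = sgn (a y)}" for v :: "('a \<Rightarrow> real) \<Rightarrow> real"
  \<comment> \<open>Restriction to \<open>L\<close> places the sign vectors in a finite extensional
    function space; each of them cuts out a basic set.\<close>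
  define vec where "vec x = restrict (\<lambda>a. sgn (a x)) L" for x :: 'a
  have cell_vec: "cell (vec x) = {y. agree L x y}" for x by (auto simp: cell_def vec_def agree_def)
  have "vec ` {z. P z} \<subseteq> L \<rightarrow>\<^sub>E {-1, 0, 1}" by (auto simp: vec_def PiE_def) (metis sgn_if)
  then have "finite (vec ` {z. P z})" by (rule finite_subset) (intro finite_PiE L; simp)
  then have "finite (cell ` vec ` {z. P z})" by blast
  moreover have "basic_semialgebraic (cell (vec x))" for x
    unfolding basic_semialgebraic_def
  proof (intro exI conjI)
    show "finite {a \<in> L. a x = 0}" "finite ({a\<in>L. a x > 0} \<union> (\<lambda>a z. - a z) ` {a\<in>L. a x < 0})" using L(1) by auto
    show "\<forall>p\<in>{a \<in> L. a x = 0} \<union> ({a\<in>L. a x > 0} \<union> (\<lambda>a z. - a z) ` {a\<in>L. a x < 0}). real_polynomial_function p"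
      using L(2) by auto
    have "sgn (a x) = sgn (a z) \<longleftrightarrow> (a x = 0 \<longrightarrow> a z = 0) \<and> (a x > 0 \<longrightarrow> a z > 0) \<and> (a x < 0 \<longrightarrow> - a z > 0)" for a :: "'a \<Rightarrow> real" and z
      by (auto simp: sgn_if)
    then show "cell (vec x) = {z. (\<forall>p\<in>{a \<in> L. a x = 0}. p z = 0) \<and>
       (\<forall>q\<in>{a\<in>L. a x > 0} \<union> (\<lambda>a z. - a z) ` {a\<in>L. a x < 0}. q z > 0)}"
      unfolding cell_vec agree_def ball_Un ball_simps by auto
  qed
  moreover have "{z. P z} = \<Union>(cell ` vec ` {z. P z})"
    using L(3) by (auto simp: cell_vec) (auto simp: agree_def)
  ultimately show "semialgebraic {z. P z}" unfolding semialgebraic_def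
    by (intro exI[of _ "cell ` vec ` {z. P z}"] conjI) blast+
next
  assume "semialgebraic {z. P z}"
  then obtain \<B> where B: "finite \<B>" "\<And>S. S \<in> \<B> \<Longrightarrow> basic_semialgebraic S" "{z. P z} = \<Union>\<B>"
    by (auto simp: semialgebraic_def)
  have "\<forall>S\<in>\<B>. \<exists>L. finite L \<and> (\<forall>a\<in>L. real_polynomial_function a) \<and> (\<forall>z z'. agree L z z' \<longrightarrow> z \<in> S \<longrightarrow> z' \<in> S)"
  proof
    fix S assume "S \<in> \<B>"
    obtain A Q where *: "finite A" "finite Q" "\<forall>p \<in> A \<union> Q. real_polynomial_function p"
      "S = {z. (\<forall>p \<in> A. p z = 0) \<and> (\<forall>q \<in> Q. q z > 0)}"
      using B(2)[OF \<open>S \<in> \<B>\<close>] unfolding basic_semialgebraic_def by (elim exE conjE) (rule that; assumption)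
    have "z \<in> S \<longrightarrow> z' \<in> S" if ag: "agree (A \<union> Q) z z'" for z z'
    proof
      assume z: "z \<in> S"
      have "p z' = 0" if "p \<in> A" for p
      proof -
        have "p z = 0" using that z unfolding *(4) by blast
        then show ?thesis using agreeD[OF ag, of p] that by (simp add: sgn_eq_0_iff)
      qed
      moreover have "q z' > 0" if "q \<in> Q" for q
      proof -
        have "q z > 0" using that z unfolding *(4) by blast
        then show ?thesis using agreeD[OF ag, of q] that by (simp add: sgn_1_pos)
      qed
      ultimately show "z' \<in> S" unfolding *(4) by blast
    qed
    then show "\<exists>L. finite L \<and> (\<forall>a\<in>L. real_polynomial_function a) \<and> (\<forall>z z'. agree L z z' \<longrightarrow> z \<in> S \<longrightarrow> z' \<in> S)"
      using *(1-3) by (intro exI[of _ "A \<union> Q"] conjI) (blast+)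
  qed
  then obtain L where L: "\<forall>S\<in>\<B>. finite (L S) \<and> (\<forall>a\<in>L S. real_polynomial_function a) \<and> (\<forall>z z'. agree (L S) z z' \<longrightarrow> z \<in> S \<longrightarrow> z' \<in> S)"
    by (rule bchoice[THEN exE])
  show "sa P"
  proof (rule saI)
    fix z z' assume ag: "agree (\<Union>S\<in>\<B>. L S) z z'" and "P z"
    then obtain S where "S \<in> \<B>" "z \<in> S" using B(3) by blast
    moreover have "agree (L S) z z'" using ag \<open>S \<in> \<B>\<close> by (auto simp: agree_def)
    ultimately show "P z'" using L B(3) by blast
  qed (use L B(1) in auto)
qed

section \<open>Closure properties and quantifier elimination\<close>

named_theorems sa_intros

lemma sa_const [sa_intros]: "sa (\<lambda>z. c)"
  by (auto simp: sa_def intro: exI[of _ "{}"])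

lemma sa_not [sa_intros]: "sa P \<Longrightarrow> sa (\<lambda>z. \<not> P z)"
  by (auto simp: sa_def)

lemma sa_conj [sa_intros]:
  assumes "sa P" "sa Q"
  shows "sa (\<lambda>z. P z \<and> Q z)"
proof -
  obtain L where L: "finite L" "\<And>a. a \<in> L \<Longrightarrow> real_polynomial_function a" "\<And>z z'. agree L z z' \<Longrightarrow> P z \<Longrightarrow> P z'"
    using saE[OF assms(1)] by blast
  obtain M where M: "finite M" "\<And>a. a \<in> M \<Longrightarrow> real_polynomial_function a" "\<And>z z'. agree M z z' \<Longrightarrow> Q z \<Longrightarrow> Q z'"
    using saE[OF assms(2)] by blast
  show ?thesis
  proof (rule saI)
    fix z z' assume *: "agree (L \<union> M) z z'" "P z \<and> Q z"
    then have "agree L z z'" "agree M z z'" by (auto simp: agree_def)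
    then show "P z' \<and> Q z'" using L(3) M(3) *(2) by blast
  qed (use L M in auto)
qed

lemma sa_imp [sa_intros]: "sa P \<Longrightarrow> sa Q \<Longrightarrow> sa (\<lambda>z. P z \<longrightarrow> Q z)"
  using sa_not[OF sa_conj[OF _ sa_not, of P Q]] by simp

lemma sa_disj [sa_intros]: "sa P \<Longrightarrow> sa Q \<Longrightarrow> sa (\<lambda>z. P z \<or> Q z)"
  using sa_imp[OF sa_not, of P Q] by (simp add: disj_imp)

lemma sa_less [sa_intros]:
  assumes "real_polynomial_function p" "real_polynomial_function q"
  shows "sa (\<lambda>z. p z < q z)"
proof -
  show ?thesis
  proof (rule saI)
    show "p z' < q z'" if "agree {\<lambda>z. p z - q z} z z'" "p z < q z" for z z'
      using that by (auto simp: agree_def sgn_if split: if_splits)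
  qed (use assms in auto)
qed

lemma sa_le [sa_intros]:
  assumes "real_polynomial_function p" "real_polynomial_function q"
  shows "sa (\<lambda>z. p z \<le> q z)"
  using sa_not[OF sa_less[OF assms(2,1)]] by (simp add: not_less)

lemma sa_eq [sa_intros]:
  assumes "real_polynomial_function p" "real_polynomial_function q"
  shows "sa (\<lambda>z. p z = q z)"
  using sa_conj[OF sa_le[OF assms] sa_le[OF assms(2,1)]] by (simp add: order_eq_iff)

lemma sa_compose:
  assumes "sa P" "polynomial_function g"
  shows "sa (\<lambda>z. P (g z))"
proof -
  obtain L where L: "finite L" "\<And>a. a \<in> L \<Longrightarrow> real_polynomial_function a" "\<And>z z'. agree L z z' \<Longrightarrow> P z \<Longrightarrow> P z'"
    using saE[OF assms(1)] by blast
  have "real_polynomial_function (\<lambda>z. a (g z))" if "real_polynomial_function a" for a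
    using real_polynomial_function_compose[OF assms(2) that] by (simp add: o_def)
  then show ?thesis using L
    by (intro saI[of "(\<lambda>a z. a (g z)) ` L"]) (auto simp: agree_def)
qed

text \<open>If the controlling signs at \<open>x\<close> and \<open>x'\<close> agree, a witness
  \<open>t\<close> over \<open>x\<close> has a counterpart over \<open>x'\<close> with the same sign
  vector.\<close>

lemma sa_ex_real:
  fixes P :: "'a::euclidean_space \<Rightarrow> real \<Rightarrow> bool"
  assumes "sa (\<lambda>w. P (fst w) (snd w))"
  shows "sa (\<lambda>x. \<exists>t. P x t)"
proof -
  obtain L where L: "finite L" "\<And>a. a \<in> L \<Longrightarrow> real_polynomial_function a"
    "\<And>z z'. agree L z z' \<Longrightarrow> P (fst z) (snd z) \<Longrightarrow> P (fst z') (snd z')"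
    using saE[OF assms] by blast
  have "\<forall>a\<in>L. \<exists>P. param_poly P \<and> (\<forall>x t. a (x, t) = poly (snd P x) t)"
    using L(2) real_polynomial_function_as_param_poly by blast
  then obtain r where "\<forall>a\<in>L. param_poly (r a) \<and> (\<forall>x t. a (x, t) = poly (snd (r a) x) t)"
    by (rule bchoice[THEN exE])
  then have r: "\<And>a. a \<in> L \<Longrightarrow> param_poly (r a)" "\<And>a x t. a \<in> L \<Longrightarrow> a (x, t) = poly (snd (r a) x) t"
    by blast+
  obtain A where A: "finite A" "\<forall>a\<in>A. real_polynomial_function a" "\<And>x x'. agree A x x' \<Longrightarrow> sign_equiv (r ` L) x x'"
    using param_polys_sign_equiv[of "r ` L"] L(1) r(1) by blast
  show ?thesis
  proof (rule saI)
    fix x x' assume ag: "agree A x x'" and "\<exists>t. P x t"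
    then obtain t where t: "P x t" by blast
    obtain t' where "same_signs (r ` L) (\<lambda>P. snd P x) (\<lambda>P. snd P x') t t'"
      using A(3)[OF ag] by (auto simp: sign_equiv_def)
    then have "agree L (x, t) (x', t')" using r(2) by (auto simp: agree_def same_signs_def)
    then have "P x' t'" using L(3)[of "(x, t)" "(x', t')"] t by simp
    then show "\<exists>t. P x' t" ..
  qed (use A in auto)
qed

lemma polynomial_function_Pair:
  assumes "polynomial_function f" "polynomial_function g"
  shows "polynomial_function (\<lambda>z. (f z, g z))"
proof -
  have "polynomial_function (\<lambda>z. (f z, 0) + (0, g z))"
  proof (rule polynomial_function_add)
    have "bounded_linear (\<lambda>x. (x, 0))" "bounded_linear (\<lambda>x. (0, x))"
      by (intro bounded_linear_Pair bounded_linear_ident bounded_linear_zero)+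
    then show "polynomial_function (\<lambda>z. (f z, 0))" "polynomial_function (\<lambda>z. (0, g z))"
      using assms unfolding polynomial_function_def o_def
      by (auto dest: bounded_linear_compose)
  qed
  then show ?thesis by simp
qed

text \<open>The quantified vector is assembled from multiples of basis vectors, one at a time, so
  each stage is a single real quantifier.\<close>

lemma sa_ex [sa_intros]:
  fixes P :: "'a::euclidean_space \<Rightarrow> 'b::euclidean_space \<Rightarrow> bool"
  assumes "sa (\<lambda>w. P (fst w) (snd w))"
  shows "sa (\<lambda>x. \<exists>y. P x y)"
proof -
  have "sa (\<lambda>w. \<exists>z\<in>span B. P (fst w) (snd w + z))" if "finite B" for B
    using that
  proof (induction B)
    case empty
    then show ?case using assms by simp
  next
    case (insert b B)
    have "bounded_linear (\<lambda>w::('a \<times> 'b) \<times> real. (fst (fst w), snd (fst w) + snd w *\<^sub>R b))"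
      by (intro bounded_linear_Pair bounded_linear_add bounded_linear_scaleR_const
          bounded_linear_compose[OF bounded_linear_fst] bounded_linear_compose[OF bounded_linear_snd]
          bounded_linear_fst bounded_linear_snd)
    from sa_compose[OF insert.IH polynomial_function_bounded_linear[OF this]]
    have "sa (\<lambda>w. \<exists>t. \<exists>z\<in>span B. P (fst w) (snd w + t *\<^sub>R b + z))"
      by (intro sa_ex_real) simp
    moreover have "(\<exists>z\<in>span (insert b B). Q (y + z)) \<longleftrightarrow> (\<exists>t. \<exists>z\<in>span B. Q (y + t *\<^sub>R b + z))" for y :: 'b and Q
    proof
      assume "\<exists>z\<in>span (insert b B). Q (y + z)"
      then obtain z k where "z - k *\<^sub>R b \<in> span B" "Q (y + z)" by (auto simp: span_breakdown_eq)
      then show "\<exists>t. \<exists>z\<in>span B. Q (y + t *\<^sub>R b + z)"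
        by (intro exI[of _ k] bexI[of _ "z - k *\<^sub>R b"]) (auto simp: algebra_simps)
    next
      assume "\<exists>t. \<exists>z\<in>span B. Q (y + t *\<^sub>R b + z)"
      then obtain t z where "z \<in> span B" "Q (y + t *\<^sub>R b + z)" by blast
      then show "\<exists>z\<in>span (insert b B). Q (y + z)"
        by (intro bexI[of _ "t *\<^sub>R b + z"]) (auto simp: span_breakdown_eq add.assoc intro: exI[of _ t])
    qed
    ultimately show ?case by simp
  qed
  from this[OF finite_Basis] have "sa (\<lambda>w::'a \<times> 'b. \<exists>z. P (fst w) (snd w + z))" by simp
  from sa_compose[OF this, of "\<lambda>x. (x, 0)"] show ?thesis
    by (simp add: polynomial_function_Pair)
qed

lemma sa_all [sa_intros]:
  fixes P :: "'a::euclidean_space \<Rightarrow> 'b::euclidean_space \<Rightarrow> bool"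
  assumes "sa (\<lambda>w. P (fst w) (snd w))"
  shows "sa (\<lambda>x. \<forall>y. P x y)"
  using sa_not[OF sa_ex, of "\<lambda>x y. \<not> P x y"] sa_not[OF assms] by simp

lemma real_polynomial_function_inner [sa_intros]:
  fixes f g :: "'a::real_normed_vector \<Rightarrow> 'b::euclidean_space"
  assumes "polynomial_function f" "polynomial_function g"
  shows "real_polynomial_function (\<lambda>z. f z \<bullet> g z)"
proof -
  have "real_polynomial_function (\<lambda>z. h z \<bullet> b)" if "polynomial_function h" for h :: "'a \<Rightarrow> 'b" and b
    using that bounded_linear_inner_left[of b] unfolding polynomial_function_def o_def by blast
  then have "real_polynomial_function (\<lambda>z. \<Sum>b\<in>Basis. (f z \<bullet> b) * (g z \<bullet> b))"
    using assms by (intro real_polynomial_function_sum real_polynomial_function.intros(4)) auto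
  then show ?thesis by (simp add: euclidean_inner[symmetric])
qed

lemma bounded_linear_fst_comp: "bounded_linear g \<Longrightarrow> bounded_linear (\<lambda>z. fst (g z))"
  and bounded_linear_snd_comp: "bounded_linear g \<Longrightarrow> bounded_linear (\<lambda>z. snd (g z))"
  by (auto intro: bounded_linear_compose[OF bounded_linear_fst] bounded_linear_compose[OF bounded_linear_snd])

lemmas poly_intros =
  polynomial_function_const polynomial_function_add polynomial_function_diff polynomial_function_mult
  polynomial_function_Pair
  real_polynomial_function.intros(2) real_polynomial_function.intros(3) real_polynomial_function_diff
  real_polynomial_function.intros(4) real_polynomial_function_minus real_polynomial_function_power
  real_polynomial_function_inner
  polynomial_function_bounded_linear real_polynomial_function.intros(1)
  bounded_linear_ident bounded_linear_fst_comp bounded_linear_snd_comp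

section \<open>Semialgebraic functions of one variable\<close>

text \<open>This is o-minimality: the truth value can change only at roots of the nonzero
  polynomials that decide it. The finiteness of every exceptional set of levels goes back to
  it.\<close>

lemma sa_real_finite_boundary:
  fixes P :: "real \<Rightarrow> bool"
  assumes "sa P"
  obtains Z where "finite Z" "\<And>u v. u \<le> v \<Longrightarrow> {u..v} \<inter> Z = {} \<Longrightarrow> P u = P v"
proof -
  obtain L where L: "finite L" "\<And>a. a \<in> L \<Longrightarrow> real_polynomial_function a" "\<And>z z'. agree L z z' \<Longrightarrow> P z \<Longrightarrow> P z'"
    using saE[OF assms] by blast
  have "\<exists>p. \<forall>x. a x = poly p x" if a: "a \<in> L" for a
  proof -
    obtain c n where "a = (\<lambda>x. \<Sum>i\<le>n. c i * x ^ i)"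
      using L(2)[OF a] real_polynomial_function_iff_sum by blast
    then have "\<forall>x. a x = poly (\<Sum>i\<le>n. monom (c i) i) x" by (simp add: poly_sum poly_monom)
    then show ?thesis by blast
  qed
  then obtain p where p: "\<And>a x. a \<in> L \<Longrightarrow> a x = poly (p a) x" by metis
  define Z where "Z = (\<Union>a\<in>{a\<in>L. p a \<noteq> 0}. {z. poly (p a) z = 0})"
  show thesis
  proof (rule that)
    show "finite Z" using L(1) by (auto simp: Z_def intro!: poly_roots_finite)
    fix u v assume uv: "u \<le> v" "{u..v} \<inter> Z = {}"
    have "sgn (a u) = sgn (a v)" if a: "a \<in> L" for a
    proof (cases "p a = 0")
      case False
      then have "poly (p a) z \<noteq> 0" if "u \<le> z" "z \<le> v" for z
        using uv(2) that a by (auto simp: Z_def)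
      then show ?thesis using uv(1) p[OF a] by (simp add: poly_same_sgn_if_no_root)
    qed (use p[OF a] in simp)
    then have "agree L u v" "agree L v u" by (auto simp: agree_def)
    then show "P u = P v" using L(3) by blast
  qed
qed

lemma finite_avoid_nhd:
  fixes Z :: "real set"
  assumes "finite Z" "r \<notin> Z"
  obtains d where "d > 0" "{r - d..r + d} \<inter> Z = {}"
proof -
  obtain e where "e > 0" "\<And>z. z \<in> Z \<Longrightarrow> e \<le> dist r z"
    using finite_set_avoid[OF assms(1), of r] assms(2) by metis
  then show thesis by (intro that[of "e/2"]) (force simp: dist_real_def)+
qed

lemma finite_avoid_right:
  fixes Z :: "real set"
  assumes "finite Z"
  obtains d where "d > 0" "{r<..<r + d} \<inter> Z = {}"
proof -
  obtain d where "d > 0" "{r - d..r + d} \<inter> (Z - {r}) = {}"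
    using finite_avoid_nhd[of "Z - {r}" r] assms by auto
  moreover have "{r<..<r + d} \<subseteq> {r - d..r + d} - {r}" by auto
  ultimately show thesis by (intro that[of d]) blast+
qed

lemma finite_avoid_left:
  fixes Z :: "real set"
  assumes "finite Z"
  obtains d where "d > 0" "{r - d<..<r} \<inter> Z = {}"
proof -
  obtain d where "d > 0" "{r - d..r + d} \<inter> (Z - {r}) = {}"
    using finite_avoid_nhd[of "Z - {r}" r] assms by auto
  moreover have "{r - d<..<r} \<subseteq> {r - d..r + d} - {r}" by auto
  ultimately show thesis by (intro that[of d]) blast+
qed

lemma sa_real_const_right:
  fixes P :: "real \<Rightarrow> bool"
  assumes "sa P"
  obtains d c where "d > 0" "\<And>s. r < s \<Longrightarrow> s < r + d \<Longrightarrow> P s = c"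
proof -
  obtain Z where Z: "finite Z" "\<And>u v. u \<le> v \<Longrightarrow> {u..v} \<inter> Z = {} \<Longrightarrow> P u = P v"
    using sa_real_finite_boundary[OF assms] by blast
  obtain d where d: "d > 0" "{r<..<r + d} \<inter> Z = {}" using finite_avoid_right[OF Z(1)] by blast
  have "P s = P (r + d / 2)" if "r < s" "s < r + d" for s
  proof (cases "s \<le> r + d/2")
    case True
    then show ?thesis using that d by (intro Z(2)) (auto simp: disjoint_iff)
  next
    case False
    then show ?thesis using that d by (intro Z(2)[symmetric]) (auto simp: disjoint_iff)
  qed
  then show thesis using that d(1) by blast
qed

lemma sa_real_const_left:
  fixes P :: "real \<Rightarrow> bool"
  assumes "sa P"
  obtains d c where "d > 0" "\<And>s. r - d < s \<Longrightarrow> s < r \<Longrightarrow> P s = c"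
proof -
  obtain Z where Z: "finite Z" "\<And>u v. u \<le> v \<Longrightarrow> {u..v} \<inter> Z = {} \<Longrightarrow> P u = P v"
    using sa_real_finite_boundary[OF assms] by blast
  obtain d where d: "d > 0" "{r - d<..<r} \<inter> Z = {}" using finite_avoid_left[OF Z(1)] by blast
  have "P s = P (r - d / 2)" if "r - d < s" "s < r" for s
  proof (cases "s \<le> r - d/2")
    case True
    then show ?thesis using that d by (intro Z(2)) (auto simp: disjoint_iff)
  next
    case False
    then show ?thesis using that d by (intro Z(2)[symmetric]) (auto simp: disjoint_iff)
  qed
  then show thesis using that d(1) by blast
qed

lemma sa_real_infinite_interval:
  fixes P :: "real \<Rightarrow> bool"
  assumes "sa P" "infinite {r. P r}"
  obtains p q where "p < q" "\<And>r. p \<le> r \<Longrightarrow> r \<le> q \<Longrightarrow> P r"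
proof -
  obtain Z where Z: "finite Z" "\<And>u v. u \<le> v \<Longrightarrow> {u..v} \<inter> Z = {} \<Longrightarrow> P u = P v"
    using sa_real_finite_boundary[OF assms(1)] by blast
  have "infinite ({r. P r} - Z)" using assms(2) Z(1) by simp
  then have "{r. P r} - Z \<noteq> {}" by (metis finite.emptyI)
  then obtain r where r: "P r" "r \<notin> Z" by blast
  obtain d where d: "d > 0" "{r - d..r + d} \<inter> Z = {}" using finite_avoid_nhd[OF Z(1) r(2)] by blast
  have "P s" if "r \<le> s" "s \<le> r + d" for s
    using Z(2)[of r s] that d r(1) by (auto simp: disjoint_iff)
  then show thesis using that[of r "r + d"] d(1) by simp
qed

definition sa_fun :: "(real \<Rightarrow> real) \<Rightarrow> bool" where
  "sa_fun F \<longleftrightarrow> sa (\<lambda>w::real \<times> real. snd w = F (fst w))"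

lemma sa_fun_app:
  assumes "sa_fun F" "real_polynomial_function g" "sa (\<lambda>w. Q (fst w) (snd w))"
  shows "sa (\<lambda>z. Q z (F (g z)))"
proof -
  have "polynomial_function (\<lambda>w::'a \<times> real. (g (fst w), snd w))"
  proof (rule polynomial_function_Pair)
    have "polynomial_function (\<lambda>w::'a \<times> real. fst w)" by (intro poly_intros)
    from real_polynomial_function_compose[OF this assms(2)]
    show "polynomial_function (\<lambda>w::'a \<times> real. g (fst w))" by (simp add: o_def real_polynomial_function_eq)
    show "polynomial_function (\<lambda>w::'a \<times> real. snd w)" by (intro poly_intros)
  qed
  from sa_compose[OF assms(1)[unfolded sa_fun_def] this]
  have "sa (\<lambda>z. \<exists>y. y = F (g z) \<and> Q z y)"
    by (intro sa_ex sa_conj assms(3)) simp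
  then show ?thesis by simp
qed

lemma sa_sgn [sa_intros]:
  assumes "real_polynomial_function p"
  shows "sa (\<lambda>z. sgn (p z) = k)"
  by (rule saI[of "{p}"]) (use assms in \<open>auto simp: agree_def\<close>)

section \<open>One-sided signs and the monotonicity theorem\<close>

definition right_sign :: "(real \<Rightarrow> real) \<Rightarrow> real \<Rightarrow> real \<Rightarrow> bool" where
  "right_sign F k r \<longleftrightarrow> (\<exists>d. d > 0 \<and> (\<forall>s. r < s \<and> s < r + d \<longrightarrow> sgn (F s - F r) = k))"

text \<open>The difference is oriented by increasing arguments, so that a strictly increasing
  function has sign 1 on both sides.\<close>

definition left_sign :: "(real \<Rightarrow> real) \<Rightarrow> real \<Rightarrow> real \<Rightarrow> bool" where
  "left_sign F k r \<longleftrightarrow> (\<exists>d. d > 0 \<and> (\<forall>s. r - d < s \<and> s < r \<longrightarrow> sgn (F r - F s) = k))"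

lemma sa_fun_diff_sgn:
  assumes "sa_fun F" "real_polynomial_function g" "real_polynomial_function h"
  shows "sa (\<lambda>z. sgn (F (g z) - F (h z)) = k)"
proof -
  have "polynomial_function (\<lambda>w::'a \<times> real. fst w)" by (intro poly_intros)
  from real_polynomial_function_compose[OF this assms(3)]
  have h: "real_polynomial_function (\<lambda>w::'a \<times> real. h (fst w))" by (simp add: o_def)
  show ?thesis
    by (rule sa_fun_app[OF assms(1,2), where Q = "\<lambda>z y. sgn (y - F (h z)) = k"],
        rule sa_fun_app[OF assms(1) h, where Q = "\<lambda>w y'. sgn (snd w - y') = k"])
       (intro sa_intros poly_intros)
qed

lemma sa_right_sign: "sa_fun F \<Longrightarrow> sa (right_sign F k)"
  and sa_left_sign: "sa_fun F \<Longrightarrow> sa (left_sign F k)"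
  unfolding right_sign_def left_sign_def by (intro sa_intros sa_fun_diff_sgn poly_intros; assumption)+

lemma ex_right_sign:
  assumes "sa_fun F"
  shows "\<exists>k\<in>{-1,0,1}. right_sign F k r"
proof -
  have *: "sa (\<lambda>s. sgn (F s - F r) = k)" for k
    using sa_fun_diff_sgn[OF assms, of "\<lambda>s. s" "\<lambda>s. r" k] by (simp add: real_polynomial_function.intros)
  obtain d1 c1 where 1: "d1 > 0" "\<And>s. r < s \<Longrightarrow> s < r + d1 \<Longrightarrow> (sgn (F s - F r) = 1) = c1"
    using sa_real_const_right[OF *] by blast
  obtain d2 c2 where 2: "d2 > 0" "\<And>s. r < s \<Longrightarrow> s < r + d2 \<Longrightarrow> (sgn (F s - F r) = 0) = c2"
    using sa_real_const_right[OF *] by blast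
  have "right_sign F (if c1 then 1 else if c2 then 0 else -1) r"
    unfolding right_sign_def
  proof (intro exI[of _ "min d1 d2"] conjI allI impI)
    fix s assume "r < s \<and> s < r + min d1 d2"
    then have "r < s" "s < r + d1" "s < r + d2" by auto
    then show "sgn (F s - F r) = (if c1 then 1 else if c2 then 0 else - 1)"
      using 1(2)[of s] 2(2)[of s] by (auto simp: sgn_if)
  qed (use 1 2 in auto)
  then show ?thesis by (auto split: if_splits)
qed

lemma ex_left_sign:
  assumes "sa_fun F"
  shows "\<exists>k\<in>{-1,0,1}. left_sign F k r"
proof -
  have *: "sa (\<lambda>s. sgn (F r - F s) = k)" for k
    using sa_fun_diff_sgn[OF assms, of "\<lambda>s. r" "\<lambda>s. s" k] by (simp add: real_polynomial_function.intros)
  obtain d1 c1 where 1: "d1 > 0" "\<And>s. r - d1 < s \<Longrightarrow> s < r \<Longrightarrow> (sgn (F r - F s) = 1) = c1"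
    using sa_real_const_left[OF *] by blast
  obtain d2 c2 where 2: "d2 > 0" "\<And>s. r - d2 < s \<Longrightarrow> s < r \<Longrightarrow> (sgn (F r - F s) = 0) = c2"
    using sa_real_const_left[OF *] by blast
  have "left_sign F (if c1 then 1 else if c2 then 0 else -1) r"
    unfolding left_sign_def
  proof (intro exI[of _ "min d1 d2"] conjI allI impI)
    fix s assume "r - min d1 d2 < s \<and> s < r"
    then have "s < r" "r - d1 < s" "r - d2 < s" by auto
    then show "sgn (F r - F s) = (if c1 then 1 else if c2 then 0 else - 1)"
      using 1(2)[of s] 2(2)[of s] by (auto simp: sgn_if)
  qed (use 1 2 in auto)
  then show ?thesis by (auto split: if_splits)
qed

lemma sgn_add_same:
  fixes a b :: real
  shows "sgn a = k \<Longrightarrow> sgn b = k \<Longrightarrow> sgn (a + b) = k"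
  by (auto simp: sgn_if split: if_splits)

text \<open>Increments add over adjacent intervals and have sign \<open>k\<close> on short intervals
  around each point, so Bolzano's bisection extends this to \<open>{u..v}\<close>.\<close>

lemma sgn_diff_if_local_signs:
  assumes "u < v" "\<And>r. u \<le> r \<Longrightarrow> r \<le> v \<Longrightarrow> right_sign F k r \<and> left_sign F k r"
  shows "sgn (F v - F u) = k"
proof -
  have "u < v \<longrightarrow> sgn (F v - F u) = k"
  proof (rule Bolzano[where P = "\<lambda>s t. s < t \<longrightarrow> sgn (F t - F s) = k"])
    show "u \<le> v" using assms(1) by simp
  next
    fix a b c assume *: "a < b \<longrightarrow> sgn (F b - F a) = k" "b < c \<longrightarrow> sgn (F c - F b) = k" "a \<le> b" "b \<le> c"
    show "a < c \<longrightarrow> sgn (F c - F a) = k"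
    proof (cases "a = b \<or> b = c")
      case False
      then have "sgn ((F c - F b) + (F b - F a)) = k" using * by (intro sgn_add_same) auto
      then show ?thesis by simp
    qed (use * in auto)
  next
    fix x assume "u \<le> x" "x \<le> v"
    then obtain d e where d: "d > 0" "\<And>s. x < s \<Longrightarrow> s < x + d \<Longrightarrow> sgn (F s - F x) = k"
      and e: "e > 0" "\<And>s. x - e < s \<Longrightarrow> s < x \<Longrightarrow> sgn (F x - F s) = k"
      using assms(2) unfolding right_sign_def left_sign_def by metis
    have "sgn (F b - F a) = k" if h: "a \<le> x" "x \<le> b" "b - a < min d e" "a < b" for a b
    proof -
      consider "a = x" | "b = x" | "a < x" "x < b" using h(1,2) by (metis order.order_iff_strict)
      then show ?thesis
      proof cases
        case 3
        then have "sgn ((F b - F x) + (F x - F a)) = k" using h d e by (intro sgn_add_same) auto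
        then show ?thesis by simp
      qed (use h d e in auto)
    qed
    then show "\<exists>d>0. \<forall>a b. a \<le> x \<and> x \<le> b \<and> b - a < d \<longrightarrow> a < b \<longrightarrow> sgn (F b - F a) = k"
      using d(1) e(1) by (intro exI[of _ "min d e"]) auto
  qed
  then show ?thesis using assms(1) by blast
qed

text \<open>A strict local minimum is the only minimum point on some interval with rational
  ends.\<close>

lemma countable_strict_local_minima:
  fixes F :: "real \<Rightarrow> real"
  shows "countable {r. \<exists>d>0. \<forall>s. s \<noteq> r \<and> \<bar>s - r\<bar> < d \<longrightarrow> F r < F s}"
proof -
  define M where "M a b = {r. a < r \<and> r < b \<and> (\<forall>s. a < s \<and> s < b \<and> s \<noteq> r \<longrightarrow> F r < F s)}" for a b
  have "countable (M a b)" for a b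
  proof (cases "M a b = {}")
    case False
    then obtain r where r: "r \<in> M a b" by blast
    have "M a b \<subseteq> {r}"
    proof
      fix s assume s: "s \<in> M a b"
      have "\<not> s \<noteq> r"
      proof
        assume "s \<noteq> r"
        then have "F r < F s" "F s < F r" using r s by (auto simp: M_def)
        then show False by simp
      qed
      then show "s \<in> {r}" by simp
    qed
    then show ?thesis by (rule countable_subset) simp
  qed simp
  then have "countable (\<Union>a\<in>\<rat>. \<Union>b\<in>\<rat>. M a b)" by (intro countable_UN countable_rat) auto
  moreover have "{r. \<exists>d>0. \<forall>s. s \<noteq> r \<and> \<bar>s - r\<bar> < d \<longrightarrow> F r < F s} \<subseteq> (\<Union>a\<in>\<rat>. \<Union>b\<in>\<rat>. M a b)"
  proof
    fix r assume "r \<in> {r. \<exists>d>0. \<forall>s. s \<noteq> r \<and> \<bar>s - r\<bar> < d \<longrightarrow> F r < F s}"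
    then obtain d where d: "d > 0" "\<And>s. s \<noteq> r \<Longrightarrow> \<bar>s - r\<bar> < d \<Longrightarrow> F r < F s" by auto
    obtain a where a: "a \<in> \<rat>" "r - d < a" "a < r" using Rats_dense_in_real[of "r - d" r] d(1) by auto
    obtain b where b: "b \<in> \<rat>" "r < b" "b < r + d" using Rats_dense_in_real[of r "r + d"] d(1) by auto
    have "r \<in> M a b" using a b d(2) by (auto simp: M_def)
    then show "r \<in> (\<Union>a\<in>\<rat>. \<Union>b\<in>\<rat>. M a b)" using a b by blast
  qed
  ultimately show ?thesis by (rule countable_subset[rotated])
qed

lemma local_signs_opposite_impossible:
  assumes "p < q" "\<And>r. p < r \<Longrightarrow> r < q \<Longrightarrow> right_sign F 1 r \<and> left_sign F (-1) r"
  shows False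
proof -
  have "{p<..<q} \<subseteq> {r. \<exists>d>0. \<forall>s. s \<noteq> r \<and> \<bar>s - r\<bar> < d \<longrightarrow> F r < F s}"
  proof
    fix r assume "r \<in> {p<..<q}"
    then obtain d e where d: "d > 0" "\<And>s. r < s \<Longrightarrow> s < r + d \<Longrightarrow> sgn (F s - F r) = 1"
      and e: "e > 0" "\<And>s. r - e < s \<Longrightarrow> s < r \<Longrightarrow> sgn (F r - F s) = -1"
      using assms(2)[of r] unfolding right_sign_def left_sign_def by (metis greaterThanLessThan_iff)
    have "F r < F s" if "s \<noteq> r" "\<bar>s - r\<bar> < min d e" for s
      using that d(2)[of s] e(2)[of s] by (cases "r < s") (auto simp: sgn_1_pos sgn_1_neg)
    then show "r \<in> {r. \<exists>d>0. \<forall>s. s \<noteq> r \<and> \<bar>s - r\<bar> < d \<longrightarrow> F r < F s}"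
      using d(1) e(1) by (auto intro!: exI[of _ "min d e"])
  qed
  then have "countable {p<..<q}" using countable_strict_local_minima countable_subset by blast
  then show False using assms(1) uncountable_open_interval by blast
qed

lemma right_sign_uminus: "right_sign (\<lambda>x. - F x) k r \<longleftrightarrow> right_sign F (- k) r"
  and left_sign_uminus: "left_sign (\<lambda>x. - F x) k r \<longleftrightarrow> left_sign F (- k) r"
proof -
  have "sgn (- F s - - F t) = k \<longleftrightarrow> sgn (F s - F t) = - k" for s t by (auto simp: sgn_if)
  then show "right_sign (\<lambda>x. - F x) k r \<longleftrightarrow> right_sign F (- k) r"
    "left_sign (\<lambda>x. - F x) k r \<longleftrightarrow> left_sign F (- k) r"
    unfolding right_sign_def left_sign_def by (simp_all only:)
qed

text \<open>Opposite nonzero signs would make every point a strict local extremum, but such points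
  are countable. A sign 0 on one side gives an interval of constancy, which forces 0 on the
  other.\<close>

lemma local_signs_agree:
  assumes pq: "p < q" and rs: "\<And>r. p < r \<Longrightarrow> r < q \<Longrightarrow> right_sign F k r"
    and ls: "\<And>r. p < r \<Longrightarrow> r < q \<Longrightarrow> left_sign F l r"
    and kl: "k \<in> {-1, 0, 1}" "l \<in> {-1, 0, 1}"
  shows "k = l"
proof -
  define m where "m = (p + q) / 2"
  have m: "p < m" "m < q" using pq by (auto simp: m_def)
  have k0: "l = 0" if "k = 0"
  proof -
    obtain d where d: "d > 0" "\<And>s. m < s \<Longrightarrow> s < m + d \<Longrightarrow> F s = F m"
      using rs[OF m] \<open>k = 0\<close> unfolding right_sign_def by (auto simp: sgn_0_0)
    define s where "s = m + min d (q - m) / 2"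
    have s: "m < s" "s < m + d" "s < q" using d(1) m by (auto simp: s_def min_def field_simps)
    then obtain e where e: "e > 0" "\<And>z. s - e < z \<Longrightarrow> z < s \<Longrightarrow> sgn (F s - F z) = l"
      using ls[of s] m unfolding left_sign_def by auto
    define z where "z = s - min e (s - m) / 2"
    have z: "m < z" "z < s" "s - e < z" using e(1) s by (auto simp: z_def min_def field_simps)
    have "F z = F m" "F s = F m" using d(2) s z by auto
    then show "l = 0" using e(2)[OF z(3,2)] by simp
  qed
  have l0: "k = 0" if "l = 0"
  proof -
    obtain d where d: "d > 0" "\<And>s. m - d < s \<Longrightarrow> s < m \<Longrightarrow> F s = F m"
      using ls[OF m] \<open>l = 0\<close> unfolding left_sign_def by (auto simp: sgn_0_0)
    define s where "s = m - min d (m - p) / 2"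
    have s: "s < m" "m - d < s" "p < s" using d(1) m by (auto simp: s_def min_def field_simps)
    then obtain e where e: "e > 0" "\<And>z. s < z \<Longrightarrow> z < s + e \<Longrightarrow> sgn (F z - F s) = k"
      using rs[of s] m unfolding right_sign_def by auto
    define z where "z = s + min e (m - s) / 2"
    have z: "z < m" "s < z" "z < s + e" using e(1) s by (auto simp: z_def min_def field_simps)
    have "F z = F m" "F s = F m" using d(2) s z by auto
    then show "k = 0" using e(2)[OF z(2,3)] by simp
  qed
  have "\<not> (k = 1 \<and> l = -1)"
    using local_signs_opposite_impossible[OF pq, of F] rs ls by blast
  moreover have "\<not> (k = -1 \<and> l = 1)"
  proof
    assume *: "k = -1 \<and> l = 1"
    have "right_sign (\<lambda>x. - F x) 1 r \<and> left_sign (\<lambda>x. - F x) (-1) r" if "p < r" "r < q" for r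
      using rs[OF that] ls[OF that] * by (simp add: right_sign_uminus left_sign_uminus)
    then show False using local_signs_opposite_impossible[OF pq] by blast
  qed
  ultimately show ?thesis using kl k0 l0 by auto
qed

definition piecewise_monotone :: "real set \<Rightarrow> (real \<Rightarrow> real) \<Rightarrow> bool" where
  "piecewise_monotone E F \<longleftrightarrow>
     (\<forall>u v. u \<le> v \<and> {u..v} \<inter> E = {} \<longrightarrow> mono_on {u..v} F \<or> antimono_on {u..v} F)"

lemma piecewise_monotone_subset: "piecewise_monotone E F \<Longrightarrow> E \<subseteq> E' \<Longrightarrow> piecewise_monotone E' F"
  unfolding piecewise_monotone_def by blast

text \<open>Off \<open>E\<close> the one-sided signs are locally constant and agree, so all
  increments within a piece have the same sign.\<close>

lemma sa_fun_piecewise_monotone: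
  assumes "sa_fun F"
  obtains E where "finite E" "piecewise_monotone E F"
proof -
  have "\<exists>Z. finite Z \<and> (\<forall>u v. u \<le> v \<longrightarrow> {u..v} \<inter> Z = {} \<longrightarrow> right_sign F k u = right_sign F k v)" for k
    using sa_real_finite_boundary[OF sa_right_sign[OF assms]] by metis
  then obtain Z where Z: "\<And>k. finite (Z k)" "\<And>k u v. u \<le> v \<Longrightarrow> {u..v} \<inter> Z k = {} \<Longrightarrow> right_sign F k u = right_sign F k v"
    by metis
  have "\<exists>Z. finite Z \<and> (\<forall>u v. u \<le> v \<longrightarrow> {u..v} \<inter> Z = {} \<longrightarrow> left_sign F k u = left_sign F k v)" for k
    using sa_real_finite_boundary[OF sa_left_sign[OF assms]] by metis
  then obtain Y where Y: "\<And>k. finite (Y k)" "\<And>k u v. u \<le> v \<Longrightarrow> {u..v} \<inter> Y k = {} \<Longrightarrow> left_sign F k u = left_sign F k v"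
    by metis
  define E where "E = (\<Union>k\<in>{-1,0,1}. Z k \<union> Y k)"
  have "mono_on {u..v} F \<or> antimono_on {u..v} F" if uv: "u \<le> v" "{u..v} \<inter> E = {}" for u v
  proof (cases "u = v")
    case True
    then show ?thesis by (auto intro!: mono_onI)
  next
    case False
    then have "u < v" using uv by simp
    obtain k l where k: "k \<in> {-1,0,1}" "right_sign F k u" and l: "l \<in> {-1,0,1}" "left_sign F l u"
      using ex_right_sign[OF assms] ex_left_sign[OF assms] by metis
    have kZ: "{u..v} \<inter> Z k = {}" and lY: "{u..v} \<inter> Y l = {}" using uv(2) k(1) l(1) unfolding E_def by blast+
    have R: "right_sign F k r" "left_sign F l r" if "u \<le> r" "r \<le> v" for r
    proof -
      have "{u..r} \<subseteq> {u..v}" using that by auto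
      then have "{u..r} \<inter> Z k = {}" "{u..r} \<inter> Y l = {}" using kZ lY by blast+
      then show "right_sign F k r" "left_sign F l r" using Z(2)[of u r k] Y(2)[of u r l] k(2) l(2) that(1) by blast+
    qed
    have "k = l" using local_signs_agree[OF \<open>u < v\<close> _ _ k(1) l(1), of F] R by simp
    then have s: "sgn (F b - F a) = k" if "u \<le> a" "a < b" "b \<le> v" for a b
      using sgn_diff_if_local_signs[OF that(2), of F k] R that by simp
    show ?thesis
    proof (cases "k = -1")
      case True
      have "F b \<le> F a" if "u \<le> a" "a \<le> b" "b \<le> v" for a b
        using s[of a b] that True by (cases "a = b") (auto simp: sgn_1_neg)
      then show ?thesis by (auto simp: monotone_on_def)
    next
      case False
      have "F a \<le> F b" if "u \<le> a" "a \<le> b" "b \<le> v" for a b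
        using s[of a b] that False k(1) by (cases "a = b") (auto simp: sgn_1_pos sgn_0_0)
      then show ?thesis by (auto simp: monotone_on_def)
    qed
  qed
  moreover have "finite E" using Z(1) Y(1) by (auto simp: E_def)
  ultimately show thesis using that by (auto simp: piecewise_monotone_def)
qed

lemma countable_discontinuities_monotone:
  fixes F :: "real \<Rightarrow> real"
  assumes "mono_on {p..q} F \<or> antimono_on {p..q} F"
  shows "countable {r \<in> {p<..<q}. \<not> isCont F r}"
proof -
  have *: "countable {r \<in> {p<..<q}. \<not> isCont G r}" if "mono_on {p..q} G" for G :: "real \<Rightarrow> real"
  proof -
    have "mono_on {p<..<q} G" using that by (rule mono_on_subset) auto
    from mono_on_ctble_discont[OF this] show ?thesis
      by (rule countable_subset[rotated]) (auto simp: at_within_open[of _ "{p<..<q}"])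
  qed
  show ?thesis
  proof (cases "mono_on {p..q} F")
    case False
    then have "mono_on {p..q} (\<lambda>x. - F x)" using assms by (auto simp: monotone_on_def)
    from *[OF this] show ?thesis
      by (rule countable_subset[rotated]) (auto dest: continuous_minus)
  qed (rule *)
qed

lemma sa_isCont:
  assumes "sa_fun F"
  shows "sa (\<lambda>r. isCont F r)"
proof -
  \<comment> \<open>Only the graph of \<open>F\<close> is known to be semialgebraic, so its values
    are named by quantified variables.\<close>
  have "isCont F r \<longleftrightarrow> (\<forall>e. e > 0 \<longrightarrow> (\<exists>d. d > 0 \<and> (\<forall>s. s - r < d \<and> r - s < d \<longrightarrow>
      (\<exists>y z. y = F s \<and> z = F r \<and> y - z < e \<and> z - y < e))))" for r
    unfolding continuous_at_real_range real_norm_def by (auto simp: abs_less_iff)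
  moreover have "sa (\<lambda>r. \<forall>e. e > 0 \<longrightarrow> (\<exists>d. d > 0 \<and> (\<forall>s. s - r < d \<and> r - s < d \<longrightarrow>
      (\<exists>y z. y = F s \<and> z = F r \<and> y - z < e \<and> z - y < e))))"
  proof -
    have c: "sa (\<lambda>z. h z = F (g z))" if "real_polynomial_function h" "real_polynomial_function g" for h g :: "'c::euclidean_space \<Rightarrow> real"
      using sa_compose[OF assms[unfolded sa_fun_def] polynomial_function_Pair, of g h] that
      by (simp add: real_polynomial_function_eq)
    show ?thesis by (intro sa_intros c poly_intros)
  qed
  ultimately show ?thesis by simp
qed

text \<open>An infinite set of discontinuities would contain an interval; on a part of it
  \<open>F\<close> is monotone and has only countably many.\<close>

lemma sa_fun_continuous:
  assumes "sa_fun F"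
  shows "finite {r. \<not> isCont F r}"
proof (rule ccontr)
  assume inf: "infinite {r. \<not> isCont F r}"
  obtain E where E: "finite E" "piecewise_monotone E F" using sa_fun_piecewise_monotone[OF assms] .
  obtain p q where pq: "p < q" "\<And>r. p \<le> r \<Longrightarrow> r \<le> q \<Longrightarrow> \<not> isCont F r"
    using sa_real_infinite_interval[OF sa_not[OF sa_isCont[OF assms]] inf] by blast
  obtain d where d: "d > 0" "{p<..<p + d} \<inter> E = {}" using finite_avoid_right[OF E(1)] by blast
  define a b where "a = p + min d (q - p) / 3" and "b = p + min d (q - p) / 2"
  have ab: "a < b" "p < a" "b < p + d" "b < q" using d(1) pq(1) by (auto simp: a_def b_def min_def field_simps)
  have "{a..b} \<inter> E = {}" using ab d(2) by (auto simp: disjoint_iff)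
  then have "mono_on {a..b} F \<or> antimono_on {a..b} F" using E(2) ab(1) by (auto simp: piecewise_monotone_def)
  then have "countable {r \<in> {a<..<b}. \<not> isCont F r}" by (rule countable_discontinuities_monotone)
  moreover have "{r \<in> {a<..<b}. \<not> isCont F r} = {a<..<b}" using pq(2) ab by auto
  ultimately show False using uncountable_open_interval[of a b] ab(1) by simp
qed

section \<open>Curve selection\<close>

lemma sa_app2:
  assumes "sa (\<lambda>w. A (fst w) (snd w))" "polynomial_function f" "polynomial_function g"
  shows "sa (\<lambda>z. A (f z) (g z))"
  using sa_compose[OF assms(1) polynomial_function_Pair[OF assms(2,3)]] by simp

section \<open>Definable choice\<close>

definition greatest_lower :: "(real \<Rightarrow> bool) \<Rightarrow> real \<Rightarrow> bool" where
  "greatest_lower T a \<longleftrightarrow> (\<forall>s. T s \<longrightarrow> a \<le> s) \<and> (\<forall>a'. (\<forall>s. T s \<longrightarrow> a' \<le> s) \<longrightarrow> a' \<le> a)"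

text \<open>This and \<open>greatest_lower\<close> are first-order formulas, so that quantifier
  elimination applies to suprema and infima.\<close>

definition least_upper :: "(real \<Rightarrow> bool) \<Rightarrow> real \<Rightarrow> bool" where
  "least_upper T a \<longleftrightarrow> (\<forall>s. T s \<longrightarrow> s \<le> a) \<and> (\<forall>a'. (\<forall>s. T s \<longrightarrow> s \<le> a') \<longrightarrow> a \<le> a')"

text \<open>
  A canonical element of a nonempty bounded semialgebraic set of reals: its minimum or, if there is none,
  the midpoint of its leftmost interval.
\<close>

definition pick :: "(real \<Rightarrow> bool) \<Rightarrow> real \<Rightarrow> bool" where
  "pick T t \<longleftrightarrow> T t \<and> (\<forall>s. T s \<longrightarrow> t \<le> s) \<or>
     \<not> (\<exists>m. T m \<and> (\<forall>s. T s \<longrightarrow> m \<le> s)) \<and>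
     (\<exists>a c. greatest_lower T a \<and> least_upper (\<lambda>c. a < c \<and> (\<forall>s. a < s \<and> s < c \<longrightarrow> T s)) c \<and> 2 * t = a + c)"

lemma greatest_lower_unique: "greatest_lower T a \<Longrightarrow> greatest_lower T b \<Longrightarrow> a = b"
  unfolding greatest_lower_def by (meson order_antisym)

lemma least_upper_unique: "least_upper T a \<Longrightarrow> least_upper T b \<Longrightarrow> a = b"
  unfolding least_upper_def by (meson order_antisym)

lemma pick_unique:
  assumes "pick T s" "pick T t"
  shows "s = t"
proof (cases "\<exists>m. T m \<and> (\<forall>s. T s \<longrightarrow> m \<le> s)")
  case True
  then show ?thesis using assms unfolding pick_def by (meson order_antisym)
next
  case False
  obtain a c where 1: "greatest_lower T a" "least_upper (\<lambda>c. a < c \<and> (\<forall>s. a < s \<and> s < c \<longrightarrow> T s)) c" "2 * s = a + c"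
    using assms(1) False unfolding pick_def by blast
  obtain a' c' where 2: "greatest_lower T a'" "least_upper (\<lambda>c. a' < c \<and> (\<forall>s. a' < s \<and> s < c \<longrightarrow> T s)) c'" "2 * t = a' + c'"
    using assms(2) False unfolding pick_def by blast
  have "a = a'" using 1(1) 2(1) by (rule greatest_lower_unique)
  moreover have "c = c'" using 1(2) 2(2) unfolding \<open>a = a'\<close> by (rule least_upper_unique)
  ultimately show ?thesis using 1(3) 2(3) by simp
qed

lemma pick_exists:
  assumes "sa T" "\<And>s. T s \<Longrightarrow> \<bar>s\<bar> \<le> C" "T s0"
  obtains t where "pick T t" "T t"
proof (cases "\<exists>m. T m \<and> (\<forall>s. T s \<longrightarrow> m \<le> s)")
  case True
  then show ?thesis using that unfolding pick_def by blast
next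
  case False
  define a where "a = Inf {s. T s}"
  have bdd: "bdd_below {s. T s}" using assms(2) by (intro bdd_belowI[of _ "- C"]) (auto simp: abs_le_iff, smt (verit))
  have a: "greatest_lower T a"
    unfolding greatest_lower_def a_def using bdd assms(3)
    by (auto intro: cInf_lower cInf_greatest)
  obtain d k where d: "d > 0" "\<And>s. a < s \<Longrightarrow> s < a + d \<Longrightarrow> T s = k"
    using sa_real_const_right[OF assms(1)] by blast
  have "\<not> T a" using a False unfolding greatest_lower_def by blast
  \<comment> \<open>Without a minimum, \<open>a\<close> itself is not in \<open>T\<close>; if
    \<open>T\<close> also failed just to the right, \<open>a + d\<close> would be a larger lower
    bound.\<close>
  have "k"
  proof (rule ccontr)
    assume "\<not> k"
    then have "a + d \<le> s" if "T s" for s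
      using d(2)[of s] that a \<open>\<not> T a\<close> unfolding greatest_lower_def by (metis linorder_not_le order_less_le)
    then have "a + d \<le> a" using a unfolding greatest_lower_def by blast
    then show False using d(1) by simp
  qed
  define P where "P c \<longleftrightarrow> a < c \<and> (\<forall>s. a < s \<and> s < c \<longrightarrow> T s)" for c
  have Pd: "P (a + d)" using d \<open>k\<close> by (simp add: P_def)
  have PC: "c \<le> C" if "P c" for c
  proof (rule ccontr)
    assume n: "\<not> c \<le> C"
    define s where "s = (max a C + c) / 2"
    have "a < s" "s < c" "C < s" using that n by (auto simp: s_def P_def max_def field_simps)
    then have "T s" using that by (auto simp: P_def)
    then show False using assms(2)[of s] \<open>C < s\<close> by simp
  qed
  define c where "c = Sup {c. P c}"
  have c: "least_upper P c"
    unfolding least_upper_def c_def using Pd PC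
    by (auto intro!: cSup_upper cSup_least bdd_aboveI[of _ C])
  define t where "t = (a + c) / 2"
  have "a + d \<le> c" using c Pd unfolding least_upper_def by blast
  then have t: "a < t" "t < c" using d(1) by (auto simp: t_def)
  then obtain c' where "P c'" "t < c'" using c unfolding least_upper_def by (meson not_le)
  then have "T t" using t by (auto simp: P_def)
  have P: "P = (\<lambda>c. a < c \<and> (\<forall>s. a < s \<and> s < c \<longrightarrow> T s))" by (simp add: P_def fun_eq_iff)
  have "2 * t = a + c" by (simp add: t_def)
  then have "\<exists>a c. greatest_lower T a \<and> least_upper (\<lambda>c. a < c \<and> (\<forall>s. a < s \<and> s < c \<longrightarrow> T s)) c \<and> 2 * t = a + c"
    using a c[unfolded P] by (intro exI[of _ a] exI[of _ c]) simp
  then have "pick T t" using False unfolding pick_def by blast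
  then show ?thesis using that \<open>T t\<close> by blast
qed

lemma sa_pick:
  assumes "sa (\<lambda>w. T (fst w) (snd w))" "polynomial_function f" "real_polynomial_function g"
  shows "sa (\<lambda>z. pick (T (f z)) (g z))"
proof -
  note T = sa_app2[OF assms(1)]
  have "sa (\<lambda>w. pick (T (fst w)) (snd w))"
    unfolding pick_def greatest_lower_def least_upper_def
    by (intro sa_intros T poly_intros)
  from sa_app2[OF this assms(2), of g] show ?thesis using assms(3) by (simp add: real_polynomial_function_eq)
qed

text \<open>Coordinates are fixed one after another: the next is picked among the values compatible
  with the earlier choices, a set that is semialgebraic as a projection and bounded by
  \<open>C\<close>.\<close>

lemma sa_choice_coordinates:
  fixes A :: "'a::euclidean_space \<Rightarrow> 'b::euclidean_space \<Rightarrow> bool"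
  assumes "sa (\<lambda>w. A (fst w) (snd w))" "\<And>x y. A x y \<Longrightarrow> norm y \<le> C" "finite B" "B \<subseteq> Basis"
  shows "\<exists>A'. sa (\<lambda>w. A' (fst w) (snd w)) \<and> (\<forall>x y. A' x y \<longrightarrow> A x y) \<and> (\<forall>x y. A x y \<longrightarrow> (\<exists>y. A' x y)) \<and>
     (\<forall>b\<in>B. \<forall>x y y'. A' x y \<longrightarrow> A' x y' \<longrightarrow> y \<bullet> b = y' \<bullet> b)"
  using assms(3,4)
proof (induction B)
  case empty
  then show ?case using assms(1) by (intro exI[of _ A]) auto
next
  case (insert b B)
  then obtain A' where A': "sa (\<lambda>w. A' (fst w) (snd w))" "\<And>x y. A' x y \<Longrightarrow> A x y" "\<And>x y. A x y \<Longrightarrow> \<exists>y. A' x y"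
     "\<And>b x y y'. b \<in> B \<Longrightarrow> A' x y \<Longrightarrow> A' x y' \<Longrightarrow> y \<bullet> b = y' \<bullet> b" by blast
  define T where "T x t \<longleftrightarrow> (\<exists>y. A' x y \<and> t = y \<bullet> b)" for x t
  have T: "sa (\<lambda>w. T (fst w) (snd w))"
    unfolding T_def by (intro sa_intros sa_app2[OF A'(1)] poly_intros)
  define A'' where "A'' x y \<longleftrightarrow> A' x y \<and> pick (T x) (y \<bullet> b)" for x y
  have "sa (\<lambda>w. A'' (fst w) (snd w))"
    unfolding A''_def by (intro sa_intros A'(1) sa_pick[OF T] poly_intros)
  moreover have "\<forall>x y. A'' x y \<longrightarrow> A x y" using A'(2) by (auto simp: A''_def)
  moreover have "\<exists>y. A'' x y" if Axy: "A x y" for x y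
  proof -
    obtain y' where y': "A' x y'" using A'(3)[OF Axy] by blast
    have "sa (\<lambda>s. T x s)" using sa_app2[OF T, of "\<lambda>s. x" "\<lambda>s. s"] by simp
    moreover have "\<bar>t\<bar> \<le> C" if "T x t" for t
    proof -
      obtain z where z: "A' x z" "t = z \<bullet> b" using \<open>T x t\<close> by (auto simp: T_def)
      have "\<bar>t\<bar> \<le> norm z" using z insert.prems by (simp add: Basis_le_norm)
      also have "\<dots> \<le> C" using A'(2)[OF z(1)] assms(2) by blast
      finally show ?thesis .
    qed
    moreover have "T x (y' \<bullet> b)" using y' by (auto simp: T_def)
    ultimately obtain t where t: "pick (T x) t" "T x t" using pick_exists by metis
    then obtain z where "A' x z" "t = z \<bullet> b" by (auto simp: T_def)
    then show ?thesis using t(1) unfolding A''_def by blast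
  qed
  moreover have "y \<bullet> c = y' \<bullet> c" if "c \<in> insert b B" "A'' x y" "A'' x y'" for c x y y'
    using that A'(4) pick_unique[of "T x" "y \<bullet> b" "y' \<bullet> b"] unfolding A''_def by blast
  ultimately show ?case by (intro exI[of _ A'']) blast
qed

lemma sa_choice:
  fixes A :: "real \<Rightarrow> 'b::euclidean_space \<Rightarrow> bool"
  assumes "sa (\<lambda>w. A (fst w) (snd w))" "\<And>r y. A r y \<Longrightarrow> norm y \<le> C"
  shows "\<exists>X. (\<forall>r y. A r y \<longrightarrow> A r (X r)) \<and> (\<forall>b. sa_fun (\<lambda>r. X r \<bullet> b)) \<and> (\<forall>r. norm (X r) \<le> max 0 C)"
proof -
  have "\<exists>A'. sa (\<lambda>w. A' (fst w) (snd w)) \<and> (\<forall>x y. A' x y \<longrightarrow> A x y) \<and> (\<forall>x y. A x y \<longrightarrow> (\<exists>y. A' x y)) \<and>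
     (\<forall>b\<in>Basis. \<forall>x y y'. A' x y \<longrightarrow> A' x y' \<longrightarrow> y \<bullet> b = y' \<bullet> b)"
    by (rule sa_choice_coordinates[where C = C]) (use assms in auto)
  then obtain A' where A': "sa (\<lambda>w. A' (fst w) (snd w))" "\<And>x y. A' x y \<Longrightarrow> A x y" "\<And>x y. A x y \<Longrightarrow> \<exists>y. A' x y"
     "\<And>b x y y'. b \<in> Basis \<Longrightarrow> A' x y \<Longrightarrow> A' x y' \<Longrightarrow> y \<bullet> b = y' \<bullet> b"
    by blast
  have uniq: "y = y'" if "A' x y" "A' x y'" for x y y'
    by (rule euclidean_eqI) (rule A'(4)[OF _ that])
  \<comment> \<open>The default 0 keeps the graph semialgebraic and \<open>X\<close> bounded;
    \<open>max 0 C\<close> allows for a negative \<open>C\<close>, possible if \<open>A\<close> is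
    empty.\<close>
  define X where "X r = (if \<exists>y. A' r y then SOME y. A' r y else 0)" for r
  have X: "A' r (X r)" if "A' r y" for r y
    using that unfolding X_def by (auto intro: someI)
  show ?thesis
  proof (intro exI[of _ X] conjI allI impI)
    show "A r (X r)" if "A r y" for r y using A'(2,3) X that by blast
    show "norm (X r) \<le> max 0 C" for r
    proof (cases "\<exists>y. A' r y")
      case True
      then have "norm (X r) \<le> C" using X A'(2) assms(2) by blast
      then show ?thesis by simp
    qed (simp add: X_def)
    fix b
    have "s = X r \<bullet> b \<longleftrightarrow> (\<exists>y. A' r y \<and> s = y \<bullet> b) \<or> \<not> (\<exists>y. A' r y) \<and> s = 0" for r s
    proof (cases "\<exists>y. A' r y")
      case True
      then have "A' r (X r)" using X by blast
      then show ?thesis using uniq by metis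
    next
      case False
      then have "X r = 0" unfolding X_def by (rule if_not_P)
      then show ?thesis using False by (simp add: inner_zero_left)
    qed
    moreover have "sa (\<lambda>w::real \<times> real. (\<exists>y. A' (fst w) y \<and> snd w = y \<bullet> b) \<or> \<not> (\<exists>y. A' (fst w) y) \<and> snd w = 0)"
      by (intro sa_intros sa_app2[OF A'(1)] poly_intros)
    ultimately show "sa_fun (\<lambda>r. X r \<bullet> b)" unfolding sa_fun_def by presburger
  qed
qed

text \<open>\<open>h\<close> is the variation function of \<open>F\<close> with the jumps across \<open>E\<close> left out.\<close>

lemma piecewise_monotone_variation:
  fixes F :: "real \<Rightarrow> real"
  assumes E: "finite E" "piecewise_monotone E F" and C: "\<And>r. \<bar>F r\<bar> \<le> C"
  shows "\<exists>h K. mono h \<and> (\<forall>r. 0 \<le> h r \<and> h r \<le> K) \<and>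
     (\<forall>r' r. r' \<le> r \<longrightarrow> {r'..r} \<inter> E = {} \<longrightarrow> \<bar>F r - F r'\<bar> \<le> h r - h r')"
proof -
  \<comment> \<open>\<open>J T\<close> is the piece of the line off \<open>E\<close> whose left
    neighbours in \<open>E\<close> are exactly \<open>T\<close>; for most subsets \<open>T\<close>
    it may be empty.\<close>
  define J where "J T = {s. s \<notin> E \<and> {e\<in>E. e < s} = T}" for T
  \<comment> \<open>On one piece \<open>F\<close> is monotone, so its variation up to
    \<open>r\<close> is the largest increment. The element 0 serves pieces with no point up to
    \<open>r\<close>.\<close>
  define V where "V T r = insert 0 {\<bar>F b - F a\<bar> | a b. a \<in> J T \<and> b \<in> J T \<and> a \<le> b \<and> b \<le> r}" for T r
  define h where "h r = (\<Sum>T\<in>Pow E. Sup (V T r))" for r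
  have V2: "v \<le> 2 * C" if v: "v \<in> V T r" for v T r
  proof -
    have "0 \<le> C" using C[of 0] by linarith
    moreover have "\<bar>F b - F a\<bar> \<le> 2 * C" for a b using C[of a] C[of b] by linarith
    ultimately show ?thesis using v by (auto simp: V_def)
  qed
  have bdd: "bdd_above (V T r)" for T r using V2 by (rule bdd_aboveI)
  have ne: "V T r \<noteq> {}" "0 \<in> V T r" for T r by (auto simp: V_def)
  have monoV: "Sup (V T r') \<le> Sup (V T r)" if "r' \<le> r" for T r r'
    by (rule cSup_subset_mono[OF ne(1) bdd]) (use that in \<open>auto simp: V_def\<close>, fastforce)
  have "mono h" unfolding h_def by (intro monoI sum_mono monoV)
  moreover have "0 \<le> h r" for r unfolding h_def by (intro sum_nonneg cSup_upper ne bdd)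
  moreover have "h r \<le> (\<Sum>T\<in>Pow E. 2 * C)" for r unfolding h_def by (intro sum_mono cSup_least ne V2)
  moreover have "\<bar>F r - F r'\<bar> \<le> h r - h r'" if r: "r' \<le> r" "{r'..r} \<inter> E = {}" for r r'
  proof -
    define T where "T = {e\<in>E. e < r'}"
    have J: "r' \<in> J T" using r by (auto simp: J_def T_def disjoint_iff)
    have "e < r'" if "e \<in> E" "e < r" for e
    proof -
      have "e \<notin> {r'..r}" using that(1) r(2) by blast
      then show ?thesis using that(2) by auto
    qed
    then have J': "r \<in> J T" using r by (auto simp: J_def T_def disjoint_iff)
    have avoid: "{a..b} \<inter> E = {}" if "a \<in> J T" "b \<in> J T" for a b
    proof (rule ccontr)
      assume "{a..b} \<inter> E \<noteq> {}"
      then obtain e where e: "e \<in> E" "a \<le> e" "e \<le> b" by auto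
      then have "e < b" using that(2) by (cases "e = b") (auto simp: J_def)
      then have "e \<in> T" using that(2) e(1) by (auto simp: J_def)
      then have "e < a" using that(1) by (auto simp: J_def)
      then show False using e(2) by simp
    qed
    have VI: "\<bar>F b - F a\<bar> \<in> V T z" if "a \<in> J T" "b \<in> J T" "a \<le> b" "b \<le> z" for a b T z
      using that unfolding V_def by blast
    have *: "v + \<bar>F r - F r'\<bar> \<le> Sup (V T r)" if v: "v \<in> V T r'" for v
    proof -
      have "\<bar>F r - F r'\<bar> \<in> V T r" unfolding V_def using J J' r(1) by blast
      then have 0: "\<bar>F r - F r'\<bar> \<le> Sup (V T r)" using bdd by (rule cSup_upper)
      consider "v = 0" | a b where "a \<in> J T" "b \<in> J T" "a \<le> b" "b \<le> r'" "v = \<bar>F b - F a\<bar>"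
        using v unfolding V_def by blast
      then show ?thesis
      proof cases
        case 1
        then show ?thesis using 0 by simp
      next
        case 2
        have "mono_on {a..r} F \<or> antimono_on {a..r} F"
          using E(2) avoid[OF 2(1) J'] 2 r(1) unfolding piecewise_monotone_def by auto
        then have "v + \<bar>F r - F r'\<bar> \<le> \<bar>F r - F a\<bar>"
        proof
          assume m: "mono_on {a..r} F"
          have "F a \<le> F b" "F b \<le> F r'" "F r' \<le> F r" using 2 r(1) by (auto intro!: mono_onD[OF m])
          then show ?thesis using 2 by simp
        next
          assume m: "antimono_on {a..r} F"
          have "F a \<ge> F b" "F b \<ge> F r'" "F r' \<ge> F r" using 2 r(1) by (auto intro!: monotone_onD[OF m])
          then show ?thesis using 2 by simp
        qed
        also have "\<bar>F r - F a\<bar> \<in> V T r" using VI[of a T r r] J' 2 r(1) by simp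
        then have "\<bar>F r - F a\<bar> \<le> Sup (V T r)" using bdd by (rule cSup_upper)
        finally show ?thesis .
      qed
    qed
    have "Sup (V T r') \<le> Sup (V T r) - \<bar>F r - F r'\<bar>"
      by (rule cSup_least[OF ne(1)]) (use * in \<open>auto simp: algebra_simps\<close>)
    moreover have "(\<Sum>S\<in>Pow E - {T}. Sup (V S r')) \<le> (\<Sum>S\<in>Pow E - {T}. Sup (V S r))"
      by (intro sum_mono monoV r)
    moreover have "T \<in> Pow E" "finite (Pow E)" using E(1) by (auto simp: T_def)
    ultimately show ?thesis unfolding h_def by (simp add: sum.remove[of _ T])
  qed
  ultimately show ?thesis by blast
qed

text \<open>The sum of the coordinate variations bounds the norm through the l1-norm; increments of
  \<open>h\<close> thus stand in for the arc length of \<open>X\<close>.\<close>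

lemma curve_selection:
  fixes A :: "real \<Rightarrow> 'b::euclidean_space \<Rightarrow> bool"
  assumes "sa (\<lambda>w. A (fst w) (snd w))" "\<And>r y. A r y \<Longrightarrow> norm y \<le> C"
  shows "\<exists>X E h K. (\<forall>r y. A r y \<longrightarrow> A r (X r)) \<and> finite E \<and> (\<forall>r. r \<notin> E \<longrightarrow> isCont X r) \<and>
    mono h \<and> (\<forall>r. 0 \<le> h r) \<and> (\<forall>r. h r \<le> K) \<and>
    (\<forall>r' r. r' \<le> r \<longrightarrow> {r'..r} \<inter> E = {} \<longrightarrow> norm (X r - X r') \<le> h r - h r')"
proof -
  have "\<exists>X. (\<forall>r y. A r y \<longrightarrow> A r (X r)) \<and> (\<forall>b. sa_fun (\<lambda>r. X r \<bullet> b)) \<and> (\<forall>r. norm (X r) \<le> max 0 C)"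
    by (rule sa_choice) (use assms in auto)
  then obtain X where X: "\<And>r y. A r y \<Longrightarrow> A r (X r)" "\<And>b. sa_fun (\<lambda>r. X r \<bullet> b)" "\<And>r. norm (X r) \<le> max 0 C"
    by blast
  have "\<forall>b. \<exists>E. finite E \<and> piecewise_monotone E (\<lambda>r. X r \<bullet> b)"
    using sa_fun_piecewise_monotone[OF X(2)] by metis
  then obtain M where M: "\<And>b. finite (M b)" "\<And>b. piecewise_monotone (M b) (\<lambda>r. X r \<bullet> b)" by metis
  define E where "E = (\<Union>b\<in>Basis. M b \<union> {r. \<not> isCont (\<lambda>r. X r \<bullet> b) r})"
  have E: "finite E" using M(1) sa_fun_continuous[OF X(2)] by (auto simp: E_def)
  have "\<forall>b\<in>Basis. \<exists>h K. mono h \<and> (\<forall>r. 0 \<le> h r \<and> h r \<le> K) \<and>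
     (\<forall>r' r. r' \<le> r \<longrightarrow> {r'..r} \<inter> E = {} \<longrightarrow> \<bar>X r \<bullet> b - X r' \<bullet> b\<bar> \<le> h r - h r')"
  proof
    fix b :: 'b assume b: "b \<in> Basis"
    have "piecewise_monotone E (\<lambda>r. X r \<bullet> b)"
      using M(2)[of b] by (rule piecewise_monotone_subset) (use b in \<open>auto simp: E_def\<close>)
    moreover have "\<bar>X r \<bullet> b\<bar> \<le> max 0 C" for r using Basis_le_norm[OF b, of "X r"] X(3)[of r] by linarith
    ultimately show "\<exists>h K. mono h \<and> (\<forall>r. 0 \<le> h r \<and> h r \<le> K) \<and>
       (\<forall>r' r. r' \<le> r \<longrightarrow> {r'..r} \<inter> E = {} \<longrightarrow> \<bar>X r \<bullet> b - X r' \<bullet> b\<bar> \<le> h r - h r')"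
      using piecewise_monotone_variation[OF E, of "\<lambda>r. X r \<bullet> b"] by blast
  qed
  then obtain h where "\<forall>b\<in>Basis. \<exists>K. mono (h b) \<and> (\<forall>r. 0 \<le> h b r \<and> h b r \<le> K) \<and>
     (\<forall>r' r. r' \<le> r \<longrightarrow> {r'..r} \<inter> E = {} \<longrightarrow> \<bar>X r \<bullet> b - X r' \<bullet> b\<bar> \<le> h b r - h b r')"
    by (rule bchoice[THEN exE])
  then obtain K where hK: "\<forall>b\<in>Basis. mono (h b) \<and> (\<forall>r. 0 \<le> h b r \<and> h b r \<le> K b) \<and>
     (\<forall>r' r. r' \<le> r \<longrightarrow> {r'..r} \<inter> E = {} \<longrightarrow> \<bar>X r \<bullet> b - X r' \<bullet> b\<bar> \<le> h b r - h b r')"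
    by (rule bchoice[THEN exE])
  show ?thesis
  proof (intro exI[of _ X] exI[of _ E] exI[of _ "\<lambda>r. \<Sum>b\<in>Basis. h b r"] exI[of _ "\<Sum>b\<in>Basis. K b"] conjI allI impI)
    show "A r (X r)" if "A r y" for r y using X(1) that .
    show "finite E" by fact
    show "mono (\<lambda>r. \<Sum>b\<in>Basis. h b r)"
      using hK by (intro monoI sum_mono) (auto dest: monoD)
    show "0 \<le> (\<Sum>b\<in>Basis. h b r)" for r using hK by (intro sum_nonneg) auto
    show "(\<Sum>b\<in>Basis. h b r) \<le> (\<Sum>b\<in>Basis. K b)" for r using hK by (intro sum_mono) auto
    show "norm (X r - X r') \<le> (\<Sum>b\<in>Basis. h b r) - (\<Sum>b\<in>Basis. h b r')"
      if "r' \<le> r" "{r'..r} \<inter> E = {}" for r r'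
    proof -
      have "norm (X r - X r') \<le> (\<Sum>b\<in>Basis. \<bar>(X r - X r') \<bullet> b\<bar>)" by (rule norm_le_l1)
      also have "\<dots> \<le> (\<Sum>b\<in>Basis. h b r - h b r')"
        using hK that by (intro sum_mono) (auto simp: inner_diff_left)
      finally show ?thesis by (simp add: sum_subtractf)
    qed
    show "isCont X r" if "r \<notin> E" for r
    proof -
      have "isCont (\<lambda>r. \<Sum>b\<in>Basis. (X r \<bullet> b) *\<^sub>R b) r"
        using that by (intro continuous_sum continuous_scaleR continuous_const) (auto simp: E_def)
      then show ?thesis by (simp add: euclidean_representation)
    qed
  qed
qed

section \<open>Desingularization\<close>

text \<open>
  An upper bound on the slope at a point of finite value \<open>r\<close>, in terms of the epigraph and free of
  norms, so that it is visibly semialgebraic.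
\<close>

definition slope_bound :: "('a::euclidean_space \<Rightarrow> ereal) \<Rightarrow> 'a \<Rightarrow> real \<Rightarrow> real \<Rightarrow> bool" where
  "slope_bound f x r c \<longleftrightarrow> f x = ereal r \<and> (\<exists>d. d > 0 \<and> (\<forall>y s.
     f y \<le> ereal s \<and> s < r \<and> (y - x) \<bullet> (y - x) < d \<longrightarrow> (r - s)\<^sup>2 \<le> c\<^sup>2 * ((y - x) \<bullet> (y - x))))"

lemma slope_bound_mono:
  assumes "slope_bound f x r c" "0 \<le> c" "c \<le> c'"
  shows "slope_bound f x r c'"
proof -
  have "c\<^sup>2 * z \<le> c'\<^sup>2 * z" if "z \<ge> 0" for z using that assms(2,3) by (intro mult_right_mono power_mono)
  then show ?thesis using assms(1) unfolding slope_bound_def by (meson inner_ge_zero order_trans)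
qed

text \<open>The strict inequality turns the limit superior into a bound on a whole punctured ball;
  squared distances explain the radius \<open>d\<^sup>2\<close>.\<close>

lemma slope_bound_if_slope_less:
  assumes "slope f x < ereal c" "f x = ereal r" "c > 0"
  shows "slope_bound f x r c"
proof -
  have "\<forall>\<^sub>F y in at x. max 0 (f x - f y) / ereal (norm (x - y)) < ereal c"
    using assms(1) unfolding slope_def by (rule Limsup_lessD)
  then obtain d where d: "d > 0" "\<And>y. y \<noteq> x \<Longrightarrow> dist y x < d \<Longrightarrow> max 0 (f x - f y) / ereal (norm (x - y)) < ereal c"
    unfolding eventually_at by auto
  have "(r - s)\<^sup>2 \<le> c\<^sup>2 * ((y - x) \<bullet> (y - x))" if ys: "f y \<le> ereal s" "s < r" "(y - x) \<bullet> (y - x) < d\<^sup>2" for y s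
  proof -
    have "y \<noteq> x" using ys assms(2) by auto
    define n where "n = norm (x - y)"
    have n: "n > 0" using \<open>y \<noteq> x\<close> by (simp add: n_def)
    have n2: "(y - x) \<bullet> (y - x) = n\<^sup>2" by (simp add: n_def power2_norm_eq_inner norm_minus_commute[of x])
    then have "n < d" using ys(3) d(1) by (simp add: power_less_imp_less_base)
    then have 1: "max 0 (f x - f y) / ereal n < ereal c"
      using d(2)[of y] \<open>y \<noteq> x\<close> by (simp add: n_def dist_norm norm_minus_commute)
    have "ereal (r - s) \<le> max 0 (f x - f y)"
      using ys(1) assms(2) by (cases "f y") (auto simp: max_def)
    then have "ereal (r - s) / ereal n \<le> max 0 (f x - f y) / ereal n"
      using n by (intro ereal_divide_right_mono) auto
    then have "ereal (r - s) / ereal n < ereal c" using 1 by (rule le_less_trans)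
    then have "r - s < c * n" using n by (simp add: field_simps)
    then have "(r - s)\<^sup>2 \<le> (c * n)\<^sup>2" using ys(2) by (intro power_mono) auto
    then show ?thesis by (simp add: n2 power_mult_distrib)
  qed
  then show ?thesis unfolding slope_bound_def using assms(2) d(1)
    by (intro conjI exI[of _ "d\<^sup>2"]) auto
qed

lemma sa_sublevel:
  assumes "semialgebraic_function f" "polynomial_function g" "real_polynomial_function r"
  shows "sa (\<lambda>z. f (g z) \<le> ereal (r z))"
proof -
  have "epigraph f = {w. f (fst w) \<le> ereal (snd w)}" by (auto simp: epigraph_def)
  then have "sa (\<lambda>w. f (fst w) \<le> ereal (snd w))"
    using assms(1) by (simp add: sa_iff_semialgebraic semialgebraic_function_def)
  from sa_app2[OF this assms(2), of r] show ?thesis using assms(3) by (simp add: real_polynomial_function_eq)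
qed

lemma sa_slope_bound:
  fixes f :: "'a::euclidean_space \<Rightarrow> ereal"
  assumes f: "semialgebraic_function f" and "polynomial_function g" "real_polynomial_function r" "real_polynomial_function c"
  shows "sa (\<lambda>z. slope_bound f (g z) (r z) (c z))"
proof -
  \<comment> \<open>Equality with a finite value is recovered from the epigraph alone.\<close>
  have eq: "f x = ereal r \<longleftrightarrow> f x \<le> ereal r \<and> (\<forall>s. s < r \<longrightarrow> \<not> f x \<le> ereal s)" for x r
  proof
    assume *: "f x \<le> ereal r \<and> (\<forall>s. s < r \<longrightarrow> \<not> f x \<le> ereal s)"
    show "f x = ereal r"
    proof (cases "f x")
      case (real t)
      then show ?thesis using * by (metis ereal_less_eq(3) linorder_neqE_linordered_idom not_less order_refl)
    next
      case MInf
      then show ?thesis using *[THEN conjunct2, rule_format, of "r - 1"] by simp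
    qed (use * in auto)
  qed auto
  have "sa (\<lambda>w::'a \<times> real \<times> real. slope_bound f (fst w) (fst (snd w)) (snd (snd w)))"
    unfolding slope_bound_def eq
    by (intro sa_intros sa_sublevel[OF f] poly_intros)
  moreover have "polynomial_function (\<lambda>z. (g z, r z, c z))"
    using assms by (intro polynomial_function_Pair) (auto simp: real_polynomial_function_eq)
  ultimately show ?thesis using sa_compose by fastforce
qed

text \<open>As \<open>X r'\<close> has value \<open>r'\<close>, the slope bound at
  \<open>X r\<close> limits \<open>r - r'\<close> to \<open>c\<close> times the distance, which
  \<open>h\<close> bounds. Continuity brings \<open>X r'\<close> into the ball where the slope bound
  is valid.\<close>

lemma selection_growth:
  fixes X :: "real \<Rightarrow> 'a::euclidean_space"
  assumes sb: "slope_bound f (X r) r c" and c: "c \<ge> 0" and cont: "isCont X r"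
    and e: "e > 0" "\<And>r'. r - e < r' \<Longrightarrow> r' < r \<Longrightarrow> f (X r') = ereal r'"
      "\<And>r'. r - e < r' \<Longrightarrow> r' < r \<Longrightarrow> norm (X r - X r') \<le> h r - h r'"
  shows "\<exists>d>0. \<forall>r'. r - d < r' \<and> r' < r \<longrightarrow> r - r' \<le> c * (h r - h r')"
proof -
  obtain d where d: "d > 0" "\<And>y s. f y \<le> ereal s \<Longrightarrow> s < r \<Longrightarrow> (y - X r) \<bullet> (y - X r) < d \<Longrightarrow>
      (r - s)\<^sup>2 \<le> c\<^sup>2 * ((y - X r) \<bullet> (y - X r))"
    using sb unfolding slope_bound_def by blast
  obtain k where k: "k > 0" "\<And>s. dist s r < k \<Longrightarrow> dist (X s) (X r) < sqrt d"
    using cont[unfolded continuous_at_eps_delta, rule_format, of "sqrt d"] d(1) by auto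
  have "r - r' \<le> c * (h r - h r')" if r': "r - min e k < r'" "r' < r" for r'
  proof -
    have n: "(X r' - X r) \<bullet> (X r' - X r) = (norm (X r - X r'))\<^sup>2"
      by (simp add: power2_norm_eq_inner norm_minus_commute[of "X r"])
    have "dist (X r') (X r) < sqrt d" using k(2)[of r'] r' by (simp add: dist_real_def)
    then have "(norm (X r - X r'))\<^sup>2 < (sqrt d)\<^sup>2"
      by (intro power_strict_mono) (auto simp: dist_norm norm_minus_commute)
    then have "(X r' - X r) \<bullet> (X r' - X r) < d" using d(1) n by simp
    then have "(r - r')\<^sup>2 \<le> c\<^sup>2 * ((X r' - X r) \<bullet> (X r' - X r))"
      using d(2)[of "X r'" r'] e(2)[of r'] r' by simp
    then have "(r - r')\<^sup>2 \<le> (c * norm (X r - X r'))\<^sup>2" by (simp add: n power_mult_distrib)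
    then have "r - r' \<le> c * norm (X r - X r')" by (rule power2_le_imp_le) (use c in simp)
    also have "\<dots> \<le> c * (h r - h r')" using e(3)[of r'] r' c by (intro mult_left_mono) auto
    finally show ?thesis .
  qed
  then show ?thesis using e(1) k(1) by (intro exI[of _ "min e k"]) auto
qed

text \<open>Continuation leftwards from \<open>v\<close>: monotonicity of \<open>h\<close> keeps the
  infimum of the good starting points good, and the local estimate would go below it if it exceeded
  \<open>u\<close>.\<close>

lemma growth_from_left:
  fixes h :: "real \<Rightarrow> real"
  assumes "mono h" "C \<ge> 0" "u \<le> v"
    and loc: "\<And>r. u < r \<Longrightarrow> r \<le> v \<Longrightarrow> \<exists>d>0. \<forall>r'. r - d < r' \<and> r' < r \<longrightarrow> r - r' \<le> C * (h r - h r')"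
  shows "v - u \<le> C * (h v - h u)"
proof -
  define S where "S = {s. u \<le> s \<and> s \<le> v \<and> v - s \<le> C * (h v - h s)}"
  define s0 where "s0 = Inf S"
  have vS: "v \<in> S" using assms(3) by (simp add: S_def)
  have bdd: "bdd_below S" by (intro bdd_belowI[of _ u]) (auto simp: S_def)
  have le: "s0 \<le> s" if "s \<in> S" for s unfolding s0_def using that bdd by (rule cInf_lower)
  have "u \<le> s0" unfolding s0_def using vS by (intro cInf_greatest) (auto simp: S_def)
  have "v - C * (h v - h s0) \<le> s0"
    unfolding s0_def
  proof (rule cInf_greatest)
    fix s assume s: "s \<in> S"
    then have "h s0 \<le> h s" using le assms(1) by (auto dest: monoD)
    then have "C * (h v - h s) \<le> C * (h v - h s0)" using assms(2) by (intro mult_left_mono) auto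
    then show "v - C * (h v - h (Inf S)) \<le> s" using s by (simp add: S_def s0_def)
  qed (use vS in auto)
  then have s0: "s0 \<in> S" using \<open>u \<le> s0\<close> le[OF vS] by (simp add: S_def)
  have "s0 = u"
  proof (rule ccontr)
    assume "s0 \<noteq> u"
    then have "u < s0" "s0 \<le> v" using \<open>u \<le> s0\<close> le[OF vS] by auto
    then obtain d where d: "d > 0" "\<And>r'. s0 - d < r' \<Longrightarrow> r' < s0 \<Longrightarrow> s0 - r' \<le> C * (h s0 - h r')"
      using loc[of s0] by blast
    define s where "s = max u (s0 - d / 2)"
    have s: "s0 - d < s" "s < s0" "u \<le> s" using d(1) \<open>u < s0\<close> by (auto simp: s_def max_def)
    have "v - s0 \<le> C * (h v - h s0)" using s0 by (simp add: S_def)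
    then have "v - s \<le> C * (h v - h s)" using d(2)[OF s(1,2)] by (simp add: algebra_simps)
    then have "s \<in> S" using s \<open>s0 \<le> v\<close> by (simp add: S_def)
    then show False using le s(2) by fastforce
  qed
  then show ?thesis using s0 by (simp add: S_def)
qed

section \<open>Slopes attained at a given level\<close>

definition attains :: "('a::euclidean_space \<Rightarrow> ereal) \<Rightarrow> real \<Rightarrow> real \<Rightarrow> real \<Rightarrow> bool" where
  "attains f R r c \<longleftrightarrow> c > 0 \<and> (\<exists>x. x \<bullet> x < R\<^sup>2 \<and> slope_bound f x r c)"

text \<open>Since \<open>slope_bound\<close> sees only the square of \<open>c\<close>, upward
  closure relies on the positivity of \<open>c\<close> built into \<open>attains\<close>.\<close>

lemma attains_mono: "attains f R r c \<Longrightarrow> c \<le> c' \<Longrightarrow> attains f R r c'"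
  unfolding attains_def using slope_bound_mono by fastforce

lemma sa_attains:
  assumes "semialgebraic_function f" "real_polynomial_function r" "real_polynomial_function c"
  shows "sa (\<lambda>z. attains f R (r z) (c z))"
proof -
  have "sa (\<lambda>w::real \<times> real. attains f R (fst w) (snd w))"
    unfolding attains_def by (intro sa_intros sa_slope_bound[OF assms(1)] poly_intros)
  from sa_app2[OF this, of r c] show ?thesis using assms by (simp add: real_polynomial_function_eq)
qed

lemma norm_less_if_inner: "x \<bullet> x < R\<^sup>2 \<Longrightarrow> norm x \<le> \<bar>R\<bar>"
  by (metis abs_norm_cancel less_imp_le power2_le_iff_abs_le power2_norm_eq_inner abs_ge_zero power2_abs)

text \<open>
  Sard property.  If the slope came arbitrarily close to zero at all levels \<open>r \<in> (p, q)\<close>, a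
  selection with slope at most \<open>r - p\<close> would have variation at least \<open>1/2\<close> over each of the
  intervals \<open>[p + w/2^(k+1), p + w/2^k]\<close>.
\<close>

lemma finite_asymptotically_critical_values:
  fixes f :: "'a::euclidean_space \<Rightarrow> ereal"
  assumes f: "semialgebraic_function f"
  shows "finite {r. \<forall>c. c > 0 \<longrightarrow> attains f R r c}"
proof (rule ccontr)
  assume inf: "infinite {r. \<forall>c. c > 0 \<longrightarrow> attains f R r c}"
  have "sa (\<lambda>r. \<forall>c. c > 0 \<longrightarrow> attains f R r c)"
    by (intro sa_intros sa_attains[OF f] poly_intros)
  then obtain p q where pq: "p < q" "\<And>r c. p \<le> r \<Longrightarrow> r \<le> q \<Longrightarrow> c > 0 \<Longrightarrow> attains f R r c"
    using sa_real_infinite_interval[OF _ inf] by metis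
  define A where "A r x \<longleftrightarrow> p < r \<and> r < q \<and> x \<bullet> x < R\<^sup>2 \<and> slope_bound f x r (r - p)" for r x
  have "sa (\<lambda>w. A (fst w) (snd w))"
    unfolding A_def by (intro sa_intros sa_slope_bound[OF f] poly_intros)
  moreover have "norm x \<le> \<bar>R\<bar>" if "A r x" for r x using that norm_less_if_inner by (auto simp: A_def)
  ultimately obtain X E h K where X: "\<And>r y. A r y \<Longrightarrow> A r (X r)" "finite E" "\<And>r. r \<notin> E \<Longrightarrow> isCont X r"
    and h: "mono h" "\<And>r. 0 \<le> h r" "\<And>r. h r \<le> K"
      "\<And>r' r. r' \<le> r \<Longrightarrow> {r'..r} \<inter> E = {} \<Longrightarrow> norm (X r - X r') \<le> h r - h r'"
    using curve_selection[of A "\<bar>R\<bar>"] by blast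
  have AX: "A r (X r)" if r: "p < r" "r < q" for r
  proof -
    have "attains f R r (r - p)" using pq(2) r by simp
    then show ?thesis using r X(1) unfolding attains_def A_def by blast
  qed
  obtain d where d: "d > 0" "{p<..<p + d} \<inter> E = {}" using finite_avoid_right[OF X(2)] by blast
  define w where "w = min d (q - p) / 2"
  have w: "w > 0" "p + w < q" "p + w < p + d" using d(1) pq(1) by (auto simp: w_def min_def field_simps)
  have growth: "v - u \<le> (v - p) * (h v - h u)" if uv: "p < u" "u \<le> v" "v \<le> p + w" for u v
  proof (rule growth_from_left[OF h(1) _ uv(2)])
    fix r assume r: "u < r" "r \<le> v"
    have "\<exists>d>0. \<forall>r'. r - d < r' \<and> r' < r \<longrightarrow> r - r' \<le> (r - p) * (h r - h r')"
    proof (rule selection_growth[where X = X and f = f and e = "r - p"])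
      have "r \<in> {p<..<p + d}" using r uv w by auto
      then have "r \<notin> E" using d(2) by blast
      then show "isCont X r" by (rule X(3))
      show "slope_bound f (X r) r (r - p)" using AX[of r] r uv w by (simp add: A_def)
      show "norm (X r - X r') \<le> h r - h r'" if "r - (r - p) < r'" "r' < r" for r'
      proof (rule h(4))
        have "{r'..r} \<subseteq> {p<..<p + d}" using that r uv w by auto
        then show "{r'..r} \<inter> E = {}" using d(2) by blast
      qed (use that in simp)
      show "f (X r') = ereal r'" if "r - (r - p) < r'" "r' < r" for r'
        using AX[of r'] that r uv w by (simp add: A_def slope_bound_def)
    qed (use r uv in auto)
    then obtain e where e: "e > 0" "\<And>r'. r - e < r' \<Longrightarrow> r' < r \<Longrightarrow> r - r' \<le> (r - p) * (h r - h r')" by blast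
    have "(r - p) * (h r - h r') \<le> (v - p) * (h r - h r')" if "r' < r" for r'
    proof (rule mult_right_mono)
      show "0 \<le> h r - h r'" using monoD[OF h(1), of r' r] that by simp
    qed (use r in simp)
    then have "r - r' \<le> (v - p) * (h r - h r')" if "r - e < r'" "r' < r" for r'
      using e(2)[OF that] that(2) by (meson order_trans)
    then show "\<exists>d>0. \<forall>r'. r - d < r' \<and> r' < r \<longrightarrow> r - r' \<le> (v - p) * (h r - h r')"
      using e(1) by blast
  qed (use uv in simp)
  have step: "1 / 2 \<le> h (p + w / 2 ^ k) - h (p + w / 2 ^ Suc k)" for k
  proof -
    define a where "a = w / 2 ^ k"
    have a: "a > 0" "a \<le> w" using w(1) by (auto simp: a_def field_simps)
    \<comment> \<open>The interval has length \<open>a / 2\<close> and slopes at most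
      \<open>a\<close>; the scale cancels, so every dyadic interval contributes equally.\<close>
    have "a * (1 / 2) \<le> a * (h (p + a) - h (p + a / 2))" using growth[of "p + a / 2" "p + a"] a by simp
    then have "1 / 2 \<le> h (p + a) - h (p + a / 2)" using a(1) by (simp only: mult_le_cancel_left_pos)
    moreover have "w / 2 ^ Suc k = a / 2" by (simp add: a_def)
    ultimately show ?thesis by (simp only: a_def[symmetric])
  qed
  have "real n / 2 \<le> h (p + w / 2 ^ 0) - h (p + w / 2 ^ n)" for n
  proof (induction n)
    case (Suc n)
    then show ?case using step[of n] by (simp add: field_simps)
  qed simp
  note bound = this
  obtain n where "real n > 2 * K" using reals_Archimedean2 by blast
  then show False using bound[of n] h(2)[of "p + w / 2 ^ n"] h(3)[of "p + w / 2 ^ 0"] by simp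
qed

text \<open>
  The function \<open>h\<close> plays the role of the desingularising function in the Kurdyka--Lojasiewicz
  inequality.  It is the variation of a curve \<open>X\<close> (a talweg) which passes, at level \<open>r\<close>, through a point
  whose slope is minimal up to the factor 2; the infimum \<open>m r\<close> of the slopes is continuous off a finite
  set, which allows to pass to the limiting slope.
\<close>

lemma desingularization:
  fixes f :: "'a::euclidean_space \<Rightarrow> ereal"
  assumes f: "semialgebraic_function f"
  shows "\<exists>E h K. finite E \<and> mono h \<and> (\<forall>r. 0 \<le> h r) \<and> (\<forall>r. h r \<le> K) \<and>
    (\<forall>r c. r \<notin> E \<longrightarrow> (\<forall>e>0. \<exists>r1. \<bar>r1 - r\<bar> < e \<and> attains f R r1 c) \<longrightarrow>
      (\<exists>d>0. \<forall>r'. r - d < r' \<and> r' < r \<longrightarrow> r - r' \<le> 2 * c * (h r - h r')))"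
proof -
  define Z where "Z = {r. \<forall>c. c > 0 \<longrightarrow> attains f R r c}"
  have finZ: "finite Z" unfolding Z_def by (rule finite_asymptotically_critical_values[OF f])
  \<comment> \<open>These are the levels whose slopes have a positive infimum. Levels where nothing
    is attained and asymptotically critical ones are set apart and get the default
    \<open>m r = 0\<close>.\<close>
  define V where "V r \<longleftrightarrow> (\<exists>c. attains f R r c) \<and> \<not> (\<forall>c. c > 0 \<longrightarrow> attains f R r c)" for r
  have saV: "sa V"
    unfolding V_def by (intro sa_intros sa_attains[OF f] poly_intros)
  obtain Y where Y: "finite Y" "\<And>u v. u \<le> v \<Longrightarrow> {u..v} \<inter> Y = {} \<Longrightarrow> V u = V v"
    using sa_real_finite_boundary[OF saV] by blast
  define m where "m r = (if V r then Inf {c. attains f R r c} else 0)" for r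
  have bdd: "bdd_below {c. attains f R r c}" for r
    by (intro bdd_belowI[of _ 0]) (auto simp: attains_def)
  have mlow: "m r \<le> c" if "V r" "attains f R r c" for r c
    using that bdd unfolding m_def by (auto intro: cInf_lower)
  have mgreat: "a \<le> m r" if "V r" "\<And>c. attains f R r c \<Longrightarrow> a \<le> c" for r a
    using that unfolding m_def V_def by (auto intro: cInf_greatest)
  have mpos: "m r > 0" if Vr: "V r" for r
  proof -
    obtain c where c: "c > 0" "\<not> attains f R r c" using Vr unfolding V_def by blast
    have "c \<le> c'" if "attains f R r c'" for c'
    proof (rule ccontr)
      assume "\<not> c \<le> c'"
      then show False using attains_mono[OF \<open>attains f R r c'\<close>, of c] c(2) by simp
    qed
    then have "c \<le> m r" by (rule mgreat[OF Vr])
    then show ?thesis using c(1) by simp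
  qed
  have "c = m r \<longleftrightarrow> (V r \<and> greatest_lower (attains f R r) c) \<or> (\<not> V r \<and> c = 0)" for r c
  proof (cases "V r")
    case True
    have "greatest_lower (attains f R r) (m r)"
      using mlow[OF True] mgreat[OF True] unfolding greatest_lower_def by blast
    then show ?thesis using True greatest_lower_unique by blast
  qed (simp add: m_def)
  moreover have "sa (\<lambda>w::real \<times> real. (V (fst w) \<and> greatest_lower (attains f R (fst w)) (snd w)) \<or> (\<not> V (fst w) \<and> snd w = 0))"
    unfolding greatest_lower_def
    by (intro sa_intros sa_compose[OF saV] sa_attains[OF f] poly_intros)
  ultimately have sam: "sa_fun m" unfolding sa_fun_def by presburger
  define A where "A r x \<longleftrightarrow> V r \<and> x \<bullet> x < R\<^sup>2 \<and> slope_bound f x r (2 * m r)" for r x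
  have "sa (\<lambda>w. A (fst w) (snd w))"
    unfolding A_def
    by (intro sa_intros sa_compose[OF saV] poly_intros,
        rule sa_fun_app[OF sam, where Q = "\<lambda>w c. slope_bound f (snd w) (fst w) (2 * c)"])
       (intro sa_slope_bound[OF f] poly_intros)+
  moreover have "norm x \<le> \<bar>R\<bar>" if "A r x" for r x using that norm_less_if_inner by (auto simp: A_def)
  ultimately obtain X E h K where X: "\<And>r y. A r y \<Longrightarrow> A r (X r)" "finite E" "\<And>r. r \<notin> E \<Longrightarrow> isCont X r"
    and h: "mono h" "\<And>r. 0 \<le> h r" "\<And>r. h r \<le> K"
      "\<And>r' r. r' \<le> r \<Longrightarrow> {r'..r} \<inter> E = {} \<Longrightarrow> norm (X r - X r') \<le> h r - h r'"
    using curve_selection[of A "\<bar>R\<bar>"] by blast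
  have AX: "A r (X r)" if r: "V r" for r
  proof -
    \<comment> \<open>Since \<open>m r\<close> is positive, \<open>2 * m r\<close> exceeds the
      infimum and leaves room for a point.\<close>
    have "\<exists>c. attains f R r c \<and> c < 2 * m r"
    proof (rule ccontr)
      assume "\<not> ?thesis"
      then have "2 * m r \<le> m r" by (intro mgreat[OF r]) auto
      then show False using mpos[OF r] by simp
    qed
    then obtain c x where "c > 0" "c < 2 * m r" "x \<bullet> x < R\<^sup>2" "slope_bound f x r c" unfolding attains_def by blast
    then have "A r x" using r slope_bound_mono[of f x r c "2 * m r"] by (simp add: A_def)
    then show ?thesis by (rule X(1))
  qed
  \<comment> \<open>Near a level off the finite set \<open>E'\<close>, the truth value of
    \<open>V\<close> is constant, no level is critical, and \<open>X\<close> and \<open>m\<close>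
    are continuous.\<close>
  define E' where "E' = E \<union> Z \<union> Y \<union> {r. \<not> isCont m r}"
  have "finite E'" using X(2) finZ Y(1) sa_fun_continuous[OF sam] by (simp add: E'_def)
  moreover have "\<exists>d>0. \<forall>r'. r - d < r' \<and> r' < r \<longrightarrow> r - r' \<le> 2 * c * (h r - h r')"
    if r: "r \<notin> E'" and c: "\<And>e. e > 0 \<Longrightarrow> \<exists>r1. \<bar>r1 - r\<bar> < e \<and> attains f R r1 c" for r c
  proof -
    obtain e where e: "e > 0" "{r - e..r + e} \<inter> E' = {}" using finite_avoid_nhd[OF \<open>finite E'\<close> r] by blast
    have VV: "V s = V t" if "\<bar>s - r\<bar> < e" "\<bar>t - r\<bar> < e" for s t
    proof -
      have *: "V s = V t" if "s \<le> t" "\<bar>s - r\<bar> < e" "\<bar>t - r\<bar> < e" for s t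
      proof (rule Y(2)[OF that(1)])
        have "{s..t} \<subseteq> {r - e..r + e}" using that by auto
        then show "{s..t} \<inter> Y = {}" using e(2) unfolding E'_def by blast
      qed
      show ?thesis using *[of s t] *[of t s] that by linarith
    qed
    have Vr1: "V r1" if "\<bar>r1 - r\<bar> < e" "attains f R r1 c" for r1
    proof -
      have "r1 \<in> {r - e..r + e}" using that(1) by auto
      then have "r1 \<notin> Z" using e(2) unfolding E'_def by blast
      then show ?thesis using that(2) unfolding V_def Z_def by blast
    qed
    obtain r1 where "\<bar>r1 - r\<bar> < e" "attains f R r1 c" using c[OF e(1)] by blast
    then have Vnear: "V s" if "\<bar>s - r\<bar> < e" for s using Vr1 VV that by blast
    \<comment> \<open>The bound \<open>c\<close> is attained only at levels near \<open>r\<close>;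
      continuity of \<open>m\<close> carries it to \<open>r\<close> itself.\<close>
    have mc: "m r \<le> c"
    proof (rule ccontr)
      assume n: "\<not> m r \<le> c"
      have "isCont m r" using r by (simp add: E'_def)
      then obtain k where k: "k > 0" "\<And>s. dist s r < k \<Longrightarrow> dist (m s) (m r) < m r - c"
        unfolding continuous_at_eps_delta using n by (metis diff_gt_0_iff_gt not_le)
      obtain r1 where r1: "\<bar>r1 - r\<bar> < min e k" "attains f R r1 c" using c[of "min e k"] e(1) k(1) by auto
      have "m r1 \<le> c" using Vnear[of r1] mlow r1 by simp
      moreover have "\<bar>m r1 - m r\<bar> < m r - c" using k(2)[of r1] r1(1) by (simp add: dist_real_def)
      ultimately show False by linarith
    qed
    have Vr: "V r" using Vnear[of r] e(1) by simp
    have "\<exists>d>0. \<forall>r'. r - d < r' \<and> r' < r \<longrightarrow> r - r' \<le> 2 * m r * (h r - h r')"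
    proof (rule selection_growth[where X = X and f = f and e = e])
      show "slope_bound f (X r) r (2 * m r)" using AX[OF Vr] by (simp add: A_def)
      show "0 \<le> 2 * m r" using mpos[OF Vr] by simp
      show "isCont X r" using X(3) r by (simp add: E'_def)
      show "f (X r') = ereal r'" if "r - e < r'" "r' < r" for r'
        using AX[OF Vnear[of r']] that by (simp add: A_def slope_bound_def)
      show "norm (X r - X r') \<le> h r - h r'" if "r - e < r'" "r' < r" for r'
      proof (rule h(4))
        have "{r'..r} \<subseteq> {r - e..r + e}" using that by auto
        then show "{r'..r} \<inter> E = {}" using e(2) unfolding E'_def by blast
      qed (use that in simp)
    qed (rule e(1))
    then obtain d where d: "d > 0" "\<And>r'. r - d < r' \<Longrightarrow> r' < r \<Longrightarrow> r - r' \<le> 2 * m r * (h r - h r')" by blast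
    have "2 * m r * (h r - h r') \<le> 2 * c * (h r - h r')" if "r' < r" for r'
    proof (rule mult_right_mono)
      show "0 \<le> h r - h r'" using monoD[OF h(1), of r' r] that by simp
    qed (use mc in simp)
    then have "r - r' \<le> 2 * c * (h r - h r')" if "r - d < r'" "r' < r" for r'
      using d(2)[OF that] that(2) by (meson order_trans)
    then show ?thesis using d(1) by blast
  qed
  ultimately show ?thesis using h(1-3) by blast
qed

section \<open>Curves of near-maximal slope\<close>

text \<open>The shift by \<open>e\<close> makes the two integrals overlap except at the ends; at
  most the part over \<open>{b..b + e}\<close> is gained, where \<open>G\<close> is at most
  \<open>K\<close>.\<close>

lemma nn_integral_increment_le:
  fixes G :: "real \<Rightarrow> real"
  assumes G: "mono G" "\<And>t. 0 \<le> G t" "\<And>t. G t \<le> K" and ab: "a \<le> b" and e: "e > 0"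
  shows "(\<integral>\<^sup>+ t. ennreal (G (t + e) - G t) * indicator {a..b} t \<partial>lborel) \<le> ennreal (K * e)"
proof -
  have [measurable]: "G \<in> borel_measurable borel" using G(1) by (rule borel_measurable_mono)
  have K: "K \<ge> 0" using G(2,3) order_trans by blast
  have fin: "(\<integral>\<^sup>+ t. ennreal (G t) * indicator {a..b} t \<partial>lborel) < \<infinity>"
  proof -
    have "(\<integral>\<^sup>+ t. ennreal (G t) * indicator {a..b} t \<partial>lborel) \<le> (\<integral>\<^sup>+ t. ennreal K * indicator {a..b} t \<partial>lborel)"
      using G(3) by (intro nn_integral_mono mult_right_mono) (auto intro: ennreal_leI)
    also have "\<dots> = ennreal (K * (b - a))" using ab K by (simp add: nn_integral_cmult_indicator ennreal_mult')
    finally show ?thesis by (simp add: le_less_trans)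
  qed
  have "(\<integral>\<^sup>+ t. ennreal (G (t + e)) * indicator {a..b} t \<partial>lborel) =
      (\<integral>\<^sup>+ t. ennreal (G (e + 1 * t)) * indicator {a + e..b + e} (e + 1 * t) \<partial>lborel)"
    by (intro nn_integral_cong) (auto simp: indicator_def add.commute)
  also have "\<dots> = (\<integral>\<^sup>+ t. ennreal (G t) * indicator {a + e..b + e} t \<partial>lborel)"
    using nn_integral_real_affine[of "\<lambda>t. ennreal (G t) * indicator {a + e..b + e} t" 1 e] by simp
  also have "\<dots> \<le> (\<integral>\<^sup>+ t. ennreal (G t) * indicator {a..b} t + ennreal K * indicator {b..b + e} t \<partial>lborel)"
    using e G(3) by (intro nn_integral_mono) (auto simp: indicator_def intro: ennreal_leI)
  also have "\<dots> = (\<integral>\<^sup>+ t. ennreal (G t) * indicator {a..b} t \<partial>lborel) + ennreal (K * e)"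
    using e K by (simp add: nn_integral_add nn_integral_cmult_indicator ennreal_mult')
  finally have U: "(\<integral>\<^sup>+ t. ennreal (G (t + e)) * indicator {a..b} t \<partial>lborel) \<le>
     (\<integral>\<^sup>+ t. ennreal (G t) * indicator {a..b} t \<partial>lborel) + ennreal (K * e)" .
  have "ennreal (G (t + e) - G t) * indicator {a..b} t =
     ennreal (G (t + e)) * indicator {a..b} t - ennreal (G t) * indicator {a..b} t" for t
    using G(2) by (auto simp: indicator_def ennreal_minus)
  then have "(\<integral>\<^sup>+ t. ennreal (G (t + e) - G t) * indicator {a..b} t \<partial>lborel) =
     (\<integral>\<^sup>+ t. ennreal (G (t + e)) * indicator {a..b} t - ennreal (G t) * indicator {a..b} t \<partial>lborel)"
    by simp
  also have "\<dots> = (\<integral>\<^sup>+ t. ennreal (G (t + e)) * indicator {a..b} t \<partial>lborel) -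
     (\<integral>\<^sup>+ t. ennreal (G t) * indicator {a..b} t \<partial>lborel)"
  proof (rule nn_integral_diff)
    show "AE t in lborel. ennreal (G t) * indicator {a..b} t \<le> ennreal (G (t + e)) * indicator {a..b} t"
      using e by (intro AE_I2 mult_right_mono ennreal_leI monoD[OF G(1)]) auto
  qed (use fin in auto)
  also have "\<dots> \<le> ennreal (K * e)" using U fin by (auto simp: ennreal_minus_le_iff)
  finally show ?thesis .
qed

text \<open>The speed is bounded by the lower limit of difference quotients of \<open>C * G\<close>,
  whose integrals are at most \<open>C * K\<close> by the shift estimate; Fatou's lemma passes to
  the limit.\<close>

lemma nn_integral_le_by_increments:
  fixes G speed :: "real \<Rightarrow> real"
  assumes G: "mono G" "\<And>t. 0 \<le> G t" "\<And>t. G t \<le> K" and ab: "a \<le> b" and C: "C \<ge> 0"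
    and ae: "AE t in lebesgue_on {a..b}. \<exists>d>0. \<forall>s. t < s \<and> s < t + d \<longrightarrow> speed t * (s - t) \<le> C * (G s - G t)"
  shows "(\<integral>\<^sup>+ t. ennreal (speed t) \<partial>lebesgue_on {a..b}) \<le> ennreal (C * K)"
proof -
  have G_meas [measurable]: "G \<in> borel_measurable borel" using G(1) by (rule borel_measurable_mono)
  define u where "u n t = ennreal (C * real (Suc n)) * (ennreal (G (t + 1 / real (Suc n)) - G t) * indicator {a..b} t)" for n t
  have u_meas [measurable]: "u n \<in> borel_measurable lborel" for n unfolding u_def by measurable
  have un: "(\<integral>\<^sup>+ t. u n t \<partial>lborel) \<le> ennreal (C * K)" for n
  proof -
    have "(\<integral>\<^sup>+ t. u n t \<partial>lborel) = ennreal (C * real (Suc n)) *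
        (\<integral>\<^sup>+ t. ennreal (G (t + 1 / real (Suc n)) - G t) * indicator {a..b} t \<partial>lborel)"
      unfolding u_def by (rule nn_integral_cmult) measurable
    also have "\<dots> \<le> ennreal (C * real (Suc n)) * ennreal (K * (1 / real (Suc n)))"
      by (intro mult_left_mono nn_integral_increment_le[OF G ab]) auto
    also have "\<dots> = ennreal (C * real (Suc n) * (K * (1 / real (Suc n))))"
      using C by (intro ennreal_mult'[symmetric]) simp
    also have "C * real (Suc n) * (K * (1 / real (Suc n))) = C * K" by (simp add: field_simps)
    finally show ?thesis .
  qed
  have "(\<integral>\<^sup>+ t. ennreal (speed t) \<partial>lebesgue_on {a..b}) \<le> (\<integral>\<^sup>+ t. liminf (\<lambda>n. u n t) \<partial>lebesgue_on {a..b})"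
  proof (rule nn_integral_mono_AE)
    have "AE t in lebesgue_on {a..b}. t \<in> {a..b}" by (rule AE_I2) simp
    with ae show "AE t in lebesgue_on {a..b}. ennreal (speed t) \<le> liminf (\<lambda>n. u n t)"
    proof eventually_elim
      case (elim t)
      then obtain d where d: "d > 0" "\<And>s. t < s \<Longrightarrow> s < t + d \<Longrightarrow> speed t * (s - t) \<le> C * (G s - G t)" by blast
      obtain N where N: "1 / real (Suc N) < d" using nat_approx_posE[OF d(1)] by metis
      have "ennreal (speed t) \<le> u n t" if "n \<ge> N" for n
      proof -
        define e where "e = 1 / real (Suc n)"
        have e: "e > 0" "e < d"
        proof -
          have "e \<le> 1 / real (Suc N)" unfolding e_def using that by (intro divide_left_mono) auto
          then show "e < d" using N by simp
        qed (simp add: e_def)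
        have "speed t * e \<le> C * (G (t + e) - G t)" using d(2)[of "t + e"] e by simp
        then have "speed t * e * real (Suc n) \<le> C * (G (t + e) - G t) * real (Suc n)" by (intro mult_right_mono) auto
        moreover have "e * real (Suc n) = 1" by (simp add: e_def)
        ultimately have "speed t \<le> C * real (Suc n) * (G (t + e) - G t)"
          by (simp only: mult.assoc mult_1_right) (simp only: mult_ac)
        then have "ennreal (speed t) \<le> ennreal (C * real (Suc n) * (G (t + e) - G t))" by (rule ennreal_leI)
        also have "\<dots> = ennreal (C * real (Suc n)) * ennreal (G (t + e) - G t)"
          using C by (intro ennreal_mult') simp
        finally show ?thesis using elim(2) by (simp add: u_def e_def)
      qed
      then have "\<forall>\<^sub>F n in sequentially. ennreal (speed t) \<le> u n t" unfolding eventually_sequentially by blast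
      then show ?case by (rule Liminf_bounded)
    qed
  qed
  also have "\<dots> = (\<integral>\<^sup>+ t. liminf (\<lambda>n. u n t) * indicator {a..b} t \<partial>lebesgue)"
    by (rule nn_integral_restrict_space) simp
  also have "\<dots> \<le> (\<integral>\<^sup>+ t. liminf (\<lambda>n. u n t) \<partial>lebesgue)"
    by (intro nn_integral_mono) (auto simp: indicator_def)
  also have "\<dots> = (\<integral>\<^sup>+ t. liminf (\<lambda>n. u n t) \<partial>lborel)" by (rule nn_integral_completion)
  also have "\<dots> \<le> liminf (\<lambda>n. \<integral>\<^sup>+ t. u n t \<partial>lborel)" by (rule nn_integral_liminf) (rule u_meas)
  also have "\<dots> \<le> ennreal (C * K)"
    using un by (intro Liminf_le) auto
  finally show ?thesis .
qed

section \<open>Values and slopes along the curve\<close>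

lemma AE_lebesgue_on_interval_ex:
  assumes "AE t in lebesgue_on {a..b}. P t" "a \<le> u" "u < v" "v \<le> (b::real)"
  shows "\<exists>t\<in>{u..v}. P t"
proof (rule ccontr)
  assume n: "\<not> ?thesis"
  have "AE t in lebesgue. t \<in> {a..b} \<longrightarrow> P t" using assms(1) by (simp add: AE_restrict_space_iff)
  then obtain N where N: "{t. \<not> (t \<in> {a..b} \<longrightarrow> P t)} \<subseteq> N" "N \<in> null_sets lebesgue"
    by (auto simp: eventually_ae_filter)
  have "{u..v} \<subseteq> N" using N(1) n assms by auto
  then have "negligible {u..v}" using N(2) negligible_iff_null_sets negligible_subset by blast
  then have "negligible (cbox u v)" by simp
  then have "box u v = {}" by (simp only: negligible_interval(1))
  then show False using assms(3) by simp
qed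

text \<open>The limit inferior runs over points near the graph point, so slopes below
  \<open>c\<close> occur in the ball at levels near \<open>r\<close>, not necessarily at
  \<open>r\<close>. Hence the nearby levels in \<open>desingularization\<close>.\<close>

lemma attains_if_limiting_slope_less:
  fixes f :: "'a::euclidean_space \<Rightarrow> ereal"
  assumes "limiting_slope f x < ereal c" "f x = ereal r" "norm x < R" "c > 0" "e > 0"
  shows "\<exists>r1. \<bar>r1 - r\<bar> < e \<and> attains f R r1 c"
proof -
  let ?F = "filtercomap (\<lambda>x. (x, f x)) (nhds (x, f x))"
  have "\<not> eventually (\<lambda>y. ereal c \<le> slope f y) ?F"
    using assms(1) Liminf_bounded[of "ereal c" "slope f" ?F] unfolding limiting_slope_def by auto
  then have "frequently (\<lambda>y. slope f y < ereal c) ?F" by (simp add: frequently_def not_less)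
  moreover have "eventually (\<lambda>p. p \<in> ball 0 R \<times> {ereal (r - e)<..<ereal (r + e)}) (nhds (x, f x))"
    using assms by (intro eventually_nhds_in_open open_Times) auto
  then have "eventually (\<lambda>y. (y, f y) \<in> ball 0 R \<times> {ereal (r - e)<..<ereal (r + e)}) ?F"
    by (rule eventually_filtercomapI)
  ultimately have "frequently (\<lambda>y. slope f y < ereal c \<and> (y, f y) \<in> ball 0 R \<times> {ereal (r - e)<..<ereal (r + e)}) ?F"
    by (rule frequently_eventually_frequently)
  then obtain y where y: "slope f y < ereal c" "(y, f y) \<in> ball 0 R \<times> {ereal (r - e)<..<ereal (r + e)}"
    using frequently_ex by blast
  then obtain r1 where r1: "f y = ereal r1" by (cases "f y") auto
  have "norm y < R" using y(2) by simp
  then have "y \<bullet> y < R\<^sup>2" by (metis norm_ge_zero power2_norm_eq_inner power_strict_mono zero_less_numeral)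
  then have "attains f R r1 c" using slope_bound_if_slope_less[OF y(1) r1 assms(4)] assms(4) by (auto simp: attains_def)
  moreover have "\<bar>r1 - r\<bar> < e" using y(2) r1 by (auto simp: abs_less_iff)
  ultimately show ?thesis by blast
qed

text \<open>Giving up half of the derivative leaves a margin, so that linear decrease holds on a
  whole right neighbourhood.\<close>

lemma decrease_right_if_deriv_neg:
  fixes \<phi> :: "real \<Rightarrow> real"
  assumes "(\<phi> has_real_derivative d) (at t within {a..b})" "d < 0" "a \<le> t" "t < b" "e > 0"
  obtains k where "k > 0" "\<And>s. t < s \<Longrightarrow> s < t + k \<Longrightarrow> s < b \<and> \<phi> t - e < \<phi> s \<and> - d / 2 * (s - t) \<le> \<phi> t - \<phi> s"
proof -
  have "((\<lambda>s. (\<phi> s - \<phi> t) / (s - t)) \<longlongrightarrow> d) (at t within {a..b})"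
    using assms(1) by (simp add: has_field_derivative_iff)
  then have 1: "\<forall>\<^sub>F s in at t within {a..b}. (\<phi> s - \<phi> t) / (s - t) < d / 2"
    using assms(2) by (intro order_tendstoD(2)) auto
  have "(\<phi> \<longlongrightarrow> \<phi> t) (at t within {a..b})"
    using DERIV_continuous[OF assms(1)] by (simp add: continuous_within)
  then have 2: "\<forall>\<^sub>F s in at t within {a..b}. \<phi> t - e < \<phi> s"
    using assms(5) by (intro order_tendstoD(1)) auto
  from eventually_conj[OF 1 2] obtain k where k: "k > 0"
    "\<And>s. s \<in> {a..b} \<Longrightarrow> s \<noteq> t \<Longrightarrow> dist s t < k \<Longrightarrow> (\<phi> s - \<phi> t) / (s - t) < d / 2 \<and> \<phi> t - e < \<phi> s"
    unfolding eventually_at by blast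
  show thesis
  proof (rule that[of "min k (b - t)"])
    fix s assume s: "t < s" "s < t + min k (b - t)"
    then have "(\<phi> s - \<phi> t) / (s - t) < d / 2" "\<phi> t - e < \<phi> s"
      using k(2)[of s] assms(3) by (auto simp: dist_real_def)
    moreover from this(1) have "\<phi> s - \<phi> t < d / 2 * (s - t)" using s(1) by (simp add: pos_divide_less_eq)
    ultimately show "s < b \<and> \<phi> t - e < \<phi> s \<and> - d / 2 * (s - t) \<le> \<phi> t - \<phi> s" using s by auto
  qed (use k(1) assms(4) in simp)
qed

lemma near_maximal_slope_curve_length_le:
  fixes f :: "'a::euclidean_space \<Rightarrow> ereal"
  assumes E: "finite E" and h: "mono h" "\<And>r. 0 \<le> h r" "\<And>r. h r \<le> K"
    and des: "\<And>r c. r \<notin> E \<Longrightarrow> (\<And>e. e > 0 \<Longrightarrow> \<exists>r1. \<bar>r1 - r\<bar> < e \<and> attains f R r1 c) \<Longrightarrow>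
      \<exists>d>0. \<forall>r'. r - d < r' \<and> r' < r \<longrightarrow> r - r' \<le> 2 * c * (h r - h r')"
    and curve: "near_maximal_slope_curve f a b \<gamma>" and R: "\<And>t. t \<in> {a..b} \<Longrightarrow> norm (\<gamma> t) < R"
  shows "curve_length a b \<gamma> \<le> ennreal (8 * K)"
proof -
  define \<phi> where "\<phi> t = real_of_ereal (f (\<gamma> t))" for t
  define speed where "speed t = norm (velocity a b \<gamma> t)" for t
  have ab: "a \<le> b" and anti: "antimono_on {a..b} (f \<circ> \<gamma>)"
    and ae1: "AE t in lebesgue_on {a..b}. \<bar>f (\<gamma> t)\<bar> \<noteq> \<infinity> \<and> \<gamma> differentiable (at t within {a..b}) \<and>
        ereal (speed t) = limiting_slope f (\<gamma> t)"
    and ae2: "AE t in lebesgue_on {a..b}. \<exists>d. (\<phi> has_real_derivative d) (at t within {a..b}) \<and>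
            ereal d \<le> - ((limiting_slope f (\<gamma> t))\<^sup>2)"
    using curve unfolding near_maximal_slope_curve_def speed_def \<phi>_def by blast+
  have antiD: "f (\<gamma> t) \<le> f (\<gamma> s)" if "a \<le> s" "s \<le> t" "t \<le> b" for s t
    using monotone_onD[OF anti, of s t] that by simp
  have fin: "f (\<gamma> t) = ereal (\<phi> t)" if t: "a < t" "t < b" for t
  proof -
    obtain s where s: "s \<in> {a..t}" "\<bar>f (\<gamma> s)\<bar> \<noteq> \<infinity>"
      using AE_lebesgue_on_interval_ex[OF ae1, of a t] t by auto
    obtain s' where s': "s' \<in> {t..b}" "\<bar>f (\<gamma> s')\<bar> \<noteq> \<infinity>"
      using AE_lebesgue_on_interval_ex[OF ae1, of t b] t by auto
    have "f (\<gamma> t) \<le> f (\<gamma> s)" "f (\<gamma> s') \<le> f (\<gamma> t)" using antiD[of s t] antiD[of t s'] s(1) s'(1) t by auto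
    then have "\<bar>f (\<gamma> t)\<bar> \<noteq> \<infinity>" using s(2) s'(2) by auto
    then show ?thesis by (simp add: \<phi>_def ereal_real')
  qed
  have \<phi>_anti: "\<phi> t \<le> \<phi> s" if "a < s" "s \<le> t" "t < b" for s t
    using antiD[of s t] fin[of s] fin[of t] that by simp
  \<comment> \<open>Subtracting from \<open>K\<close> makes \<open>h\<close> increase along the
    curve. The constants 0 and \<open>K\<close> outside the open interval absorb the ends, where
    \<open>f\<close> may be infinite.\<close>
  define G where "G t = (if t \<le> a then 0 else if t < b then K - h (\<phi> t) else K)" for t
  have K: "K \<ge> 0" using h(2,3) order_trans by blast
  have G01: "0 \<le> G t" "G t \<le> K" for t using h(2,3) K by (auto simp: G_def)
  have "G s \<le> G t" if "s \<le> t" for s t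
  proof -
    consider "s \<le> a" | "b \<le> t" | "a < s" "t < b" by linarith
    then show ?thesis
    proof cases
      case 1
      then show ?thesis using G01(1)[of t] by (simp add: G_def)
    next
      case 2
      then show ?thesis using G01[of s] that by (cases "t \<le> a") (auto simp: G_def)
    next
      case 3
      then show ?thesis using monoD[OF h(1) \<phi>_anti[of s t]] that by (simp add: G_def)
    qed
  qed
  then have G: "mono G" by (rule monoI)
  \<comment> \<open>Since \<open>\<phi>\<close> drops right after such a time and never rises, it is
    injective on \<open>B\<close>; hence \<open>B\<close> is finite.\<close>
  define B where "B = {t. a < t \<and> t < b \<and> \<phi> t \<in> E \<and> (\<exists>d. d < 0 \<and> (\<phi> has_real_derivative d) (at t within {a..b}))}"
  have neq: "\<phi> t \<noteq> \<phi> s" if st: "t \<in> B" "s \<in> B" "t < s" for s t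
  proof
    assume eq: "\<phi> t = \<phi> s"
    obtain d where d: "d < 0" "(\<phi> has_real_derivative d) (at t within {a..b})" using st(1) by (auto simp: B_def)
    have t: "a < t" "t < b" "s < b" using st by (auto simp: B_def)
    obtain k where k: "k > 0" "\<And>z. t < z \<Longrightarrow> z < t + k \<Longrightarrow> z < b \<and> \<phi> t - 1 < \<phi> z \<and> - d / 2 * (z - t) \<le> \<phi> t - \<phi> z"
      using decrease_right_if_deriv_neg[OF d(2,1), of 1] t by auto
    define z where "z = t + min k (s - t) / 2"
    have z: "t < z" "z < t + k" "z < s" using k(1) st(3) by (auto simp: z_def min_def field_simps)
    have "0 < - d / 2 * (z - t)" using d(1) z(1) by (simp add: mult_neg_pos)
    then have "\<phi> z < \<phi> t" using k(2)[OF z(1,2)] by linarith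
    then show False using \<phi>_anti[of z s] eq z t by simp
  qed
  have "inj_on \<phi> B" by (rule linorder_inj_onI') (use neq in blast)
  moreover have "\<phi> ` B \<subseteq> E" by (auto simp: B_def)
  ultimately have finB: "finite B" using E by (meson finite_imageD finite_subset)
  define N where "N = B \<union> {a, b}"
  have "AE t in lebesgue. t \<notin> N"
    by (rule AE_not_in) (use finB in \<open>auto simp: N_def negligible_iff_null_sets[symmetric]\<close>)
  then have "AE t in lebesgue. t \<in> {a..b} \<longrightarrow> t \<notin> N" by eventually_elim simp
  then have ae3: "AE t in lebesgue_on {a..b}. t \<notin> N" by (simp add: AE_restrict_space_iff)
  have "AE t in lebesgue_on {a..b}. t \<in> {a..b}" by (rule AE_I2) simp
  with ae1 ae2 ae3 have "AE t in lebesgue_on {a..b}. \<exists>d>0. \<forall>s. t < s \<and> s < t + d \<longrightarrow> speed t * (s - t) \<le> 8 * (G s - G t)"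
  proof eventually_elim
    case (elim t)
    then have t: "a < t" "t < b" by (auto simp: N_def)
    show ?case
    proof (cases "speed t = 0")
      \<comment> \<open>A curve may rest at an exceptional level for a set of times of positive
        measure; there monotonicity of \<open>G\<close> is enough.\<close>
      case True
      then show ?thesis using monoD[OF G] by (auto intro: exI[of _ 1])
    next
      case False
      then have l: "speed t > 0" by (simp add: speed_def)
      obtain d where d: "(\<phi> has_real_derivative d) (at t within {a..b})" "ereal d \<le> - ((limiting_slope f (\<gamma> t))\<^sup>2)"
        using elim by blast
      have ls: "limiting_slope f (\<gamma> t) = ereal (speed t)" using elim by simp
      have dl: "d \<le> - (speed t)\<^sup>2" using d(2) unfolding ls by simp
      then have d0: "d < 0" using l by (smt (verit) zero_less_power)
      then have "\<phi> t \<notin> E" using elim t d(1) by (auto simp: B_def N_def)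
      \<comment> \<open>The limiting slope equals the speed; doubling the positive speed yields the
        strict inequality required.\<close>
      moreover have "\<exists>r1. \<bar>r1 - \<phi> t\<bar> < e \<and> attains f R r1 (2 * speed t)" if "e > 0" for e
        using attains_if_limiting_slope_less[of f "\<gamma> t" "2 * speed t" "\<phi> t" R e] ls l fin[OF t] R[of t] t that by simp
      ultimately obtain e where e: "e > 0"
         "\<And>r'. \<phi> t - e < r' \<Longrightarrow> r' < \<phi> t \<Longrightarrow> \<phi> t - r' \<le> 2 * (2 * speed t) * (h (\<phi> t) - h r')"
        using des by blast
      obtain k where k: "k > 0" "\<And>s. t < s \<Longrightarrow> s < t + k \<Longrightarrow> s < b \<and> \<phi> t - e < \<phi> s \<and> - d / 2 * (s - t) \<le> \<phi> t - \<phi> s"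
        using decrease_right_if_deriv_neg[OF d(1) d0 _ t(2) e(1)] t by auto
      have "speed t * (s - t) \<le> 8 * (G s - G t)" if s: "t < s" "s < t + k" for s
      proof -
        have sb: "s < b" "\<phi> t - e < \<phi> s" "- d / 2 * (s - t) \<le> \<phi> t - \<phi> s" using k(2)[OF s] by auto
        have "(speed t)\<^sup>2 / 2 * (s - t) \<le> - d / 2 * (s - t)" using dl s(1) by (intro mult_right_mono) auto
        then have 1: "(speed t)\<^sup>2 / 2 * (s - t) \<le> \<phi> t - \<phi> s" using sb(3) by linarith
        have "(speed t)\<^sup>2 / 2 * (s - t) > 0" using l s(1) by simp
        then have "\<phi> s < \<phi> t" using 1 by linarith
        then have "(speed t)\<^sup>2 / 2 * (s - t) \<le> 4 * speed t * (h (\<phi> t) - h (\<phi> s))" using e(2)[OF sb(2)] 1 by simp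
        \<comment> \<open>One power of the speed cancels. The constant 8 collects a factor 2 each
          from the near-minimal slope of the talweg, the doubled speed and the halved
          derivative.\<close>
        then have "(speed t / 2) * (speed t * (s - t)) \<le> (speed t / 2) * (8 * (h (\<phi> t) - h (\<phi> s)))"
          by (simp add: power2_eq_square field_simps)
        then have "speed t * (s - t) \<le> 8 * (h (\<phi> t) - h (\<phi> s))" using l by (subst (asm) mult_le_cancel_left_pos) auto
        then show ?thesis using t s sb(1) by (simp add: G_def)
      qed
      then show ?thesis using k(1) by blast
    qed
  qed
  then show ?thesis unfolding curve_length_def speed_def[symmetric]
    by (intro nn_integral_le_by_increments[OF G G01 ab]) auto
qed

theorem theorem4p18:
  fixes f :: "real ^ 'n \<Rightarrow> ereal" and U :: "(real ^ 'n) set"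
  assumes "lower_semicontinuous f"
    and "semialgebraic_function f"
    and "bounded U"
  shows "\<exists>N::real. N > 0 \<and>
    (\<forall>a b \<gamma>. near_maximal_slope_curve f a b \<gamma> \<and> \<gamma> ` {a..b} \<subseteq> U
       \<longrightarrow> curve_length a b \<gamma> \<le> ennreal N)"
proof -
  obtain R where R: "\<And>x. x \<in> U \<Longrightarrow> norm x < R"
    using assms(3) unfolding bounded_pos_less by blast
  obtain E h K where *: "finite E" "mono h" "\<And>r. 0 \<le> h r" "\<And>r. h r \<le> K"
    "\<And>r c. r \<notin> E \<Longrightarrow> (\<And>e. e > 0 \<Longrightarrow> \<exists>r1. \<bar>r1 - r\<bar> < e \<and> attains f R r1 c) \<Longrightarrow>
      \<exists>d>0. \<forall>r'. r - d < r' \<and> r' < r \<longrightarrow> r - r' \<le> 2 * c * (h r - h r')"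
    using desingularization[OF assms(2), of R] by blast
  have "K \<ge> 0" using *(3,4) order_trans by blast
  \<comment> \<open>The summand 1 makes the bound positive even if \<open>K = 0\<close>.\<close>
  have "curve_length a b \<gamma> \<le> ennreal (8 * K + 1)"
    if "near_maximal_slope_curve f a b \<gamma>" "\<gamma> ` {a..b} \<subseteq> U" for a b \<gamma>
  proof -
    have "norm (\<gamma> t) < R" if "t \<in> {a..b}" for t using R \<open>\<gamma> ` {a..b} \<subseteq> U\<close> that by blast
    then have "curve_length a b \<gamma> \<le> ennreal (8 * K)"
      using near_maximal_slope_curve_length_le[OF * that(1)] by blast
    also have "\<dots> \<le> ennreal (8 * K + 1)" by (intro ennreal_leI) simp
    finally show ?thesis .
  qed
  then show ?thesis using \<open>K \<ge> 0\<close> by (intro exI[of _ "8 * K + 1"]) auto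
qed

end
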